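(* Without assuming propositional resizing, the Scott interpretation of PCF types can be typed as a function \[[\![-]\!]:\text{PCF types}\to\mathcal U_0\text{-}(\mathsf{DCPO}_\bot)_{\mathcal U_1,\mathcal U_1}.\] That is, every $[\![\sigma]\!]$ is a $\mathcal U_0$-directed complete poset with a least element, whose underlying type lies in $\mathcal U_1$ and whose order takes values in $\mathcal U_1$.
   Context: The ambient theory is intensional Martin-Löf type theory with function extensionality, propositional extensionality, propositional truncation $\|-\|$, and universes $\mathcal U_0:\mathcal U_1$ closed under $+,\Sigma,\Pi$, with $\mathbf 0,\mathbf 1,\mathbb N:\mathcal U_0$. No propositional resizing is assumed. $\Omega$ is the type of propositions in $\mathcal U_0$ (so $\Omega:\mathcal U_1$). A family $u:I\to X$ in a poset is directed if $\|I\|$ holds and $\prod_{i,j}\|\sum_k u_i\le u_k\times u_j\le u_k\|$. A poset is a set with a proposition-valued reflexive, antisymmetric, transitive order. $\mathcal W\text{-}(\mathsf{DCPO}_\bot)_{\mathcal U,\mathcal V}$ is the type of posets with a least element that have least upper bounds of all directed families indexed by types in $\mathcal W$, whose underlying type is in $\mathcal U$ and whose order takes values in $\mathcal V$. PCF types are $\iota$ and $\sigma\Rightarrow\tau$. The interpretation is $[\![\iota]\!]:=\mathcal L(\mathbb N)=\sum_{P:\Omega}(P\to\mathbb N)$, ordered by $l\sqsubseteq m:=(\mathsf{pr}_1(l)\to l=m)$. Further, $[\![\sigma\Rightarrow\tau]\!]$ is the type of continuous maps $[\![\sigma]\!]\to[\![\tau]\!]$ (maps preserving least upper bounds of directed families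 indexed by types in $\mathcal U_0$), ordered pointwise. *)

theory Defs
  imports Main
begin

text \<open>
  The statement is about the universe levels at which a construction can be carried out in a
  predicative type theory, so the type theory itself is defined here: a deep embedding of
  intensional Martin-Loef type theory with function extensionality, propositional extensionality,
  propositional truncation and two universes, in de Bruijn notation (\<open>Var 0\<close> is the innermost
  variable, contexts are lists with the innermost variable first). In the comments on
  constructors, an argument written \<open>x. t\<close> binds a variable, and \<open>x y. t\<close> binds two, \<open>y\<close> being
  \<open>Var 0\<close>.
\<close>

section \<open>Terms and substitution\<close>

datatype tm =
    Var nat
  | Univ nat
  | Pi tm tm              (* Pi A (x. B) *)
  | Lam tm tm             (* Lam A (x. b) *)
  | App tm tm
  | Sg tm tm              (* Sigma type: Sg A (x. B) *)
  | Pair tm tm tm tm      (* Pair A (x. B) a b *)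
  | Fst tm
  | Snd tm
  | SgInd tm tm tm        (* SgInd (z. C) (x y. d) p *)
  | Plus tm tm
  | Inl tm tm             (* Inl B a : Plus A B *)
  | Inr tm tm             (* Inr A b : Plus A B *)
  | PlusInd tm tm tm tm   (* PlusInd (z. C) (x. l) (y. r) s *)
  | EmptyT
  | EmptyInd tm tm        (* EmptyInd (z. C) e *)
  | UnitT
  | Star
  | UnitInd tm tm tm      (* UnitInd (z. C) d u *)
  | NatT
  | Zero
  | Succ tm
  | NatInd tm tm tm tm    (* NatInd (z. C) d (n h. s) m *)
  | Eq tm tm tm           (* identity type: Eq A a b *)
  | Refl tm
  | J tm tm tm            (* J (x p. C) d q *)
  | Trunc tm
  | TrIn tm
  | TrEq tm tm            (* TrEq s t : Eq (Trunc A) s t *)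
  | TrRec tm tm tm tm     (* TrRec P h f t, where h proves that P is a proposition *)
  | Funext tm tm tm       (* Funext f g h *)
  | Propext tm tm tm tm tm tm  (* Propext P Q hP hQ f g *)
  | PcfT                  (* the inductive type of PCF types *)
  | Iota
  | Arr tm tm
  | PcfInd tm tm tm tm    (* PcfInd (z. C) d (s t hs ht. e) r *)

definition up_ren :: "(nat \<Rightarrow> nat) \<Rightarrow> nat \<Rightarrow> nat" where
  "up_ren r = case_nat 0 (\<lambda>k. Suc (r k))"

primrec ren :: "(nat \<Rightarrow> nat) \<Rightarrow> tm \<Rightarrow> tm" where
  "ren r (Var n) = Var (r n)"
| "ren r (Univ i) = Univ i"
| "ren r (Pi A B) = Pi (ren r A) (ren (up_ren r) B)"
| "ren r (Lam A b) = Lam (ren r A) (ren (up_ren r) b)"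
| "ren r (App f a) = App (ren r f) (ren r a)"
| "ren r (Sg A B) = Sg (ren r A) (ren (up_ren r) B)"
| "ren r (Pair A B a b) = Pair (ren r A) (ren (up_ren r) B) (ren r a) (ren r b)"
| "ren r (Fst p) = Fst (ren r p)"
| "ren r (Snd p) = Snd (ren r p)"
| "ren r (SgInd C d p) = SgInd (ren (up_ren r) C) (ren (up_ren (up_ren r)) d) (ren r p)"
| "ren r (Plus A B) = Plus (ren r A) (ren r B)"
| "ren r (Inl B a) = Inl (ren r B) (ren r a)"
| "ren r (Inr A b) = Inr (ren r A) (ren r b)"
| "ren r (PlusInd C d e s) =
     PlusInd (ren (up_ren r) C) (ren (up_ren r) d) (ren (up_ren r) e) (ren r s)"
| "ren r EmptyT = EmptyT"
| "ren r (EmptyInd C e) = EmptyInd (ren (up_ren r) C) (ren r e)"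
| "ren r UnitT = UnitT"
| "ren r Star = Star"
| "ren r (UnitInd C d u) = UnitInd (ren (up_ren r) C) (ren r d) (ren r u)"
| "ren r NatT = NatT"
| "ren r Zero = Zero"
| "ren r (Succ n) = Succ (ren r n)"
| "ren r (NatInd C d s m) =
     NatInd (ren (up_ren r) C) (ren r d) (ren (up_ren (up_ren r)) s) (ren r m)"
| "ren r (Eq A a b) = Eq (ren r A) (ren r a) (ren r b)"
| "ren r (Refl a) = Refl (ren r a)"
| "ren r (J C d q) = J (ren (up_ren (up_ren r)) C) (ren r d) (ren r q)"
| "ren r (Trunc A) = Trunc (ren r A)"
| "ren r (TrIn a) = TrIn (ren r a)"
| "ren r (TrEq s t) = TrEq (ren r s) (ren r t)"
| "ren r (TrRec P h f t) = TrRec (ren r P) (ren r h) (ren r f) (ren r t)"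
| "ren r (Funext f g h) = Funext (ren r f) (ren r g) (ren r h)"
| "ren r (Propext P Q p q f g) =
     Propext (ren r P) (ren r Q) (ren r p) (ren r q) (ren r f) (ren r g)"
| "ren r PcfT = PcfT"
| "ren r Iota = Iota"
| "ren r (Arr s t) = Arr (ren r s) (ren r t)"
| "ren r (PcfInd C d e t) =
     PcfInd (ren (up_ren r) C) (ren r d)
       (ren (up_ren (up_ren (up_ren (up_ren r)))) e) (ren r t)"

definition lift :: "nat \<Rightarrow> tm \<Rightarrow> tm" where
  "lift n = ren (\<lambda>k. k + n)"

definition up :: "(nat \<Rightarrow> tm) \<Rightarrow> nat \<Rightarrow> tm" where
  "up \<sigma> = case_nat (Var 0) (\<lambda>k. lift 1 (\<sigma> k))"

primrec sub :: "(nat \<Rightarrow> tm) \<Rightarrow> tm \<Rightarrow> tm" where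
  "sub \<sigma> (Var n) = \<sigma> n"
| "sub \<sigma> (Univ i) = Univ i"
| "sub \<sigma> (Pi A B) = Pi (sub \<sigma> A) (sub (up \<sigma>) B)"
| "sub \<sigma> (Lam A b) = Lam (sub \<sigma> A) (sub (up \<sigma>) b)"
| "sub \<sigma> (App f a) = App (sub \<sigma> f) (sub \<sigma> a)"
| "sub \<sigma> (Sg A B) = Sg (sub \<sigma> A) (sub (up \<sigma>) B)"
| "sub \<sigma> (Pair A B a b) = Pair (sub \<sigma> A) (sub (up \<sigma>) B) (sub \<sigma> a) (sub \<sigma> b)"
| "sub \<sigma> (Fst p) = Fst (sub \<sigma> p)"
| "sub \<sigma> (Snd p) = Snd (sub \<sigma> p)"
| "sub \<sigma> (SgInd C d p) = SgInd (sub (up \<sigma>) C) (sub (up (up \<sigma>)) d) (sub \<sigma> p)"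
| "sub \<sigma> (Plus A B) = Plus (sub \<sigma> A) (sub \<sigma> B)"
| "sub \<sigma> (Inl B a) = Inl (sub \<sigma> B) (sub \<sigma> a)"
| "sub \<sigma> (Inr A b) = Inr (sub \<sigma> A) (sub \<sigma> b)"
| "sub \<sigma> (PlusInd C d e s) =
     PlusInd (sub (up \<sigma>) C) (sub (up \<sigma>) d) (sub (up \<sigma>) e) (sub \<sigma> s)"
| "sub \<sigma> EmptyT = EmptyT"
| "sub \<sigma> (EmptyInd C e) = EmptyInd (sub (up \<sigma>) C) (sub \<sigma> e)"
| "sub \<sigma> UnitT = UnitT"
| "sub \<sigma> Star = Star"
| "sub \<sigma> (UnitInd C d u) = UnitInd (sub (up \<sigma>) C) (sub \<sigma> d) (sub \<sigma> u)"
| "sub \<sigma> NatT = NatT"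
| "sub \<sigma> Zero = Zero"
| "sub \<sigma> (Succ n) = Succ (sub \<sigma> n)"
| "sub \<sigma> (NatInd C d s m) =
     NatInd (sub (up \<sigma>) C) (sub \<sigma> d) (sub (up (up \<sigma>)) s) (sub \<sigma> m)"
| "sub \<sigma> (Eq A a b) = Eq (sub \<sigma> A) (sub \<sigma> a) (sub \<sigma> b)"
| "sub \<sigma> (Refl a) = Refl (sub \<sigma> a)"
| "sub \<sigma> (J C d q) = J (sub (up (up \<sigma>)) C) (sub \<sigma> d) (sub \<sigma> q)"
| "sub \<sigma> (Trunc A) = Trunc (sub \<sigma> A)"
| "sub \<sigma> (TrIn a) = TrIn (sub \<sigma> a)"
| "sub \<sigma> (TrEq s t) = TrEq (sub \<sigma> s) (sub \<sigma> t)"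
| "sub \<sigma> (TrRec P h f t) = TrRec (sub \<sigma> P) (sub \<sigma> h) (sub \<sigma> f) (sub \<sigma> t)"
| "sub \<sigma> (Funext f g h) = Funext (sub \<sigma> f) (sub \<sigma> g) (sub \<sigma> h)"
| "sub \<sigma> (Propext P Q p q f g) =
     Propext (sub \<sigma> P) (sub \<sigma> Q) (sub \<sigma> p) (sub \<sigma> q) (sub \<sigma> f) (sub \<sigma> g)"
| "sub \<sigma> PcfT = PcfT"
| "sub \<sigma> Iota = Iota"
| "sub \<sigma> (Arr s t) = Arr (sub \<sigma> s) (sub \<sigma> t)"
| "sub \<sigma> (PcfInd C d e t) =
     PcfInd (sub (up \<sigma>) C) (sub \<sigma> d) (sub (up (up (up (up \<sigma>)))) e) (sub \<sigma> t)"

text \<open>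
  \<open>repl n a C\<close> is the type family \<open>C\<close> over \<open>\<Gamma>, z\<close> moved to a context that extends \<open>\<Gamma>\<close> by \<open>n\<close>
  variables, with the term \<open>a\<close> of that context substituted for \<open>z\<close>. In particular \<open>repl 0 a C\<close>
  is the ordinary substitution \<open>C[a/z]\<close>.
\<close>

definition repl :: "nat \<Rightarrow> tm \<Rightarrow> tm \<Rightarrow> tm" where
  "repl n a = sub (case_nat a (\<lambda>k. Var (k + n)))"

text \<open>\<open>inst2 a b t\<close> substitutes \<open>b\<close> for \<open>Var 0\<close> and \<open>a\<close> for \<open>Var 1\<close>.\<close>

definition inst2 :: "tm \<Rightarrow> tm \<Rightarrow> tm \<Rightarrow> tm" where
  "inst2 a b = sub (case_nat b (case_nat a Var))"

definition inst4 :: "tm \<Rightarrow> tm \<Rightarrow> tm \<Rightarrow> tm \<Rightarrow> tm \<Rightarrow> tm" where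
  "inst4 a b c d = sub (case_nat d (case_nat c (case_nat b (case_nat a Var))))"


section \<open>Definitional equality\<close>

text \<open>
  Definitional equality is the congruence generated by the computation rules and the uniqueness
  rule for functions. It is a relation on raw terms, as in pure type systems; it is only used
  between terms that are typed separately (see \<open>ty_conv\<close> and \<open>def_eq\<close> below). Truncation and the two
  extensionality principles do not compute.
\<close>

inductive conv :: "tm \<Rightarrow> tm \<Rightarrow> bool" (infix "\<cong>" 50) where
  conv_refl: "t \<cong> t"
| conv_sym: "t \<cong> u \<Longrightarrow> u \<cong> t"
| conv_trans: "t \<cong> u \<Longrightarrow> u \<cong> v \<Longrightarrow> t \<cong> v"

| beta: "App (Lam A b) a \<cong> repl 0 a b"
| eta: "Lam A (App (lift 1 f) (Var 0)) \<cong> f"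
| fst_pair: "Fst (Pair A B a b) \<cong> a"
| snd_pair: "Snd (Pair A B a b) \<cong> b"
| sg_comp: "SgInd C d (Pair A B a b) \<cong> inst2 a b d"
| inl_comp: "PlusInd C d e (Inl B a) \<cong> repl 0 a d"
| inr_comp: "PlusInd C d e (Inr A b) \<cong> repl 0 b e"
| unit_comp: "UnitInd C d Star \<cong> d"
| zero_comp: "NatInd C d s Zero \<cong> d"
| succ_comp: "NatInd C d s (Succ m) \<cong> inst2 m (NatInd C d s m) s"
| refl_comp: "J C d (Refl a) \<cong> d"
| iota_comp: "PcfInd C d e Iota \<cong> d"
| arr_comp: "PcfInd C d e (Arr s t) \<cong> inst4 s t (PcfInd C d e s) (PcfInd C d e t) e"

| cong_Pi: "A \<cong> A' \<Longrightarrow> B \<cong> B' \<Longrightarrow> Pi A B \<cong> Pi A' B'"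
| cong_Lam: "A \<cong> A' \<Longrightarrow> b \<cong> b' \<Longrightarrow> Lam A b \<cong> Lam A' b'"
| cong_App: "f \<cong> f' \<Longrightarrow> a \<cong> a' \<Longrightarrow> App f a \<cong> App f' a'"
| cong_Sg: "A \<cong> A' \<Longrightarrow> B \<cong> B' \<Longrightarrow> Sg A B \<cong> Sg A' B'"
| cong_Pair: "A \<cong> A' \<Longrightarrow> B \<cong> B' \<Longrightarrow> a \<cong> a' \<Longrightarrow> b \<cong> b' \<Longrightarrow> Pair A B a b \<cong> Pair A' B' a' b'"
| cong_Fst: "p \<cong> p' \<Longrightarrow> Fst p \<cong> Fst p'"
| cong_Snd: "p \<cong> p' \<Longrightarrow> Snd p \<cong> Snd p'"
| cong_SgInd: "C \<cong> C' \<Longrightarrow> d \<cong> d' \<Longrightarrow> p \<cong> p' \<Longrightarrow> SgInd C d p \<cong> SgInd C' d' p'"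
| cong_Plus: "A \<cong> A' \<Longrightarrow> B \<cong> B' \<Longrightarrow> Plus A B \<cong> Plus A' B'"
| cong_Inl: "B \<cong> B' \<Longrightarrow> a \<cong> a' \<Longrightarrow> Inl B a \<cong> Inl B' a'"
| cong_Inr: "A \<cong> A' \<Longrightarrow> b \<cong> b' \<Longrightarrow> Inr A b \<cong> Inr A' b'"
| cong_PlusInd: "C \<cong> C' \<Longrightarrow> d \<cong> d' \<Longrightarrow> e \<cong> e' \<Longrightarrow> s \<cong> s' \<Longrightarrow>
    PlusInd C d e s \<cong> PlusInd C' d' e' s'"
| cong_EmptyInd: "C \<cong> C' \<Longrightarrow> e \<cong> e' \<Longrightarrow> EmptyInd C e \<cong> EmptyInd C' e'"
| cong_UnitInd: "C \<cong> C' \<Longrightarrow> d \<cong> d' \<Longrightarrow> u \<cong> u' \<Longrightarrow> UnitInd C d u \<cong> UnitInd C' d' u'"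
| cong_Succ: "m \<cong> m' \<Longrightarrow> Succ m \<cong> Succ m'"
| cong_NatInd: "C \<cong> C' \<Longrightarrow> d \<cong> d' \<Longrightarrow> s \<cong> s' \<Longrightarrow> m \<cong> m' \<Longrightarrow>
    NatInd C d s m \<cong> NatInd C' d' s' m'"
| cong_Eq: "A \<cong> A' \<Longrightarrow> a \<cong> a' \<Longrightarrow> b \<cong> b' \<Longrightarrow> Eq A a b \<cong> Eq A' a' b'"
| cong_Refl: "a \<cong> a' \<Longrightarrow> Refl a \<cong> Refl a'"
| cong_J: "C \<cong> C' \<Longrightarrow> d \<cong> d' \<Longrightarrow> q \<cong> q' \<Longrightarrow> J C d q \<cong> J C' d' q'"
| cong_Trunc: "A \<cong> A' \<Longrightarrow> Trunc A \<cong> Trunc A'"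
| cong_TrIn: "a \<cong> a' \<Longrightarrow> TrIn a \<cong> TrIn a'"
| cong_TrEq: "s \<cong> s' \<Longrightarrow> t \<cong> t' \<Longrightarrow> TrEq s t \<cong> TrEq s' t'"
| cong_TrRec: "P \<cong> P' \<Longrightarrow> h \<cong> h' \<Longrightarrow> f \<cong> f' \<Longrightarrow> t \<cong> t' \<Longrightarrow> TrRec P h f t \<cong> TrRec P' h' f' t'"
| cong_Funext: "f \<cong> f' \<Longrightarrow> g \<cong> g' \<Longrightarrow> h \<cong> h' \<Longrightarrow> Funext f g h \<cong> Funext f' g' h'"
| cong_Propext: "P \<cong> P' \<Longrightarrow> Q \<cong> Q' \<Longrightarrow> p \<cong> p' \<Longrightarrow> q \<cong> q' \<Longrightarrow> f \<cong> f' \<Longrightarrow> g \<cong> g' \<Longrightarrow>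
    Propext P Q p q f g \<cong> Propext P' Q' p' q' f' g'"
| cong_Arr: "s \<cong> s' \<Longrightarrow> t \<cong> t' \<Longrightarrow> Arr s t \<cong> Arr s' t'"
| cong_PcfInd: "C \<cong> C' \<Longrightarrow> d \<cong> d' \<Longrightarrow> e \<cong> e' \<Longrightarrow> t \<cong> t' \<Longrightarrow>
    PcfInd C d e t \<cong> PcfInd C' d' e' t'"


section \<open>Typing\<close>

definition arrow :: "tm \<Rightarrow> tm \<Rightarrow> tm" where
  "arrow A B = Pi A (lift 1 B)"

definition prod :: "tm \<Rightarrow> tm \<Rightarrow> tm" where
  "prod A B = Sg A (lift 1 B)"

definition is_prop :: "tm \<Rightarrow> tm" where
  "is_prop A = Pi A (Pi (lift 1 A) (Eq (lift 2 A) (Var 1) (Var 0)))"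

text \<open>
  The universes of the theory are \<open>Univ 0 : Univ 1\<close>. They are not cumulative, and a type former
  applied to types in two universes lands in the larger one. \<open>Univ 2\<close> has no type, so it is not a
  universe: the judgement \<open>\<Gamma> \<turnstile> A : Univ 2\<close> only says that \<open>A\<close> is a type which is too large to be in
  \<open>Univ 1\<close>, such as \<open>Univ 1\<close> itself. There is no resizing rule: a type that quantifies over
  \<open>Univ 0\<close> is in \<open>Univ 1\<close> or above even if it is a proposition, and no rule makes it equivalent to a
  type in \<open>Univ 0\<close>.
\<close>

inductive wf_ctx :: "tm list \<Rightarrow> bool"
  and typing :: "tm list \<Rightarrow> tm \<Rightarrow> tm \<Rightarrow> bool" ("_ \<turnstile> _ \<Ztypecolon> _" [51, 51, 51] 50) where
  wf_nil: "wf_ctx []"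
| wf_cons: "wf_ctx \<Gamma> \<Longrightarrow> \<Gamma> \<turnstile> A \<Ztypecolon> Univ i \<Longrightarrow> wf_ctx (A # \<Gamma>)"

| ty_var: "wf_ctx \<Gamma> \<Longrightarrow> n < length \<Gamma> \<Longrightarrow> \<Gamma> \<turnstile> Var n \<Ztypecolon> lift (Suc n) (\<Gamma> ! n)"
| ty_conv: "\<Gamma> \<turnstile> t \<Ztypecolon> A \<Longrightarrow> A \<cong> B \<Longrightarrow> \<Gamma> \<turnstile> B \<Ztypecolon> Univ i \<Longrightarrow> \<Gamma> \<turnstile> t \<Ztypecolon> B"
| ty_Univ: "wf_ctx \<Gamma> \<Longrightarrow> i < 2 \<Longrightarrow> \<Gamma> \<turnstile> Univ i \<Ztypecolon> Univ (Suc i)"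

| ty_Pi: "\<Gamma> \<turnstile> A \<Ztypecolon> Univ i \<Longrightarrow> A # \<Gamma> \<turnstile> B \<Ztypecolon> Univ j \<Longrightarrow> \<Gamma> \<turnstile> Pi A B \<Ztypecolon> Univ (max i j)"
| ty_Lam: "\<Gamma> \<turnstile> A \<Ztypecolon> Univ i \<Longrightarrow> A # \<Gamma> \<turnstile> b \<Ztypecolon> B \<Longrightarrow> \<Gamma> \<turnstile> Lam A b \<Ztypecolon> Pi A B"
| ty_App: "\<Gamma> \<turnstile> f \<Ztypecolon> Pi A B \<Longrightarrow> \<Gamma> \<turnstile> a \<Ztypecolon> A \<Longrightarrow> \<Gamma> \<turnstile> App f a \<Ztypecolon> repl 0 a B"

| ty_Sg: "\<Gamma> \<turnstile> A \<Ztypecolon> Univ i \<Longrightarrow> A # \<Gamma> \<turnstile> B \<Ztypecolon> Univ j \<Longrightarrow> \<Gamma> \<turnstile> Sg A B \<Ztypecolon> Univ (max i j)"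
| ty_Pair: "\<Gamma> \<turnstile> A \<Ztypecolon> Univ i \<Longrightarrow> A # \<Gamma> \<turnstile> B \<Ztypecolon> Univ j \<Longrightarrow> \<Gamma> \<turnstile> a \<Ztypecolon> A \<Longrightarrow> \<Gamma> \<turnstile> b \<Ztypecolon> repl 0 a B \<Longrightarrow>
    \<Gamma> \<turnstile> Pair A B a b \<Ztypecolon> Sg A B"
| ty_Fst: "\<Gamma> \<turnstile> p \<Ztypecolon> Sg A B \<Longrightarrow> \<Gamma> \<turnstile> Fst p \<Ztypecolon> A"
| ty_Snd: "\<Gamma> \<turnstile> p \<Ztypecolon> Sg A B \<Longrightarrow> \<Gamma> \<turnstile> Snd p \<Ztypecolon> repl 0 (Fst p) B"
| ty_SgInd: "Sg A B # \<Gamma> \<turnstile> C \<Ztypecolon> Univ i \<Longrightarrow>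
    B # A # \<Gamma> \<turnstile> d \<Ztypecolon> repl 2 (Pair (lift 2 A) (repl 3 (Var 0) B) (Var 1) (Var 0)) C \<Longrightarrow>
    \<Gamma> \<turnstile> p \<Ztypecolon> Sg A B \<Longrightarrow> \<Gamma> \<turnstile> SgInd C d p \<Ztypecolon> repl 0 p C"

| ty_Plus: "\<Gamma> \<turnstile> A \<Ztypecolon> Univ i \<Longrightarrow> \<Gamma> \<turnstile> B \<Ztypecolon> Univ j \<Longrightarrow> \<Gamma> \<turnstile> Plus A B \<Ztypecolon> Univ (max i j)"
| ty_Inl: "\<Gamma> \<turnstile> a \<Ztypecolon> A \<Longrightarrow> \<Gamma> \<turnstile> B \<Ztypecolon> Univ j \<Longrightarrow> \<Gamma> \<turnstile> Inl B a \<Ztypecolon> Plus A B"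
| ty_Inr: "\<Gamma> \<turnstile> A \<Ztypecolon> Univ i \<Longrightarrow> \<Gamma> \<turnstile> b \<Ztypecolon> B \<Longrightarrow> \<Gamma> \<turnstile> Inr A b \<Ztypecolon> Plus A B"
| ty_PlusInd: "Plus A B # \<Gamma> \<turnstile> C \<Ztypecolon> Univ i \<Longrightarrow>
    A # \<Gamma> \<turnstile> d \<Ztypecolon> repl 1 (Inl (lift 1 B) (Var 0)) C \<Longrightarrow>
    B # \<Gamma> \<turnstile> e \<Ztypecolon> repl 1 (Inr (lift 1 A) (Var 0)) C \<Longrightarrow>
    \<Gamma> \<turnstile> s \<Ztypecolon> Plus A B \<Longrightarrow> \<Gamma> \<turnstile> PlusInd C d e s \<Ztypecolon> repl 0 s C"

| ty_Empty: "wf_ctx \<Gamma> \<Longrightarrow> \<Gamma> \<turnstile> EmptyT \<Ztypecolon> Univ 0"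
| ty_EmptyInd: "EmptyT # \<Gamma> \<turnstile> C \<Ztypecolon> Univ i \<Longrightarrow> \<Gamma> \<turnstile> e \<Ztypecolon> EmptyT \<Longrightarrow>
    \<Gamma> \<turnstile> EmptyInd C e \<Ztypecolon> repl 0 e C"

| ty_Unit: "wf_ctx \<Gamma> \<Longrightarrow> \<Gamma> \<turnstile> UnitT \<Ztypecolon> Univ 0"
| ty_Star: "wf_ctx \<Gamma> \<Longrightarrow> \<Gamma> \<turnstile> Star \<Ztypecolon> UnitT"
| ty_UnitInd: "UnitT # \<Gamma> \<turnstile> C \<Ztypecolon> Univ i \<Longrightarrow> \<Gamma> \<turnstile> d \<Ztypecolon> repl 0 Star C \<Longrightarrow> \<Gamma> \<turnstile> u \<Ztypecolon> UnitT \<Longrightarrow>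
    \<Gamma> \<turnstile> UnitInd C d u \<Ztypecolon> repl 0 u C"

| ty_Nat: "wf_ctx \<Gamma> \<Longrightarrow> \<Gamma> \<turnstile> NatT \<Ztypecolon> Univ 0"
| ty_Zero: "wf_ctx \<Gamma> \<Longrightarrow> \<Gamma> \<turnstile> Zero \<Ztypecolon> NatT"
| ty_Succ: "\<Gamma> \<turnstile> m \<Ztypecolon> NatT \<Longrightarrow> \<Gamma> \<turnstile> Succ m \<Ztypecolon> NatT"
| ty_NatInd: "NatT # \<Gamma> \<turnstile> C \<Ztypecolon> Univ i \<Longrightarrow> \<Gamma> \<turnstile> d \<Ztypecolon> repl 0 Zero C \<Longrightarrow>
    C # NatT # \<Gamma> \<turnstile> s \<Ztypecolon> repl 2 (Succ (Var 1)) C \<Longrightarrow> \<Gamma> \<turnstile> m \<Ztypecolon> NatT \<Longrightarrow>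
    \<Gamma> \<turnstile> NatInd C d s m \<Ztypecolon> repl 0 m C"

| ty_Eq: "\<Gamma> \<turnstile> A \<Ztypecolon> Univ i \<Longrightarrow> \<Gamma> \<turnstile> a \<Ztypecolon> A \<Longrightarrow> \<Gamma> \<turnstile> b \<Ztypecolon> A \<Longrightarrow> \<Gamma> \<turnstile> Eq A a b \<Ztypecolon> Univ i"
| ty_Refl: "\<Gamma> \<turnstile> a \<Ztypecolon> A \<Longrightarrow> \<Gamma> \<turnstile> Refl a \<Ztypecolon> Eq A a a"
| ty_J: "Eq (lift 1 A) (lift 1 a) (Var 0) # A # \<Gamma> \<turnstile> C \<Ztypecolon> Univ i \<Longrightarrow>
    \<Gamma> \<turnstile> d \<Ztypecolon> inst2 a (Refl a) C \<Longrightarrow> \<Gamma> \<turnstile> q \<Ztypecolon> Eq A a b \<Longrightarrow>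
    \<Gamma> \<turnstile> J C d q \<Ztypecolon> inst2 b q C"

| ty_Trunc: "\<Gamma> \<turnstile> A \<Ztypecolon> Univ i \<Longrightarrow> \<Gamma> \<turnstile> Trunc A \<Ztypecolon> Univ i"
| ty_TrIn: "\<Gamma> \<turnstile> a \<Ztypecolon> A \<Longrightarrow> \<Gamma> \<turnstile> TrIn a \<Ztypecolon> Trunc A"
| ty_TrEq: "\<Gamma> \<turnstile> s \<Ztypecolon> Trunc A \<Longrightarrow> \<Gamma> \<turnstile> t \<Ztypecolon> Trunc A \<Longrightarrow> \<Gamma> \<turnstile> TrEq s t \<Ztypecolon> Eq (Trunc A) s t"
| ty_TrRec: "\<Gamma> \<turnstile> P \<Ztypecolon> Univ j \<Longrightarrow> \<Gamma> \<turnstile> h \<Ztypecolon> is_prop P \<Longrightarrow> \<Gamma> \<turnstile> f \<Ztypecolon> arrow A P \<Longrightarrow>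
    \<Gamma> \<turnstile> t \<Ztypecolon> Trunc A \<Longrightarrow> \<Gamma> \<turnstile> TrRec P h f t \<Ztypecolon> P"

| ty_Funext: "\<Gamma> \<turnstile> f \<Ztypecolon> Pi A B \<Longrightarrow> \<Gamma> \<turnstile> g \<Ztypecolon> Pi A B \<Longrightarrow>
    \<Gamma> \<turnstile> h \<Ztypecolon> Pi A (Eq B (App (lift 1 f) (Var 0)) (App (lift 1 g) (Var 0))) \<Longrightarrow>
    \<Gamma> \<turnstile> Funext f g h \<Ztypecolon> Eq (Pi A B) f g"
| ty_Propext: "i < 2 \<Longrightarrow> \<Gamma> \<turnstile> P \<Ztypecolon> Univ i \<Longrightarrow> \<Gamma> \<turnstile> Q \<Ztypecolon> Univ i \<Longrightarrow>
    \<Gamma> \<turnstile> p \<Ztypecolon> is_prop P \<Longrightarrow> \<Gamma> \<turnstile> q \<Ztypecolon> is_prop Q \<Longrightarrow>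
    \<Gamma> \<turnstile> f \<Ztypecolon> arrow P Q \<Longrightarrow> \<Gamma> \<turnstile> g \<Ztypecolon> arrow Q P \<Longrightarrow>
    \<Gamma> \<turnstile> Propext P Q p q f g \<Ztypecolon> Eq (Univ i) P Q"

| ty_Pcf: "wf_ctx \<Gamma> \<Longrightarrow> \<Gamma> \<turnstile> PcfT \<Ztypecolon> Univ 0"
| ty_Iota: "wf_ctx \<Gamma> \<Longrightarrow> \<Gamma> \<turnstile> Iota \<Ztypecolon> PcfT"
| ty_Arr: "\<Gamma> \<turnstile> s \<Ztypecolon> PcfT \<Longrightarrow> \<Gamma> \<turnstile> t \<Ztypecolon> PcfT \<Longrightarrow> \<Gamma> \<turnstile> Arr s t \<Ztypecolon> PcfT"
| ty_PcfInd: "PcfT # \<Gamma> \<turnstile> C \<Ztypecolon> Univ i \<Longrightarrow> \<Gamma> \<turnstile> d \<Ztypecolon> repl 0 Iota C \<Longrightarrow>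
    repl 3 (Var 1) C # repl 2 (Var 1) C # PcfT # PcfT # \<Gamma> \<turnstile> e \<Ztypecolon> repl 4 (Arr (Var 3) (Var 2)) C \<Longrightarrow>
    \<Gamma> \<turnstile> t \<Ztypecolon> PcfT \<Longrightarrow> \<Gamma> \<turnstile> PcfInd C d e t \<Ztypecolon> repl 0 t C"

definition def_eq :: "tm list \<Rightarrow> tm \<Rightarrow> tm \<Rightarrow> tm \<Rightarrow> bool" ("_ \<turnstile> _ \<doteq> _ \<Ztypecolon> _" [51, 51, 51, 51] 50) where
  "\<Gamma> \<turnstile> t \<doteq> u \<Ztypecolon> A \<longleftrightarrow> \<Gamma> \<turnstile> t \<Ztypecolon> A \<and> \<Gamma> \<turnstile> u \<Ztypecolon> A \<and> t \<cong> u"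


section \<open>Domain theory inside the type theory\<close>

text \<open>
  The following functions build terms of the type theory. \<open>X\<close> is the underlying type, \<open>r\<close> the
  order, and \<open>u : I \<rightarrow> X\<close> a family; in the comments \<open>\<le>\<close> stands for \<open>r\<close>.
\<close>

definition rel :: "tm \<Rightarrow> tm \<Rightarrow> tm \<Rightarrow> tm" where
  "rel r x y = App (App r x) y"

definition is_set :: "tm \<Rightarrow> tm" where
  "is_set X = Pi X (Pi (lift 1 X) (is_prop (Eq (lift 2 X) (Var 1) (Var 0))))"

definition is_poset :: "tm \<Rightarrow> tm \<Rightarrow> tm" where
  "is_poset X r =
    prod (is_set X)
   (prod (Pi X (Pi (lift 1 X) (is_prop (rel (lift 2 r) (Var 1) (Var 0)))))
   (prod (Pi X (rel (lift 1 r) (Var 0) (Var 0)))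
   (prod (Pi X (Pi (lift 1 X)
           (arrow (rel (lift 2 r) (Var 1) (Var 0))
           (arrow (rel (lift 2 r) (Var 0) (Var 1))
             (Eq (lift 2 X) (Var 1) (Var 0))))))
         (Pi X (Pi (lift 1 X) (Pi (lift 2 X)
           (arrow (rel (lift 3 r) (Var 2) (Var 1))
           (arrow (rel (lift 3 r) (Var 1) (Var 0))
             (rel (lift 3 r) (Var 2) (Var 0))))))))))"

definition has_least :: "tm \<Rightarrow> tm \<Rightarrow> tm" where
  "has_least X r = Sg X (Pi (lift 1 X) (rel (lift 2 r) (Var 1) (Var 0)))"

(* |I| and, for all i j : I, | Sigma k : I. u i \<le> u k and u j \<le> u k | *)
definition is_directed :: "tm \<Rightarrow> tm \<Rightarrow> tm \<Rightarrow> tm" where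
  "is_directed r I u =
    prod (Trunc I)
      (Pi I (Pi (lift 1 I) (Trunc (Sg (lift 2 I)
        (prod (rel (lift 3 r) (App (lift 3 u) (Var 2)) (App (lift 3 u) (Var 0)))
              (rel (lift 3 r) (App (lift 3 u) (Var 1)) (App (lift 3 u) (Var 0))))))))"

definition is_upper_bound :: "tm \<Rightarrow> tm \<Rightarrow> tm \<Rightarrow> tm \<Rightarrow> tm" where
  "is_upper_bound r I u x = Pi I (rel (lift 1 r) (App (lift 1 u) (Var 0)) (lift 1 x))"

definition is_lub :: "tm \<Rightarrow> tm \<Rightarrow> tm \<Rightarrow> tm \<Rightarrow> tm \<Rightarrow> tm" where
  "is_lub X r I u x =
    prod (is_upper_bound r I u x)
      (Pi X (arrow (is_upper_bound (lift 1 r) (lift 1 I) (lift 1 u) (Var 0))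
                   (rel (lift 1 r) (lift 1 x) (Var 0))))"

definition directed_complete :: "nat \<Rightarrow> tm \<Rightarrow> tm \<Rightarrow> tm" where
  "directed_complete w X r =
    Pi (Univ w) (Pi (arrow (Var 0) (lift 1 X))
      (arrow (is_directed (lift 2 r) (Var 1) (Var 0))
        (Sg (lift 2 X) (is_lub (lift 3 X) (lift 3 r) (Var 2) (Var 1) (Var 0)))))"

text \<open>
  \<open>DCPO_bot w u v\<close> is the type \<open>U\<^sub>w-(DCPO\<^sub>\<bottom>)\<close> with underlying types in \<open>U\<^sub>u\<close> and orders valued in
  \<open>U\<^sub>v\<close>.
\<close>

definition DCPO_bot :: "nat \<Rightarrow> nat \<Rightarrow> nat \<Rightarrow> tm" where
  "DCPO_bot w u v =
    Sg (Univ u) (Sg (arrow (Var 0) (arrow (Var 0) (Univ v)))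
      (prod (is_poset (Var 1) (Var 0))
      (prod (has_least (Var 1) (Var 0))
            (directed_complete w (Var 1) (Var 0)))))"

definition carrier :: "tm \<Rightarrow> tm" where
  "carrier D = Fst D"

definition order :: "tm \<Rightarrow> tm" where
  "order D = Fst (Snd D)"

definition Omega :: tm where
  "Omega = Sg (Univ 0) (is_prop (Var 0))"

text \<open>The lifting \<open>L(N)\<close>. The first projection of a partial element is an element of \<open>Omega\<close>,
  so its underlying type is a second \<open>Fst\<close> away.\<close>

definition lift_nat :: tm where
  "lift_nat = Sg Omega (arrow (Fst (Var 0)) NatT)"

definition lift_nat_order :: tm where
  "lift_nat_order =
    Lam lift_nat (Lam (lift 1 lift_nat)
      (arrow (Fst (Fst (Var 1))) (Eq (lift 2 lift_nat) (Var 1) (Var 0))))"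

(* for all I : U_0, u : I \<rightarrow> X directed and x : X, if x is a least upper bound of u,
   then f x is a least upper bound of i \<mapsto> f (u i) *)
definition is_continuous :: "tm \<Rightarrow> tm \<Rightarrow> tm \<Rightarrow> tm \<Rightarrow> tm \<Rightarrow> tm" where
  "is_continuous X r Y s f =
    Pi (Univ 0) (Pi (arrow (Var 0) (lift 1 X))
      (arrow (is_directed (lift 2 r) (Var 1) (Var 0))
        (Pi (lift 2 X)
          (arrow (is_lub (lift 3 X) (lift 3 r) (Var 2) (Var 1) (Var 0))
                 (is_lub (lift 3 Y) (lift 3 s) (Var 2)
                   (Lam (Var 2) (App (lift 4 f) (App (Var 2) (Var 0))))
                   (App (lift 3 f) (Var 0)))))))"

definition cont_maps :: "tm \<Rightarrow> tm \<Rightarrow> tm" where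
  "cont_maps D E =
    Sg (arrow (carrier D) (carrier E))
       (is_continuous (lift 1 (carrier D)) (lift 1 (order D))
                      (lift 1 (carrier E)) (lift 1 (order E)) (Var 0))"

definition pointwise_order :: "tm \<Rightarrow> tm \<Rightarrow> tm" where
  "pointwise_order D E =
    Lam (cont_maps D E) (Lam (lift 1 (cont_maps D E))
      (Pi (lift 2 (carrier D))
        (rel (lift 3 (order E)) (App (Fst (Var 2)) (Var 0)) (App (Fst (Var 1)) (Var 0)))))"

text \<open>
  The clauses of the Scott interpretation, for a closed term \<open>S\<close> on PCF types. They hold
  definitionally; the second clause is stated for two variables \<open>\<sigma>\<close> (\<open>Var 1\<close>) and \<open>\<tau>\<close> (\<open>Var 0\<close>) ranging
  over the type of PCF types, and hence for all its elements. The clauses fix the underlying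
  type and the order, which is all that the definition of the interpretation prescribes.
\<close>

definition scott_iota :: "tm \<Rightarrow> bool" where
  "scott_iota S \<longleftrightarrow>
    [] \<turnstile> carrier (App S Iota) \<doteq> lift_nat \<Ztypecolon> Univ 1 \<and>
    [] \<turnstile> order (App S Iota) \<doteq> lift_nat_order \<Ztypecolon> arrow lift_nat (arrow lift_nat (Univ 1))"

definition scott_arr :: "tm \<Rightarrow> bool" where
  "scott_arr S \<longleftrightarrow>
    (let S' = lift 2 S;
         D = App S' (Var 1);
         E = App S' (Var 0);
         F = App S' (Arr (Var 1) (Var 0))
     in [PcfT, PcfT] \<turnstile> carrier F \<doteq> cont_maps D E \<Ztypecolon> Univ 1 \<and>
        [PcfT, PcfT] \<turnstile> order F \<doteq> pointwise_order D E
          \<Ztypecolon> arrow (cont_maps D E) (arrow (cont_maps D E) (Univ 1)))"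

end

theory Submission
  imports Defs
begin

text \<open>
  \<open>L(N)\<close> is large because it quantifies over the propositions in \<open>Univ 0\<close>. It is a set because the
  relation "same extent and same values" is reflexive, proposition-valued and implies equality. The
  supremum of a directed family \<open>u\<close> has the extent \<open>\<Sigma> n. \<parallel>\<Sigma> i p. u i p = n\<parallel>\<close>, which compares
  values in \<open>N\<close> and not elements of \<open>L(N)\<close> and hence stays in \<open>Univ 0\<close>; it is a proposition since any
  two members of \<open>u\<close> have a common upper bound and therefore the same values. Suprema of continuous
  maps are pointwise. Continuity quantifies over families indexed by types in \<open>Univ 0\<close>, so it is in
  \<open>Univ 1\<close>, and no further universe is needed for iterated exponentials.

  The interpretation is an explicit term. Its typing derivation, which is far too large to be written
  down, is found by a type checker for the theory that is proved sound and run by the simplifier.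
\<close>

section \<open>Renaming and substitution\<close>

text \<open>The clauses have to hold definitionally, so carriers and orders must compute, while the
  proofs about them may stay opaque. Hence only \<open>mk_dcpo\<close>, \<open>nat_dcpo\<close>,
  \<open>arr_dcpo\<close> and \<open>scott\<close> are unfolded again after they have been checked;
  every other theorem acts as a closed constant of known type. Soundness of the checker rests on two
  facts about the raw calculus: typing is stable under substitution, and the components of a
  well-typed type former are well-typed. As conversion is untyped, neither confluence nor uniqueness
  of types enters. Conversion has a uniqueness rule for functions but none for pairs. Extensionality
  for a Sigma type is therefore proved for explicit pairs and transferred by the eliminator. One
  criterion in the spirit of Hedberg's theorem yields all sets: a reflexive, proposition-valued
  relation that implies equality. It is applied to propositions, to N, to L(N) and to antisymmetric
  orders.\<close>

lemma up_simps: "up \<sigma> 0 = Var 0" "up \<sigma> (Suc k) = lift 1 (\<sigma> k)" by (simp_all add: up_def)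
lemma up_ren_simps: "up_ren r 0 = 0" "up_ren r (Suc k) = Suc (r k)" by (simp_all add: up_ren_def)

lemma up_ren_comp: "up_ren r \<circ> up_ren s = up_ren (r \<circ> s)"
  by (rule ext) (simp add: up_ren_def split: nat.split)
text \<open>The composition laws come in the order \<open>ren_ren\<close>, \<open>sub_ren\<close>,
  \<open>ren_sub\<close>, \<open>sub_sub\<close>: passing a binder introduces \<open>up\<close>,
  which is built from \<open>lift\<close>, and the last two laws need the commutation with
  \<open>lift\<close> that the earlier ones supply.\<close>

lemma ren_ren: "ren r (ren s t) = ren (r \<circ> s) t"
  by (induction t arbitrary: r s) (simp_all add: up_ren_comp)

lemma up_comp_up_ren: "up \<sigma> \<circ> up_ren r = up (\<sigma> \<circ> r)"
  by (rule ext) (simp add: up_def up_ren_def split: nat.split)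
lemma sub_ren: "sub \<sigma> (ren r t) = sub (\<sigma> \<circ> r) t"
  by (induction t arbitrary: \<sigma> r) (simp_all add: up_comp_up_ren)

lemma ren_lift: "ren (up_ren r) (lift 1 t) = lift 1 (ren r t)"
  by (simp add: lift_def ren_ren comp_def up_ren_simps)
lemma ren_comp_up: "ren (up_ren r) \<circ> up \<sigma> = up (ren r \<circ> \<sigma>)"
  by (rule ext) (simp add: up_def up_ren_simps ren_lift[unfolded One_nat_def] split: nat.split)
lemma ren_sub: "ren r (sub \<sigma> t) = sub (ren r \<circ> \<sigma>) t"
  by (induction t arbitrary: \<sigma> r) (simp_all add: ren_comp_up)

lemma sub_up_lift: "sub (up \<sigma>) (lift 1 t) = lift 1 (sub \<sigma> t)"
  by (simp add: lift_def sub_ren ren_sub comp_def up_simps)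
lemma sub_comp_up: "sub (up \<tau>) \<circ> up \<sigma> = up (sub \<tau> \<circ> \<sigma>)"
proof (rule ext)
  fix k show "(sub (up \<tau>) \<circ> up \<sigma>) k = up (sub \<tau> \<circ> \<sigma>) k"
    by (cases k) (simp_all add: up_simps sub_up_lift[unfolded One_nat_def])
qed
lemma sub_sub: "sub \<tau> (sub \<sigma> t) = sub (sub \<tau> \<circ> \<sigma>) t"
  by (induction t arbitrary: \<sigma> \<tau>) (simp_all add: sub_comp_up)

lemma up_Var: "up Var = Var"
  by (rule ext) (simp add: up_def lift_def split: nat.split)
lemma sub_Var: "sub Var t = t"
  by (induction t) (simp_all add: up_Var)
lemma ren_eq_sub: "ren r t = sub (Var \<circ> r) t"
  by (metis sub_Var sub_ren)

lemma lift_Var: "lift n (Var k) = Var (k + n)" by (simp add: lift_def)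
lemma lift_eq_sub: "lift n t = sub (\<lambda>k. Var (k + n)) t"
  by (simp add: lift_def ren_eq_sub comp_def)

lemma upn_add: "(up ^^ n) \<sigma> (k + n) = lift n (\<sigma> k)"
  by (induction n) (simp_all add: lift_def ren_ren comp_def up_simps ren_eq_sub[of "\<lambda>k. k"]
    sub_Var flip: fun_eq_iff)

lemma sub_upn_lift: "sub ((up ^^ n) \<sigma>) (lift n t) = lift n (sub \<sigma> t)"
  by (simp add: lift_def sub_ren ren_sub comp_def upn_add)

text \<open>The motive \<open>C\<close> lives over one variable beyond the base context, while
  \<open>a\<close> and the result live over \<open>n\<close> further ones. So
  \<open>\<sigma>\<close> passes one binder in \<open>C\<close> and \<open>n\<close> binders in
  \<open>a\<close>; this is the shape of the branches of an eliminator.\<close>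

lemma sub_repl: "sub ((up ^^ n) \<sigma>) (repl n a C) = repl n (sub ((up ^^ n) \<sigma>) a) (sub (up \<sigma>) C)"
  unfolding repl_def sub_sub
proof (rule arg_cong[where f = "\<lambda>s. sub s C"], rule ext)
  fix k show "(sub ((up ^^ n) \<sigma>) \<circ> case_nat a (\<lambda>k. Var (k + n))) k =
      (sub (case_nat (sub ((up ^^ n) \<sigma>) a) (\<lambda>k. Var (k + n))) \<circ> up \<sigma>) k"
    by (cases k) (simp_all add: upn_add up_simps lift_eq_sub sub_sub comp_def)
qed

lemma sub_inst2: "sub \<sigma> (inst2 a b t) = inst2 (sub \<sigma> a) (sub \<sigma> b) (sub (up (up \<sigma>)) t)"
  unfolding inst2_def sub_sub
proof (rule arg_cong[where f = "\<lambda>s. sub s t"], rule ext)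
  fix k show "(sub \<sigma> \<circ> case_nat b (case_nat a Var)) k =
      (sub (case_nat (sub \<sigma> b) (case_nat (sub \<sigma> a) Var)) \<circ> up (up \<sigma>)) k"
    by (auto simp: up_simps lift_def sub_ren ren_ren comp_def sub_Var split: nat.split simp: up_def)
qed

lemma sub_inst4: "sub \<sigma> (inst4 a b c d t) =
    inst4 (sub \<sigma> a) (sub \<sigma> b) (sub \<sigma> c) (sub \<sigma> d) (sub (up (up (up (up \<sigma>)))) t)"
  unfolding inst4_def sub_sub
proof (rule arg_cong[where f = "\<lambda>s. sub s t"], rule ext)
  fix k show "(sub \<sigma> \<circ> case_nat d (case_nat c (case_nat b (case_nat a Var)))) k =
      (sub (case_nat (sub \<sigma> d) (case_nat (sub \<sigma> c) (case_nat (sub \<sigma> b) (case_nat (sub \<sigma> a) Var)))) \<circ>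
       up (up (up (up \<sigma>)))) k"
    by (auto simp: up_simps lift_def sub_ren ren_ren comp_def sub_Var split: nat.split simp: up_def)
qed

text \<open>Each computation rule is mapped to an instance of itself, because \<open>repl\<close>,
  \<open>inst2\<close> and \<open>inst4\<close> commute with substitution; for eta, substituting
  under the binder leaves the weakening of the function intact.\<close>

lemma conv_sub: "t \<cong> u \<Longrightarrow> sub \<sigma> t \<cong> sub \<sigma> u"
proof (induction arbitrary: \<sigma> rule: conv.induct)
  case (beta A b a)
  then show ?case using conv.beta sub_repl[of 0 \<sigma> a b] by simp
next
  case (eta A f)
  then show ?case using conv.eta by (simp add: up_simps sub_up_lift[simplified])
next
  case (conv_trans t u v)
  then show ?case by (meson conv.conv_trans)
next
  case (conv_sym t u)
  then show ?case by (meson conv.conv_sym)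
qed (auto intro: conv.intros simp: sub_repl[of 0, simplified] sub_inst2 sub_inst4)

lemma sub_repls:
  "sub \<sigma> (repl 0 a C) = repl 0 (sub \<sigma> a) (sub (up \<sigma>) C)"
  "sub (up \<sigma>) (repl (Suc 0) a C) = repl (Suc 0) (sub (up \<sigma>) a) (sub (up \<sigma>) C)"
  "sub (up (up \<sigma>)) (repl 2 a C) = repl 2 (sub (up (up \<sigma>)) a) (sub (up \<sigma>) C)"
  "sub (up (up (up \<sigma>))) (repl 3 a C) = repl 3 (sub (up (up (up \<sigma>))) a) (sub (up \<sigma>) C)"
  "sub (up (up (up (up \<sigma>)))) (repl 4 a C) = repl 4 (sub (up (up (up (up \<sigma>)))) a) (sub (up \<sigma>) C)"
  using sub_repl[of 0 \<sigma>] sub_repl[of 1 \<sigma>] sub_repl[of 2 \<sigma>] sub_repl[of 3 \<sigma>] sub_repl[of 4 \<sigma>]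
  by (simp_all add: eval_nat_numeral)
lemma sub_lifts:
  "sub (up \<sigma>) (lift (Suc 0) t) = lift (Suc 0) (sub \<sigma> t)"
  "sub (up (up \<sigma>)) (lift 2 t) = lift 2 (sub \<sigma> t)"
  using sub_upn_lift[of 1 \<sigma>] sub_upn_lift[of 2 \<sigma>] by (simp_all add: eval_nat_numeral)

text \<open>The arrow branch of \<open>PcfInd\<close> refers to its two PCF types as
  \<open>Var 3\<close> and \<open>Var 2\<close>, which must survive four binders; these numerals do
  not match the equations for \<open>Suc\<close>.\<close>

lemma up4_numerals: "up (up (up (up \<sigma>))) 2 = Var 2" "up (up (up (up \<sigma>))) 3 = Var 3"
  by (simp_all add: up_simps lift_def eval_nat_numeral)

lemma sub_arrow: "sub \<sigma> (arrow A B) = arrow (sub \<sigma> A) (sub \<sigma> B)"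
  by (simp add: arrow_def sub_lifts)
lemma sub_is_prop: "sub \<sigma> (is_prop A) = is_prop (sub \<sigma> A)"
  by (simp add: is_prop_def sub_lifts up_simps lift_Var)

lemmas sub_rules = sub_repls sub_lifts sub_inst2 sub_inst4 sub_arrow sub_is_prop up_simps lift_Var
  up4_numerals

section \<open>Stability of typing under a class of substitutions\<close>

text \<open>
  Weakening and substitution are both proved by the induction \<open>typing_stable\<close> below, which is
  parametric in a class \<open>K\<close> of substitutions that is closed under passing a binder. Some typing
  rules have a premise in an extended context but none for the added type, so \<open>subst_ctx\<close> carries
  along that the types in the context can be substituted, too.
\<close>

definition subst_ctx :: "(tm list \<Rightarrow> (nat \<Rightarrow> tm) \<Rightarrow> tm list \<Rightarrow> bool) \<Rightarrow> tm list \<Rightarrow> bool" where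
  "subst_ctx K \<Gamma> \<longleftrightarrow> (\<forall>\<Gamma>1 C \<Gamma>2 \<Delta> \<sigma>. \<Gamma> = \<Gamma>1 @ C # \<Gamma>2 \<longrightarrow> wf_ctx \<Delta> \<longrightarrow> K \<Delta> \<sigma> \<Gamma>2 \<longrightarrow>
    (\<exists>i. \<Delta> \<turnstile> sub \<sigma> C \<Ztypecolon> Univ i))"

lemma subst_ctx_Nil: "subst_ctx K []" by (simp add: subst_ctx_def)
lemma subst_ctx_Cons: "subst_ctx K (C # \<Gamma>) \<longleftrightarrow>
    subst_ctx K \<Gamma> \<and> (\<forall>\<Delta> \<sigma>. wf_ctx \<Delta> \<longrightarrow> K \<Delta> \<sigma> \<Gamma> \<longrightarrow> (\<exists>i. \<Delta> \<turnstile> sub \<sigma> C \<Ztypecolon> Univ i))"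
  unfolding subst_ctx_def
  by (auto simp: Cons_eq_append_conv) blast+

definition sub_stable :: "(tm list \<Rightarrow> (nat \<Rightarrow> tm) \<Rightarrow> tm list \<Rightarrow> bool) \<Rightarrow> tm list \<Rightarrow> tm \<Rightarrow> tm \<Rightarrow> bool" where
  "sub_stable K \<Gamma> t A \<longleftrightarrow> subst_ctx K \<Gamma> \<and> (\<forall>\<Delta> \<sigma>. wf_ctx \<Delta> \<longrightarrow> K \<Delta> \<sigma> \<Gamma> \<longrightarrow> \<Delta> \<turnstile> sub \<sigma> t \<Ztypecolon> sub \<sigma> A)"

lemma sub_stableI:
  "subst_ctx K \<Gamma> \<Longrightarrow> (\<And>\<Delta> \<sigma>. wf_ctx \<Delta> \<Longrightarrow> K \<Delta> \<sigma> \<Gamma> \<Longrightarrow> \<Delta> \<turnstile> sub \<sigma> t \<Ztypecolon> sub \<sigma> A) \<Longrightarrow> sub_stable K \<Gamma> t A"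
  by (simp add: sub_stable_def)

lemmas typing_basic = ty_Univ ty_Plus ty_Inl ty_Inr ty_Empty ty_Unit ty_Star ty_Nat ty_Zero ty_Succ
  ty_App ty_Fst ty_Snd ty_TrRec ty_TrEq ty_Funext[unfolded One_nat_def] ty_Eq ty_Refl ty_Trunc
    ty_TrIn ty_Propext ty_Pcf ty_Iota ty_Arr

text \<open>There are two instances. For renamings the variable condition is the variable rule
  itself, and the result is weakening; for typed substitutions, passing a binder needs that
  weakening.\<close>

locale subst_class =
  fixes K :: "tm list \<Rightarrow> (nat \<Rightarrow> tm) \<Rightarrow> tm list \<Rightarrow> bool"
  assumes K_up: "K \<Delta> \<sigma> \<Gamma> \<Longrightarrow> wf_ctx (sub \<sigma> A # \<Delta>) \<Longrightarrow> K (sub \<sigma> A # \<Delta>) (up \<sigma>) (A # \<Gamma>)"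
    and K_var: "K \<Delta> \<sigma> \<Gamma> \<Longrightarrow> wf_ctx \<Delta> \<Longrightarrow> n < length \<Gamma> \<Longrightarrow>
      \<Delta> \<turnstile> \<sigma> n \<Ztypecolon> sub \<sigma> (lift (Suc n) (\<Gamma> ! n))"
begin

lemma sub_stable0: "sub_stable K \<Gamma> t A \<Longrightarrow> wf_ctx \<Delta> \<Longrightarrow> K \<Delta> \<sigma> \<Gamma> \<Longrightarrow> \<Delta> \<turnstile> sub \<sigma> t \<Ztypecolon> sub \<sigma> A"
  by (simp add: sub_stable_def)

lemma subst_ctx_up:
  "subst_ctx K (C # \<Gamma>) \<Longrightarrow> wf_ctx \<Delta> \<Longrightarrow> K \<Delta> \<sigma> \<Gamma> \<Longrightarrow>
   wf_ctx (sub \<sigma> C # \<Delta>) \<and> K (sub \<sigma> C # \<Delta>) (up \<sigma>) (C # \<Gamma>)"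
  by (metis K_up subst_ctx_Cons wf_cons)

lemma sub_stable1: "sub_stable K (C # \<Gamma>) t A \<Longrightarrow> wf_ctx \<Delta> \<Longrightarrow> K \<Delta> \<sigma> \<Gamma> \<Longrightarrow>
   sub \<sigma> C # \<Delta> \<turnstile> sub (up \<sigma>) t \<Ztypecolon> sub (up \<sigma>) A"
  unfolding sub_stable_def using subst_ctx_up by blast

lemma sub_stable2:
  assumes "sub_stable K (C # D # \<Gamma>) t A" "wf_ctx \<Delta>" "K \<Delta> \<sigma> \<Gamma>"
  shows "sub (up \<sigma>) C # sub \<sigma> D # \<Delta> \<turnstile> sub (up (up \<sigma>)) t \<Ztypecolon> sub (up (up \<sigma>)) A"
proof -
  have "subst_ctx K (D # \<Gamma>)" using assms(1) by (simp add: sub_stable_def subst_ctx_Cons)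
  from subst_ctx_up[OF this assms(2,3)] show ?thesis by (auto intro: sub_stable1[OF assms(1)])
qed

lemma sub_stable4:
  assumes "sub_stable K (B # C # D # E # \<Gamma>) t A" "wf_ctx \<Delta>" "K \<Delta> \<sigma> \<Gamma>"
  shows "sub (up (up (up \<sigma>))) B # sub (up (up \<sigma>)) C # sub (up \<sigma>) D # sub \<sigma> E # \<Delta>
     \<turnstile> sub (up (up (up (up \<sigma>)))) t \<Ztypecolon> sub (up (up (up (up \<sigma>)))) A"
proof -
  have c: "subst_ctx K (E # \<Gamma>)" "subst_ctx K (D # E # \<Gamma>)"
    using assms(1) by (simp_all add: sub_stable_def subst_ctx_Cons)
  from subst_ctx_up[OF c(1) assms(2,3)] have "wf_ctx (sub \<sigma> E # \<Delta>)" "K (sub \<sigma> E # \<Delta>) (up \<sigma>) (E # \<Gamma>)"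
    by auto
  from subst_ctx_up[OF c(2) this] show ?thesis by (auto intro: sub_stable2[OF assms(1)])
qed

lemma sub_stable_ctx: "sub_stable K \<Gamma> t A \<Longrightarrow> subst_ctx K \<Gamma>"
  by (simp add: sub_stable_def)
lemma sub_stable_ctx1: "sub_stable K (C # \<Gamma>) t A \<Longrightarrow> subst_ctx K \<Gamma>"
  by (simp add: sub_stable_def subst_ctx_Cons)

lemma typing_stable:
  shows "wf_ctx \<Gamma> \<Longrightarrow> subst_ctx K \<Gamma>" and "\<Gamma> \<turnstile> t \<Ztypecolon> A \<Longrightarrow> sub_stable K \<Gamma> t A"
proof (induction rule: wf_ctx_typing.inducts)
  case wf_nil
  then show ?case by (simp add: subst_ctx_Nil)
next
  case (wf_cons \<Gamma> A i)
  then show ?case by (auto simp: subst_ctx_Cons sub_stable_def)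
next
  case (ty_var \<Gamma> n)
  then show ?case by (simp add: K_var sub_stable_def)
next
  case (ty_conv \<Gamma> t A B i)
  then show ?case by (simp add: sub_stable_def) (meson conv_sub wf_ctx_typing.ty_conv)
next
  case (ty_Pi \<Gamma> A i B j)
  then show ?case
    using sub_stable0[OF ty_Pi.IH(1)] sub_stable1[OF ty_Pi.IH(2)]
    by (intro sub_stableI) (auto simp: sub_rules dest: sub_stable_ctx sub_stable_ctx1
      intro!: wf_ctx_typing.ty_Pi)
next
  case (ty_Lam \<Gamma> A i b B)
  then show ?case
    using sub_stable0[OF ty_Lam.IH(1)] sub_stable1[OF ty_Lam.IH(2)]
    by (intro sub_stableI) (auto simp: sub_rules dest: sub_stable_ctx sub_stable_ctx1
      intro!: wf_ctx_typing.ty_Lam)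
next
  case (ty_Sg \<Gamma> A i B j)
  then show ?case
    using sub_stable0[OF ty_Sg.IH(1)] sub_stable1[OF ty_Sg.IH(2)]
    by (intro sub_stableI) (auto simp: sub_rules dest: sub_stable_ctx sub_stable_ctx1
      intro!: wf_ctx_typing.ty_Sg)
next
  case (ty_Pair \<Gamma> A i B j a b)
  then show ?case
    using sub_stable0[OF ty_Pair.IH(1)] sub_stable1[OF ty_Pair.IH(2)]
      sub_stable0[OF ty_Pair.IH(3)] sub_stable0[OF ty_Pair.IH(4)]
    by (intro sub_stableI) (auto simp: sub_rules dest: sub_stable_ctx sub_stable_ctx1
      intro!: wf_ctx_typing.ty_Pair)
next
  case (ty_SgInd A B \<Gamma> C i d p)
  then show ?case
    using sub_stable1[OF ty_SgInd.IH(1)] sub_stable2[OF ty_SgInd.IH(2)]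
      sub_stable0[OF ty_SgInd.IH(3)]
    by (intro sub_stableI) (auto simp: sub_rules dest: sub_stable_ctx sub_stable_ctx1
      intro!: wf_ctx_typing.ty_SgInd)
next
  case (ty_PlusInd A B \<Gamma> C i d e s)
  then show ?case
    using sub_stable1[OF ty_PlusInd.IH(1)] sub_stable1[OF ty_PlusInd.IH(2)]
      sub_stable1[OF ty_PlusInd.IH(3)] sub_stable0[OF ty_PlusInd.IH(4)]
    by (intro sub_stableI) (auto simp: sub_rules dest: sub_stable_ctx sub_stable_ctx1
      intro!: wf_ctx_typing.ty_PlusInd)
next
  case (ty_EmptyInd \<Gamma> C i e)
  then show ?case
    using sub_stable1[OF ty_EmptyInd.IH(1)] sub_stable0[OF ty_EmptyInd.IH(2)]
    by (intro sub_stableI) (auto simp: sub_rules dest: sub_stable_ctx sub_stable_ctx1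
      intro!: wf_ctx_typing.ty_EmptyInd)
next
  case (ty_UnitInd \<Gamma> C i d u)
  then show ?case
    using sub_stable1[OF ty_UnitInd.IH(1)] sub_stable0[OF ty_UnitInd.IH(2)]
      sub_stable0[OF ty_UnitInd.IH(3)]
    by (intro sub_stableI) (auto simp: sub_rules dest: sub_stable_ctx sub_stable_ctx1
      intro!: wf_ctx_typing.ty_UnitInd)
next
  case (ty_NatInd \<Gamma> C i d s m)
  then show ?case
    using sub_stable1[OF ty_NatInd.IH(1)] sub_stable0[OF ty_NatInd.IH(2)]
      sub_stable2[OF ty_NatInd.IH(3)] sub_stable0[OF ty_NatInd.IH(4)]
    by (intro sub_stableI) (auto simp: sub_rules dest: sub_stable_ctx sub_stable_ctx1
      intro!: wf_ctx_typing.ty_NatInd)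
next
  case (ty_J A a \<Gamma> C i d q b)
  then show ?case
    using sub_stable2[OF ty_J.IH(1)] sub_stable0[OF ty_J.IH(2)] sub_stable0[OF ty_J.IH(3)]
    by (intro sub_stableI) (auto simp: sub_rules dest: sub_stable_ctx sub_stable_ctx1
      intro!: wf_ctx_typing.ty_J)
next
  case (ty_PcfInd \<Gamma> C i d e t)
  then show ?case
    using sub_stable1[OF ty_PcfInd.IH(1)] sub_stable0[OF ty_PcfInd.IH(2)]
      sub_stable4[OF ty_PcfInd.IH(3)] sub_stable0[OF ty_PcfInd.IH(4)]
    by (intro sub_stableI) (auto simp: sub_rules dest: sub_stable_ctx sub_stable_ctx1
      intro!: wf_ctx_typing.ty_PcfInd)
\<comment> \<open>The remaining rules have all their premises in the unextended context, so the
  induction hypotheses apply directly.\<close>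
qed (rule sub_stableI; simp add: sub_stable_def sub_rules; meson typing_basic)+

end

section \<open>Weakening and the substitution lemma\<close>

lemma wf_ctx_ConsD: "wf_ctx (A # \<Gamma>) \<Longrightarrow> wf_ctx \<Gamma> \<and> (\<exists>i. \<Gamma> \<turnstile> A \<Ztypecolon> Univ i)"
  by (cases rule: wf_ctx.cases) auto

lemma typing_wf_ctx: "\<Gamma> \<turnstile> t \<Ztypecolon> A \<Longrightarrow> wf_ctx \<Gamma>"
  by (induction rule: wf_ctx_typing.inducts(2)[where ?P1.0 = "\<lambda>_. True"]) (auto dest: wf_ctx_ConsD)

text \<open>Formulated by equality of weakened context entries and not by typing: this condition
  passes a binder by computation alone, so weakening can be derived from it without
  circularity.\<close>

definition renaming :: "tm list \<Rightarrow> (nat \<Rightarrow> tm) \<Rightarrow> tm list \<Rightarrow> bool" where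
  "renaming \<Delta> \<sigma> \<Gamma> \<longleftrightarrow> (\<forall>n<length \<Gamma>. \<exists>m<length \<Delta>. \<sigma> n = Var m \<and>
     lift (Suc m) (\<Delta> ! m) = sub \<sigma> (lift (Suc n) (\<Gamma> ! n)))"

lemma lift_Suc: "lift (Suc n) t = lift (Suc 0) (lift n t)"
  by (simp add: lift_def ren_ren comp_def)
lemmas lift_Suc_Suc = lift_Suc[of "Suc n" for n]

interpretation ren: subst_class renaming
proof
  fix \<Delta> \<sigma> \<Gamma> A assume r: "renaming \<Delta> \<sigma> \<Gamma>"
  show "renaming (sub \<sigma> A # \<Delta>) (up \<sigma>) (A # \<Gamma>)"
    unfolding renaming_def
  proof (intro allI impI)
    fix n assume n: "n < length (A # \<Gamma>)"
    show "\<exists>m<length (sub \<sigma> A # \<Delta>). up \<sigma> n = Var m \<and>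
        lift (Suc m) ((sub \<sigma> A # \<Delta>) ! m) = sub (up \<sigma>) (lift (Suc n) ((A # \<Gamma>) ! n))"
    proof (cases n)
      case 0
      then show ?thesis by (auto simp: up_simps sub_lifts intro!: exI[of _ 0])
    next
      case (Suc k)
      with n r obtain m where m: "m < length \<Delta>" "\<sigma> k = Var m"
        "lift (Suc m) (\<Delta> ! m) = sub \<sigma> (lift (Suc k) (\<Gamma> ! k))" by (auto simp: renaming_def)
      have "lift (Suc (Suc m)) (\<Delta> ! m) = sub (up \<sigma>) (lift (Suc (Suc k)) (\<Gamma> ! k))"
        using m(3) by (simp add: lift_Suc_Suc sub_lifts)
      with m Suc show ?thesis by (auto simp: up_simps lift_Var intro!: exI[of _ "Suc m"])
    qed
  qed
next
  fix \<Delta> \<sigma> \<Gamma> n assume "renaming \<Delta> \<sigma> \<Gamma>" "wf_ctx \<Delta>" "n < length \<Gamma>"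
  then show "\<Delta> \<turnstile> \<sigma> n \<Ztypecolon> sub \<sigma> (lift (Suc n) (\<Gamma> ! n))"
    by (metis renaming_def ty_var)
qed

lemma weakening:
  assumes "\<Gamma> \<turnstile> t \<Ztypecolon> A" "wf_ctx (B # \<Gamma>)"
  shows "B # \<Gamma> \<turnstile> lift 1 t \<Ztypecolon> lift 1 A"
proof -
  have "renaming (B # \<Gamma>) (\<lambda>k. Var (k + 1)) \<Gamma>"
    unfolding renaming_def lift_eq_sub[symmetric] by (auto simp: lift_Suc_Suc)
  from ren.sub_stable0[OF ren.typing_stable(2)[OF assms(1)] assms(2) this] show ?thesis
    by (simp add: lift_eq_sub)
qed

definition substitution :: "tm list \<Rightarrow> (nat \<Rightarrow> tm) \<Rightarrow> tm list \<Rightarrow> bool" where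
  "substitution \<Delta> \<sigma> \<Gamma> \<longleftrightarrow> (\<forall>n<length \<Gamma>. \<Delta> \<turnstile> \<sigma> n \<Ztypecolon> sub \<sigma> (lift (Suc n) (\<Gamma> ! n)))"

interpretation sub: subst_class substitution
proof
  fix \<Delta> \<sigma> \<Gamma> A assume s: "substitution \<Delta> \<sigma> \<Gamma>" and w: "wf_ctx (sub \<sigma> A # \<Delta>)"
  show "substitution (sub \<sigma> A # \<Delta>) (up \<sigma>) (A # \<Gamma>)"
    unfolding substitution_def
  proof (intro allI impI)
    fix n assume n: "n < length (A # \<Gamma>)"
    show "sub \<sigma> A # \<Delta> \<turnstile> up \<sigma> n \<Ztypecolon> sub (up \<sigma>) (lift (Suc n) ((A # \<Gamma>) ! n))"
    proof (cases n)
      case 0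
      then show ?thesis using ty_var[OF w, of 0] by (simp add: up_simps sub_lifts)
    next
      case (Suc k)
      with n s have "\<Delta> \<turnstile> \<sigma> k \<Ztypecolon> sub \<sigma> (lift (Suc k) (\<Gamma> ! k))" by (auto simp: substitution_def)
      from weakening[OF this w] show ?thesis
        using Suc by (simp add: up_simps lift_Suc_Suc sub_lifts)
    qed
  qed
qed (simp add: substitution_def)

lemmas typing_sub = sub.sub_stable0[OF sub.typing_stable(2)]

lemma sub_case_lift: "sub (case_nat a \<sigma>) (lift (Suc n) t) = sub \<sigma> (lift n t)"
  by (simp add: lift_def sub_ren comp_def)
lemma sub_lift0: "sub \<sigma> (lift 0 t) = sub \<sigma> t"
  by (simp add: lift_def sub_ren comp_def)

text \<open>\<open>\<Xi>\<close> holds the \<open>n\<close> variables that a branch of an eliminator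
  binds and on which \<open>a\<close> may depend; \<open>n = 0\<close> is the ordinary substitution
  lemma.\<close>

lemma typing_repl:
  assumes "Z # \<Gamma> \<turnstile> t \<Ztypecolon> T" "\<Xi> @ \<Gamma> \<turnstile> a \<Ztypecolon> lift n Z" "length \<Xi> = n"
  shows "\<Xi> @ \<Gamma> \<turnstile> repl n a t \<Ztypecolon> repl n a T"
  unfolding repl_def
proof (rule typing_sub[OF assms(1) typing_wf_ctx[OF assms(2)]], unfold substitution_def, intro
  allI impI)
  fix k assume k: "k < length (Z # \<Gamma>)"
  have "lift n (lift k t) = lift (k + n) t" for k t
    by (simp add: lift_def ren_ren comp_def ac_simps)
  then show "\<Xi> @ \<Gamma> \<turnstile> (case k of 0 \<Rightarrow> a | Suc k \<Rightarrow> Var (k + n))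
      \<Ztypecolon> sub (case_nat a (\<lambda>k. Var (k + n))) (lift (Suc k) ((Z # \<Gamma>) ! k))"
    using k assms(2,3) ty_var[OF typing_wf_ctx[OF assms(2)], of "k - 1 + n"]
    by (cases k) (simp_all add: sub_case_lift sub_lift0 nth_append flip: lift_eq_sub)
qed

lemma lift_0: "lift 0 t = t" by (simp add: lift_eq_sub sub_Var)

lemma typing_inst2:
  assumes "B # A # \<Gamma> \<turnstile> t \<Ztypecolon> T" "\<Gamma> \<turnstile> a \<Ztypecolon> A" "\<Gamma> \<turnstile> b \<Ztypecolon> repl 0 a B"
  shows "\<Gamma> \<turnstile> inst2 a b t \<Ztypecolon> inst2 a b T"
  unfolding inst2_def
proof (rule typing_sub[OF assms(1) typing_wf_ctx[OF assms(2)]], unfold substitution_def, intro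
  allI impI)
  fix n assume n: "n < length (B # A # \<Gamma>)"
  consider "n = 0" | "n = 1" | k where "n = Suc (Suc k)" by (metis One_nat_def not0_implies_Suc)
  then show "\<Gamma> \<turnstile> (case n of 0 \<Rightarrow> b | Suc k \<Rightarrow> (case k of 0 \<Rightarrow> a | Suc k \<Rightarrow> Var k))
      \<Ztypecolon> sub (case_nat b (case_nat a Var)) (lift (Suc n) ((B # A # \<Gamma>) ! n))"
    using n assms(2,3) ty_var[OF typing_wf_ctx[OF assms(2)], of "n - 2"]
    by cases (simp_all add: sub_case_lift sub_lift0 sub_Var repl_def)
qed

text \<open>Inversion by the shape of the subject: \<open>ty_conv\<close> changes the type
  \<open>T\<close> but not the term \<open>t\<close>, so the induction passes through it, and in
  each formation case the premises are the claim.\<close>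

lemma typing_formers:
  "\<Gamma> \<turnstile> t \<Ztypecolon> T \<Longrightarrow>
    (\<forall>A B. t = Pi A B \<longrightarrow> (\<exists>i j. \<Gamma> \<turnstile> A \<Ztypecolon> Univ i \<and> A # \<Gamma> \<turnstile> B \<Ztypecolon> Univ j)) \<and>
    (\<forall>A B. t = Sg A B \<longrightarrow> (\<exists>i j. \<Gamma> \<turnstile> A \<Ztypecolon> Univ i \<and> A # \<Gamma> \<turnstile> B \<Ztypecolon> Univ j)) \<and>
    (\<forall>A a b. t = Eq A a b \<longrightarrow> (\<exists>i. \<Gamma> \<turnstile> A \<Ztypecolon> Univ i) \<and> \<Gamma> \<turnstile> a \<Ztypecolon> A \<and> \<Gamma> \<turnstile> b \<Ztypecolon> A) \<and>
    (\<forall>A. t = Trunc A \<longrightarrow> (\<exists>i. \<Gamma> \<turnstile> A \<Ztypecolon> Univ i))"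
  by (induction rule: wf_ctx_typing.inducts(2)[where ?P1.0 = "\<lambda>_. True"]) auto

definition is_type :: "tm list \<Rightarrow> tm \<Rightarrow> bool" where
  "is_type \<Gamma> A \<longleftrightarrow> (\<exists>i. \<Gamma> \<turnstile> A \<Ztypecolon> Univ i)"

lemma is_type_formers:
  "is_type \<Gamma> (Pi A B) \<Longrightarrow> is_type \<Gamma> A \<and> is_type (A # \<Gamma>) B"
  "is_type \<Gamma> (Sg A B) \<Longrightarrow> is_type \<Gamma> A \<and> is_type (A # \<Gamma>) B"
  "is_type \<Gamma> (Eq A a b) \<Longrightarrow> is_type \<Gamma> A \<and> \<Gamma> \<turnstile> a \<Ztypecolon> A \<and> \<Gamma> \<turnstile> b \<Ztypecolon> A"
  "is_type \<Gamma> (Trunc A) \<Longrightarrow> is_type \<Gamma> A"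
  unfolding is_type_def using typing_formers by blast+

lemma is_type_conv: "\<Gamma> \<turnstile> t \<Ztypecolon> A \<Longrightarrow> A \<cong> B \<Longrightarrow> is_type \<Gamma> B \<Longrightarrow> \<Gamma> \<turnstile> t \<Ztypecolon> B"
  unfolding is_type_def using ty_conv by blast

lemma is_type_repl0: "is_type (A # \<Gamma>) B \<Longrightarrow> \<Gamma> \<turnstile> a \<Ztypecolon> A \<Longrightarrow> is_type \<Gamma> (repl 0 a B)"
  unfolding is_type_def using typing_repl[of A \<Gamma> B "Univ i" "[]" a 0 for i]
    by (fastforce simp: repl_def lift_0)

lemma is_type_inst2: "is_type (B # A # \<Gamma>) T \<Longrightarrow> \<Gamma> \<turnstile> a \<Ztypecolon> A \<Longrightarrow> \<Gamma> \<turnstile> b \<Ztypecolon> repl 0 a B \<Longrightarrow> is_type \<Gamma>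
  (inst2 a b T)"
  unfolding is_type_def using typing_inst2[of B A \<Gamma> T _ a b] by (fastforce simp: inst2_def)

lemma is_type_var:
  assumes "wf_ctx \<Gamma>" "n < length \<Gamma>" shows "is_type \<Gamma> (lift (Suc n) (\<Gamma> ! n))"
  using assms
proof (induction \<Gamma> arbitrary: n rule: list.induct)
  case (Cons A \<Gamma>)
  then obtain i where A: "wf_ctx \<Gamma>" "\<Gamma> \<turnstile> A \<Ztypecolon> Univ i" using wf_ctx_ConsD by blast
  have "is_type \<Gamma> (lift n ((A # \<Gamma>) ! n))"
  proof (cases n)
    case 0
    then show ?thesis using A by (auto simp: is_type_def lift_eq_sub sub_Var)
  next
    case (Suc k)
    then show ?thesis using Cons A by simp
  qed
  then obtain j where "\<Gamma> \<turnstile> lift n ((A # \<Gamma>) ! n) \<Ztypecolon> Univ j" by (auto simp: is_type_def)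
  from weakening[OF this Cons.prems(1)] show ?case
    by (subst lift_Suc) (auto simp: is_type_def lift_def)
qed simp

section \<open>A type checker\<close>

text \<open>Own constants instead of case expressions, so that the simplifier can be given
  congruence rules that evaluate only the scrutinee, and one equation for each head that is expected
  there. Any other head leaves the evaluation stuck, which can only make a check fail.\<close>

definition case_lam :: "tm \<Rightarrow> (tm \<Rightarrow> tm) \<Rightarrow> tm \<Rightarrow> tm" where
  "case_lam t k d = (case t of Lam A b \<Rightarrow> k b | _ \<Rightarrow> d)"
definition case_pair :: "tm \<Rightarrow> (tm \<Rightarrow> tm \<Rightarrow> tm) \<Rightarrow> tm \<Rightarrow> tm" where
  "case_pair t k d = (case t of Pair A B a b \<Rightarrow> k a b | _ \<Rightarrow> d)"
definition case_refl :: "tm \<Rightarrow> tm \<Rightarrow> tm \<Rightarrow> tm" where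
  "case_refl t k d = (case t of Refl a \<Rightarrow> k | _ \<Rightarrow> d)"
definition case_star :: "tm \<Rightarrow> tm \<Rightarrow> tm \<Rightarrow> tm" where
  "case_star t k d = (case t of Star \<Rightarrow> k | _ \<Rightarrow> d)"
definition case_num :: "tm \<Rightarrow> tm \<Rightarrow> (tm \<Rightarrow> tm) \<Rightarrow> tm \<Rightarrow> tm" where
  "case_num t z k d = (case t of Zero \<Rightarrow> z | Succ m \<Rightarrow> k m | _ \<Rightarrow> d)"

lemma case_lam_simps:
  "case_lam (Lam A b) k d = k b"
  "case_lam (Var x) k d = d" "case_lam (App f a) k d = d" "case_lam (Fst f) k d = d"
  "case_lam (Snd f) k d = d" "case_lam (NatInd t1 t2 t3 t4) k d = d" "case_lam (J t1 t2 t3) k d = d"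
  "case_lam (SgInd t1 t2 t3) k d = d" "case_lam (UnitInd t1 t2 t3) k d = d"
  "case_lam (EmptyInd t1 t2) k d = d" "case_lam (TrRec t1 t2 t3 t4) k d = d"
  by (simp_all add: case_lam_def)
lemma case_pair_simps:
  "case_pair (Pair A B a b) kk d = kk a b"
  "case_pair (Var x) kk d = d" "case_pair (App f a) kk d = d" "case_pair (Fst f) kk d = d"
  "case_pair (Snd f) kk d = d" "case_pair (NatInd t1 t2 t3 t4) kk d = d" "case_pair (J t1 t2 t3)
    kk d = d"
  "case_pair (SgInd t1 t2 t3) kk d = d" "case_pair (UnitInd t1 t2 t3) kk d = d"
  "case_pair (EmptyInd t1 t2) kk d = d" "case_pair (TrRec t1 t2 t3 t4) kk d = d"
  by (simp_all add: case_pair_def)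
lemma case_refl_simps:
  "case_refl (Refl a) z d = z"
  "case_refl (Var x) z d = d" "case_refl (App f a) z d = d" "case_refl (Fst f) z d = d"
  "case_refl (Snd f) z d = d" "case_refl (NatInd t1 t2 t3 t4) z d = d" "case_refl (J t1 t2 t3) z
    d = d"
  "case_refl (SgInd t1 t2 t3) z d = d" "case_refl (UnitInd t1 t2 t3) z d = d"
  "case_refl (EmptyInd t1 t2) z d = d" "case_refl (TrRec t1 t2 t3 t4) z d = d"
  "case_refl (Funext t1 t2 t3) z d = d" "case_refl (Propext t1 t2 t3 t4 t5 t6) z d = d" "case_refl
    (TrEq t1 t2) z d = d"
  by (simp_all add: case_refl_def)
lemma case_star_simps:
  "case_star Star z d = z"
  "case_star (Var x) z d = d" "case_star (App f a) z d = d" "case_star (Fst f) z d = d"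
  "case_star (Snd f) z d = d" "case_star (NatInd t1 t2 t3 t4) z d = d" "case_star (J t1 t2 t3) z
    d = d"
  "case_star (SgInd t1 t2 t3) z d = d" "case_star (UnitInd t1 t2 t3) z d = d"
  "case_star (EmptyInd t1 t2) z d = d" "case_star (TrRec t1 t2 t3 t4) z d = d"
  by (simp_all add: case_star_def)
lemma case_num_simps:
  "case_num Zero z k d = z" "case_num (Succ m) z k d = k m"
  "case_num (Var x) z k d = d" "case_num (App f a) z k d = d" "case_num (Fst f) z k d = d"
  "case_num (Snd f) z k d = d" "case_num (NatInd t1 t2 t3 t4) z k d = d" "case_num (J t1 t2 t3) z
    k d = d"
  "case_num (SgInd t1 t2 t3) z k d = d" "case_num (UnitInd t1 t2 t3) z k d = d"
  "case_num (EmptyInd t1 t2) z k d = d" "case_num (TrRec t1 t2 t3 t4) z k d = d"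
  by (simp_all add: case_num_def)

text \<open>The first argument is fuel, which makes the function total on untyped terms; running out
  of it merely stops the reduction and is still sound. Arguments are substituted before they are
  normalized, and formers without a clause are returned as they are.\<close>

fun nf :: "nat \<Rightarrow> tm \<Rightarrow> tm" where
  "nf 0 t = t"
| "nf (Suc n) (Var k) = Var k"
| "nf (Suc n) (Univ i) = Univ i"
| "nf (Suc n) (Pi A B) = Pi (nf n A) (nf n B)"
| "nf (Suc n) (Lam A b) = Lam (nf n A) (nf n b)"
| "nf (Suc n) (App f a) =
     case_lam (nf n f) (\<lambda>b. nf n (repl 0 a b)) (App (nf n f) (nf n a))"
| "nf (Suc n) (Sg A B) = Sg (nf n A) (nf n B)"
| "nf (Suc n) (Pair A B a b) = Pair (nf n A) (nf n B) (nf n a) (nf n b)"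
| "nf (Suc n) (Fst p) = case_pair (nf n p) (\<lambda>a b. a) (Fst (nf n p))"
| "nf (Suc n) (Snd p) = case_pair (nf n p) (\<lambda>a b. b) (Snd (nf n p))"
| "nf (Suc n) (SgInd C d p) =
     case_pair (nf n p) (\<lambda>a b. nf n (inst2 a b d)) (SgInd (nf n C) (nf n d) (nf n p))"
| "nf (Suc n) (UnitInd C d u) =
     case_star (nf n u) (nf n d) (UnitInd (nf n C) (nf n d) (nf n u))"
| "nf (Suc n) (NatInd C d s m) =
     case_num (nf n m) (nf n d) (\<lambda>m. nf n (inst2 m (NatInd C d s m) s))
       (NatInd (nf n C) (nf n d) (nf n s) (nf n m))"
| "nf (Suc n) (J C d q) = case_refl (nf n q) (nf n d) (J (nf n C) (nf n d) (nf n q))"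
| "nf (Suc n) (Succ m) = Succ (nf n m)"
| "nf (Suc n) (Eq A a b) = Eq (nf n A) (nf n a) (nf n b)"
| "nf (Suc n) (Refl a) = Refl (nf n a)"
| "nf (Suc n) (Trunc A) = Trunc (nf n A)"
| "nf (Suc n) (TrIn A) = TrIn (nf n A)"
| "nf (Suc n) EmptyT = EmptyT"
| "nf (Suc n) UnitT = UnitT"
| "nf (Suc n) Star = Star"
| "nf (Suc n) NatT = NatT"
| "nf (Suc n) Zero = Zero"
| "nf (Suc n) PcfT = PcfT"
| "nf (Suc n) t = t"

text \<open>The bound 40 on the depth of the normalization is generous for all terms below.\<close>

definition cv :: "tm \<Rightarrow> tm \<Rightarrow> bool" where
  "cv t u \<longleftrightarrow> t = u \<or> nf 40 t = nf 40 u"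

primrec look :: "tm list \<Rightarrow> nat \<Rightarrow> tm option" where
  "look [] n = None"
| "look (A # \<Gamma>) n = (case n of 0 \<Rightarrow> Some A | Suc m \<Rightarrow> look \<Gamma> m)"

definition univ_of :: "tm \<Rightarrow> nat option" where
  "univ_of A = (case A of Univ i \<Rightarrow> Some i | _ \<Rightarrow> None)"
definition pi_of :: "tm \<Rightarrow> (tm \<times> tm) option" where
  "pi_of A = (case A of Pi A B \<Rightarrow> Some (A, B) | _ \<Rightarrow> None)"
definition sg_of :: "tm \<Rightarrow> (tm \<times> tm) option" where
  "sg_of A = (case A of Sg A B \<Rightarrow> Some (A, B) | _ \<Rightarrow> None)"
definition eq_of :: "tm \<Rightarrow> (tm \<times> tm \<times> tm) option" where
  "eq_of A = (case A of Eq A a b \<Rightarrow> Some (A, a, b) | _ \<Rightarrow> None)"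
definition tr_of :: "tm \<Rightarrow> tm option" where
  "tr_of A = (case A of Trunc A \<Rightarrow> Some A | _ \<Rightarrow> None)"
definition small :: "tm \<Rightarrow> bool" where
  "small A = (case A of Univ i \<Rightarrow> i < 2 | _ \<Rightarrow> True)"

notation Option.bind (infixl "\<bind>" 54)

definition guard :: "bool \<Rightarrow> 'a option \<Rightarrow> 'a option" where
  "guard b x = (if b then x else None)"

text \<open>
  Types are never reduced when the checker looks for a \<open>Pi\<close>, \<open>Sg\<close>, \<open>Eq\<close> or \<open>Trunc\<close>, because a
  reduct would have to be typed again (subject reduction is not available). Instead, a term \<open>t\<close> is
  given the type \<open>T\<close> explicitly by writing the redex \<open>App (Lam T (Var 0)) t\<close>. The test \<open>small\<close>
  rejects terms whose type is \<open>Univ 2\<close>, which is not itself a type.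
\<close>

primrec infer :: "tm list \<Rightarrow> tm \<Rightarrow> tm option" where
  "infer \<Gamma> (Var n) = look \<Gamma> n \<bind> (\<lambda>A. Some (lift (Suc n) A))"
| "infer \<Gamma> (Univ i) = guard (i < 2) (Some (Univ (Suc i)))"
| "infer \<Gamma> (Pi A B) = infer \<Gamma> A \<bind> univ_of \<bind> (\<lambda>i. infer (A # \<Gamma>) B \<bind> univ_of \<bind> (\<lambda>j.
     Some (Univ (max i j))))"
| "infer \<Gamma> (Lam A b) = infer \<Gamma> A \<bind> univ_of \<bind> (\<lambda>i. infer (A # \<Gamma>) b \<bind> (\<lambda>B.
     guard (small B) (Some (Pi A B))))"
| "infer \<Gamma> (App f a) = infer \<Gamma> f \<bind> pi_of \<bind> (\<lambda>(A, B). infer \<Gamma> a \<bind> (\<lambda>A'.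
     guard (cv A' A) (Some (repl 0 a B))))"
| "infer \<Gamma> (Sg A B) = infer \<Gamma> A \<bind> univ_of \<bind> (\<lambda>i. infer (A # \<Gamma>) B \<bind> univ_of \<bind> (\<lambda>j.
     Some (Univ (max i j))))"
| "infer \<Gamma> (Pair A B a b) = infer \<Gamma> A \<bind> univ_of \<bind> (\<lambda>i. infer (A # \<Gamma>) B \<bind> univ_of \<bind> (\<lambda>j.
     infer \<Gamma> a \<bind> (\<lambda>A'. guard (cv A' A) (infer \<Gamma> b \<bind> (\<lambda>B'. guard (cv B' (repl 0 a B))
     (Some (Sg A B)))))))"
| "infer \<Gamma> (Fst p) = infer \<Gamma> p \<bind> sg_of \<bind> (\<lambda>(A, B). Some A)"
| "infer \<Gamma> (Snd p) = infer \<Gamma> p \<bind> sg_of \<bind> (\<lambda>(A, B). Some (repl 0 (Fst p) B))"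
| "infer \<Gamma> (SgInd C d p) = infer \<Gamma> p \<bind> sg_of \<bind> (\<lambda>(A, B).
     infer (Sg A B # \<Gamma>) C \<bind> univ_of \<bind> (\<lambda>i. infer (B # A # \<Gamma>) d \<bind> (\<lambda>D.
     guard (cv D (repl 2 (Pair (lift 2 A) (repl 3 (Var 0) B) (Var 1) (Var 0)) C))
     (Some (repl 0 p C)))))"
| "infer \<Gamma> (Plus A B) = None"
| "infer \<Gamma> (Inl B a) = None"
| "infer \<Gamma> (Inr A b) = None"
| "infer \<Gamma> (PlusInd C d e s) = None"
| "infer \<Gamma> EmptyT = Some (Univ 0)"
| "infer \<Gamma> (EmptyInd C e) = infer (EmptyT # \<Gamma>) C \<bind> univ_of \<bind> (\<lambda>i. infer \<Gamma> e \<bind> (\<lambda>E.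
     guard (cv E EmptyT) (Some (repl 0 e C))))"
| "infer \<Gamma> UnitT = Some (Univ 0)"
| "infer \<Gamma> Star = Some UnitT"
| "infer \<Gamma> (UnitInd C d u) = infer (UnitT # \<Gamma>) C \<bind> univ_of \<bind> (\<lambda>i. infer \<Gamma> d \<bind> (\<lambda>D.
     guard (cv D (repl 0 Star C)) (infer \<Gamma> u \<bind> (\<lambda>U. guard (cv U UnitT) (Some (repl 0 u C))))))"
| "infer \<Gamma> NatT = Some (Univ 0)"
| "infer \<Gamma> Zero = Some NatT"
| "infer \<Gamma> (Succ m) = infer \<Gamma> m \<bind> (\<lambda>M. guard (cv M NatT) (Some NatT))"
| "infer \<Gamma> (NatInd C d s m) = infer (NatT # \<Gamma>) C \<bind> univ_of \<bind> (\<lambda>i. infer \<Gamma> d \<bind> (\<lambda>D.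
     guard (cv D (repl 0 Zero C)) (infer (C # NatT # \<Gamma>) s \<bind> (\<lambda>S.
     guard (cv S (repl 2 (Succ (Var 1)) C)) (infer \<Gamma> m \<bind> (\<lambda>M. guard (cv M NatT)
     (Some (repl 0 m C))))))))"
| "infer \<Gamma> (Eq A a b) = infer \<Gamma> A \<bind> univ_of \<bind> (\<lambda>i. infer \<Gamma> a \<bind> (\<lambda>A'. guard (cv A' A)
     (infer \<Gamma> b \<bind> (\<lambda>B. guard (cv B A) (Some (Univ i))))))"
| "infer \<Gamma> (Refl a) = infer \<Gamma> a \<bind> (\<lambda>A. guard (small A) (Some (Eq A a a)))"
| "infer \<Gamma> (J C d q) = infer \<Gamma> q \<bind> eq_of \<bind> (\<lambda>(A, a, b).
     infer (Eq (lift 1 A) (lift 1 a) (Var 0) # A # \<Gamma>) C \<bind> univ_of \<bind> (\<lambda>i.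
     infer \<Gamma> d \<bind> (\<lambda>D. guard (cv D (inst2 a (Refl a) C)) (Some (inst2 b q C)))))"
| "infer \<Gamma> (Trunc A) = infer \<Gamma> A \<bind> univ_of \<bind> (\<lambda>i. Some (Univ i))"
| "infer \<Gamma> (TrIn a) = infer \<Gamma> a \<bind> (\<lambda>A. guard (small A) (Some (Trunc A)))"
| "infer \<Gamma> (TrEq s t) = infer \<Gamma> s \<bind> tr_of \<bind> (\<lambda>A. infer \<Gamma> t \<bind> (\<lambda>T.
     guard (cv T (Trunc A)) (Some (Eq (Trunc A) s t))))"
| "infer \<Gamma> (TrRec P h f t) = infer \<Gamma> P \<bind> univ_of \<bind> (\<lambda>j. infer \<Gamma> h \<bind> (\<lambda>H.
     guard (cv H (is_prop P)) (infer \<Gamma> t \<bind> tr_of \<bind> (\<lambda>A. infer \<Gamma> f \<bind> (\<lambda>F.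
     guard (cv F (arrow A P)) (Some P))))))"
| "infer \<Gamma> (Funext f g h) = infer \<Gamma> f \<bind> pi_of \<bind> (\<lambda>(A, B). infer \<Gamma> g \<bind> (\<lambda>G.
     guard (cv G (Pi A B)) (infer \<Gamma> h \<bind> (\<lambda>H.
     guard (cv H (Pi A (Eq B (App (lift 1 f) (Var 0)) (App (lift 1 g) (Var 0)))))
     (Some (Eq (Pi A B) f g))))))"
| "infer \<Gamma> (Propext P Q p q f g) = infer \<Gamma> P \<bind> univ_of \<bind> (\<lambda>i. guard (i < 2)
     (infer \<Gamma> Q \<bind> univ_of \<bind> (\<lambda>j. guard (j = i) (infer \<Gamma> p \<bind> (\<lambda>P'. guard (cv P' (is_prop P))
     (infer \<Gamma> q \<bind> (\<lambda>Q'. guard (cv Q' (is_prop Q)) (infer \<Gamma> f \<bind> (\<lambda>F. guard (cv F (arrow P Q))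
     (infer \<Gamma> g \<bind> (\<lambda>G. guard (cv G (arrow Q P)) (Some (Eq (Univ i) P Q)))))))))))))"
| "infer \<Gamma> PcfT = Some (Univ 0)"
| "infer \<Gamma> Iota = Some PcfT"
| "infer \<Gamma> (Arr s t) = infer \<Gamma> s \<bind> (\<lambda>S. guard (cv S PcfT) (infer \<Gamma> t \<bind> (\<lambda>T.
     guard (cv T PcfT) (Some PcfT))))"
| "infer \<Gamma> (PcfInd C d e t) = infer (PcfT # \<Gamma>) C \<bind> univ_of \<bind> (\<lambda>i. infer \<Gamma> d \<bind> (\<lambda>D.
     guard (cv D (repl 0 Iota C))
     (infer (repl 3 (Var 1) C # repl 2 (Var 1) C # PcfT # PcfT # \<Gamma>) e \<bind> (\<lambda>E.
     guard (cv E (repl 4 (Arr (Var 3) (Var 2)) C)) (infer \<Gamma> t \<bind> (\<lambda>T. guard (cv T PcfT)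
     (Some (repl 0 t C))))))))"

section \<open>Soundness of the type checker\<close>

lemma conv_case:
  "(\<And>A b. t = Lam A b \<Longrightarrow> kl b \<cong> u) \<Longrightarrow> d \<cong> u \<Longrightarrow> case_lam t kl d \<cong> u"
  "(\<And>A B a b. t = Pair A B a b \<Longrightarrow> kp a b \<cong> u) \<Longrightarrow> d \<cong> u \<Longrightarrow> case_pair t kp d \<cong> u"
  "(\<And>a. t = Refl a \<Longrightarrow> kr \<cong> u) \<Longrightarrow> d \<cong> u \<Longrightarrow> case_refl t kr d \<cong> u"
  "(t = Star \<Longrightarrow> kr \<cong> u) \<Longrightarrow> d \<cong> u \<Longrightarrow> case_star t kr d \<cong> u"
  "(t = Zero \<Longrightarrow> kr \<cong> u) \<Longrightarrow> (\<And>m. t = Succ m \<Longrightarrow> kl m \<cong> u) \<Longrightarrow> d \<cong> u \<Longrightarrow> case_num t kr kl d \<cong> u"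
  by (cases t; simp add: case_lam_def case_pair_def case_refl_def case_star_def case_num_def)+

lemmas conv_cong = cong_Pi cong_Lam cong_App cong_Sg cong_Pair cong_Fst cong_Snd cong_SgInd
  cong_UnitInd cong_Succ cong_NatInd cong_Eq cong_Refl cong_J cong_Trunc cong_TrIn

lemma nf_conv: "nf n t \<cong> t"
proof (induction n arbitrary: t)
  case (Suc n)
  \<comment> \<open>If \<open>t\<close> is convertible to a redex \<open>t'\<close> that contracts
    to \<open>u\<close>, then normalizing \<open>u\<close> stays convertible to \<open>t\<close>. In
    each case below, \<open>t'\<close> is \<open>t\<close> with its principal argument already
    normalized.\<close>
  have red: "nf n u \<cong> t" if "t' \<cong> u" "t' \<cong> t" for u t t'
    using Suc that by (meson conv_sym conv_trans)
  show ?case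
  proof (cases t)
    case (App f a)
    have "nf n (repl 0 a b) \<cong> App f a" if "nf n f = Lam A b" for A b
      using Suc[of f] that by (intro red[OF beta[of A b a]] cong_App conv_refl) simp
    then show ?thesis using App Suc by (auto intro!: conv_case conv_cong)
  next
    case (Fst p)
    have "a \<cong> Fst p" if "nf n p = Pair A B a b" for A B a b
      using Suc[of p] that by (metis cong_Fst conv_sym conv_trans fst_pair)
    then show ?thesis using Fst Suc by (auto intro!: conv_case conv_cong)
  next
    case (Snd p)
    have "b \<cong> Snd p" if "nf n p = Pair A B a b" for A B a b
      using Suc[of p] that by (metis cong_Snd conv_sym conv_trans snd_pair)
    then show ?thesis using Snd Suc by (auto intro!: conv_case conv_cong)
  next
    case (SgInd C d p)
    have "nf n (inst2 a b d) \<cong> SgInd C d p" if "nf n p = Pair A B a b" for A B a b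
      using Suc[of p] that by (intro red[OF sg_comp[of C d A B a b]] cong_SgInd conv_refl) simp
    then show ?thesis using SgInd Suc by (auto intro!: conv_case conv_cong)
  next
    case (UnitInd C d u)
    have "nf n d \<cong> UnitInd C d u" if "nf n u = Star"
      using Suc[of u] that by (intro red[OF unit_comp[of C d]] cong_UnitInd conv_refl) simp
    then show ?thesis using UnitInd Suc by (auto intro!: conv_case conv_cong)
  next
    case (NatInd C d s m)
    have "nf n d \<cong> NatInd C d s m" if "nf n m = Zero"
      using Suc[of m] that by (intro red[OF zero_comp[of C d s]] cong_NatInd conv_refl) simp
    moreover have "nf n (inst2 m' (NatInd C d s m') s) \<cong> NatInd C d s m" if "nf n m = Succ m'" for
      m'
      using Suc[of m] that by (intro red[OF succ_comp[of C d s m']] cong_NatInd conv_refl) simp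
    ultimately show ?thesis using NatInd Suc by (auto intro!: conv_case conv_cong)
  next
    case (J C d q)
    have "nf n d \<cong> J C d q" if "nf n q = Refl a" for a
      using Suc[of q] that by (intro red[OF refl_comp[of C d a]] cong_J conv_refl) simp
    then show ?thesis using J Suc by (auto intro!: conv_case conv_cong)
  qed (auto intro: conv_cong Suc conv_refl)
qed (simp add: conv_refl)

lemma cv_sound:
  assumes "cv t u" shows "t \<cong> u"
proof (cases "t = u")
  case False
  with assms have "nf 40 t = nf 40 u" unfolding cv_def by blast
  then show ?thesis using nf_conv[of 40 t] nf_conv[of 40 u] conv_sym conv_trans by metis
qed (simp add: conv_refl)

lemma look_eq: "look \<Gamma> n = Some A \<longleftrightarrow> n < length \<Gamma> \<and> \<Gamma> ! n = A"
  by (induction \<Gamma> arbitrary: n) (auto split: nat.split)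

lemma guard_eq: "guard b x = Some y \<longleftrightarrow> b \<and> x = Some y" by (simp add: guard_def)
lemma univ_of_eq: "univ_of A = Some i \<longleftrightarrow> A = Univ i" by (cases A) (simp_all add: univ_of_def)
lemma pi_of_eq: "pi_of A = Some x \<longleftrightarrow> A = Pi (fst x) (snd x)"
  by (cases A; cases x) (auto simp: pi_of_def)
lemma sg_of_eq: "sg_of A = Some x \<longleftrightarrow> A = Sg (fst x) (snd x)"
  by (cases A; cases x) (auto simp: sg_of_def)
lemma eq_of_eq: "eq_of A = Some x \<longleftrightarrow> A = Eq (fst x) (fst (snd x)) (snd (snd x))"
  by (cases A; cases x) (auto simp: eq_of_def)
lemma tr_of_eq: "tr_of A = Some x \<longleftrightarrow> A = Trunc x" by (cases A) (simp_all add: tr_of_def)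

lemmas infer_eqs = Option.bind_eq_Some_conv look_eq guard_eq univ_of_eq pi_of_eq sg_of_eq eq_of_eq
  tr_of_eq

text \<open>The inferred type must itself be a type, because its components become targets of
  \<open>ty_conv\<close>, which demands well-formed targets. \<open>Univ 2\<close>, the level of
  \<open>Univ 1\<close>, is the one exception.\<close>

definition typed :: "tm list \<Rightarrow> tm \<Rightarrow> tm \<Rightarrow> bool" where
  "typed \<Gamma> t A \<longleftrightarrow> \<Gamma> \<turnstile> t \<Ztypecolon> A \<and> (is_type \<Gamma> A \<or> A = Univ 2)"

lemma typing_Univ: "\<Gamma> \<turnstile> t \<Ztypecolon> T \<Longrightarrow> t = Univ i \<Longrightarrow> i < 2"
  by (induction rule: wf_ctx_typing.inducts(2)[where ?P1.0 = "\<lambda>_. True"]) simp_all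

lemma typedI: "\<Gamma> \<turnstile> t \<Ztypecolon> A \<Longrightarrow> is_type \<Gamma> A \<Longrightarrow> typed \<Gamma> t A" by (simp add: typed_def)

lemma typed_Univ: "typed \<Gamma> A (Univ i) \<longleftrightarrow> \<Gamma> \<turnstile> A \<Ztypecolon> Univ i \<and> i \<le> 2"
proof -
  have "is_type \<Gamma> (Univ i)" if "\<Gamma> \<turnstile> A \<Ztypecolon> Univ i" "i < 2"
    using ty_Univ typing_wf_ctx[OF that(1)] that(2) unfolding is_type_def by blast
  moreover have "i < 2" if "is_type \<Gamma> (Univ i)"
    using that typing_Univ by (auto simp: is_type_def)
  ultimately show ?thesis by (fastforce simp: typed_def)
qed

lemma typed_small: "typed \<Gamma> t A \<Longrightarrow> small A \<Longrightarrow> \<Gamma> \<turnstile> t \<Ztypecolon> A \<and> is_type \<Gamma> A"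
  by (auto simp: typed_def small_def)

lemma typed_former:
  "typed \<Gamma> t (Pi A B) \<longleftrightarrow> \<Gamma> \<turnstile> t \<Ztypecolon> Pi A B \<and> is_type \<Gamma> (Pi A B)"
  "typed \<Gamma> t (Sg A B) \<longleftrightarrow> \<Gamma> \<turnstile> t \<Ztypecolon> Sg A B \<and> is_type \<Gamma> (Sg A B)"
  "typed \<Gamma> t (Eq A a b) \<longleftrightarrow> \<Gamma> \<turnstile> t \<Ztypecolon> Eq A a b \<and> is_type \<Gamma> (Eq A a b)"
  "typed \<Gamma> t (Trunc A) \<longleftrightarrow> \<Gamma> \<turnstile> t \<Ztypecolon> Trunc A \<and> is_type \<Gamma> (Trunc A)"
  by (auto simp: typed_def)

lemma typed_cv: "typed \<Gamma> t A \<Longrightarrow> cv A B \<Longrightarrow> is_type \<Gamma> B \<Longrightarrow> \<Gamma> \<turnstile> t \<Ztypecolon> B"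
  using cv_sound is_type_conv by (auto simp: typed_def)

lemma is_type_wf: "is_type \<Gamma> A \<Longrightarrow> wf_ctx \<Gamma> \<and> wf_ctx (A # \<Gamma>)"
  unfolding is_type_def using typing_wf_ctx wf_cons by blast

lemma is_type_weaken: "is_type \<Gamma> A \<Longrightarrow> wf_ctx (B # \<Gamma>) \<Longrightarrow> is_type (B # \<Gamma>) (lift (Suc 0) A)"
  unfolding is_type_def using weakening[of \<Gamma> A "Univ i" B for i] by (fastforce simp: lift_def)

lemma is_type_intro:
  "is_type \<Gamma> A \<Longrightarrow> is_type (A # \<Gamma>) B \<Longrightarrow> is_type \<Gamma> (Pi A B)"
  "is_type \<Gamma> A \<Longrightarrow> is_type (A # \<Gamma>) B \<Longrightarrow> is_type \<Gamma> (Sg A B)"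
  "is_type \<Gamma> A \<Longrightarrow> \<Gamma> \<turnstile> a \<Ztypecolon> A \<Longrightarrow> \<Gamma> \<turnstile> b \<Ztypecolon> A \<Longrightarrow> is_type \<Gamma> (Eq A a b)"
  "is_type \<Gamma> A \<Longrightarrow> is_type \<Gamma> (Trunc A)"
  "wf_ctx \<Gamma> \<Longrightarrow> is_type \<Gamma> EmptyT" "wf_ctx \<Gamma> \<Longrightarrow> is_type \<Gamma> UnitT" "wf_ctx \<Gamma> \<Longrightarrow> is_type \<Gamma> NatT"
  "wf_ctx \<Gamma> \<Longrightarrow> is_type \<Gamma> PcfT"
  unfolding is_type_def by (blast intro: wf_ctx_typing.intros)+

lemma is_type_arrow: "is_type \<Gamma> A \<Longrightarrow> is_type \<Gamma> B \<Longrightarrow> is_type \<Gamma> (arrow A B)"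
  unfolding arrow_def using is_type_wf[of \<Gamma> A] by (auto intro: is_type_intro is_type_weaken)

lemma is_type_is_prop:
  assumes "is_type \<Gamma> A" shows "is_type \<Gamma> (is_prop A)"
proof -
  have w1: "wf_ctx (A # \<Gamma>)" using is_type_wf[OF assms] by simp
  have t1: "is_type (A # \<Gamma>) (lift 1 A)" using is_type_weaken[OF assms w1] by simp
  have w2: "wf_ctx (lift 1 A # A # \<Gamma>)" using is_type_wf[OF t1] by simp
  have t2: "is_type (lift 1 A # A # \<Gamma>) (lift 2 A)"
    using is_type_weaken[OF t1 w2] by (simp add: eval_nat_numeral lift_Suc_Suc)
  have "lift 1 A # A # \<Gamma> \<turnstile> Var 1 \<Ztypecolon> lift 2 A" "lift 1 A # A # \<Gamma> \<turnstile> Var 0 \<Ztypecolon> lift 2 A"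
    using ty_var[OF w2, of 0] ty_var[OF w2, of 1] by (simp_all add: eval_nat_numeral lift_Suc_Suc)
  then show ?thesis unfolding is_prop_def using assms t1 t2 by (intro is_type_intro) simp_all
qed

lemma is_type_repl: "is_type (Z # \<Gamma>) C \<Longrightarrow> \<Xi> @ \<Gamma> \<turnstile> a \<Ztypecolon> lift n Z \<Longrightarrow> length \<Xi> = n \<Longrightarrow>
    is_type (\<Xi> @ \<Gamma>) (repl n a C)"
  unfolding is_type_def using typing_repl[of Z \<Gamma> C "Univ i" for i] by (fastforce simp: repl_def)

lemma repl0_lift: "repl 0 a (lift (Suc 0) t) = t"
  by (simp add: repl_def sub_case_lift sub_lift0 sub_Var)

lemma typed_Univ_is_type: "typed \<Gamma> A (Univ i) \<Longrightarrow> is_type \<Gamma> A"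
  by (auto simp: typed_Univ is_type_def)

lemma typed_UnivD: "typed \<Gamma> A (Univ i) \<Longrightarrow> \<Gamma> \<turnstile> A \<Ztypecolon> Univ i \<and> is_type \<Gamma> A"
  by (auto simp: typed_Univ is_type_def)

lemma typed_formerD:
  "typed \<Gamma> t (Pi A B) \<Longrightarrow> \<Gamma> \<turnstile> t \<Ztypecolon> Pi A B \<and> is_type \<Gamma> (Pi A B) \<and> is_type \<Gamma> A \<and> is_type (A # \<Gamma>) B"
  "typed \<Gamma> t (Sg A B) \<Longrightarrow> \<Gamma> \<turnstile> t \<Ztypecolon> Sg A B \<and> is_type \<Gamma> (Sg A B) \<and> is_type \<Gamma> A \<and> is_type (A # \<Gamma>) B"
  "typed \<Gamma> t (Eq A a b) \<Longrightarrow> \<Gamma> \<turnstile> t \<Ztypecolon> Eq A a b \<and> is_type \<Gamma> (Eq A a b) \<and> is_type \<Gamma> A \<and> \<Gamma> \<turnstile> a \<Ztypecolon> A \<and> \<Gamma> \<turnstile>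
    b \<Ztypecolon> A"
  "typed \<Gamma> t (Trunc A) \<Longrightarrow> \<Gamma> \<turnstile> t \<Ztypecolon> Trunc A \<and> is_type \<Gamma> (Trunc A) \<and> is_type \<Gamma> A"
  unfolding typed_former using is_type_formers by blast+

text \<open>This is the type that \<open>ty_SgInd\<close> expects of its branch; knowing that it is
  well-formed allows the inferred type of the branch to be converted to it.\<close>

lemma repl_pair_type:
  assumes S: "is_type \<Gamma> (Sg A B)" and C: "is_type (Sg A B # \<Gamma>) C"
  shows "is_type (B # A # \<Gamma>) (repl 2 (Pair (lift 2 A) (repl 3 (Var 0) B) (Var 1) (Var 0)) C)"
proof -
  have t: "is_type \<Gamma> A" "is_type (A # \<Gamma>) B" using is_type_formers(2)[OF S] by auto
  have w: "wf_ctx (A # \<Gamma>)" "wf_ctx (B # A # \<Gamma>)" using t is_type_wf by blast+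
  have l2: "lift 2 X = lift (Suc 0) (lift (Suc 0) X)" "lift 3 X = lift (Suc 0) (lift 2 X)" for X
    by (simp_all add: lift_Suc_Suc eval_nat_numeral)
  have A2: "is_type (B # A # \<Gamma>) (lift 2 A)"
    unfolding l2 using is_type_weaken[OF is_type_weaken[OF t(1) w(1)] w(2)] .
  have w3: "wf_ctx (lift 2 A # B # A # \<Gamma>)" using A2 is_type_wf by blast
  have B3: "is_type (lift 2 A # B # A # \<Gamma>) (repl 3 (Var 0) B)"
    using is_type_repl[OF t(2), of "[lift 2 A, B, A]" "Var 0" 3] ty_var[OF w3, of 0]
      by (simp add: l2)
  \<comment> \<open>In this context \<open>Var 0\<close> has type \<open>B\<close> weakened by one;
    instantiating the family weakened under its binder at \<open>Var 1\<close> gives exactly that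
    term.\<close>
  have e: "repl 0 (Var (Suc 0)) (repl 3 (Var 0) B) = lift (Suc 0) B"
    unfolding repl_def sub_sub lift_eq_sub
    by (rule arg_cong[where f = "\<lambda>s. sub s B"], rule ext) (simp add: eval_nat_numeral
         split: nat.split)
  have "B # A # \<Gamma> \<turnstile> Pair (lift 2 A) (repl 3 (Var 0) B) (Var 1) (Var 0) \<Ztypecolon> Sg (lift 2 A)
    (repl 3 (Var 0) B)"
    using A2 B3 ty_var[OF w(2), of 0] ty_var[OF w(2), of 1] unfolding is_type_def
    by (auto intro!: ty_Pair simp: e l2 lift_Suc_Suc)
  moreover have "Sg (lift 2 A) (repl 3 (Var 0) B) = lift 2 (Sg A B)"
    by (simp add: lift_eq_sub repl_def up_simps lift_Var)
       (rule arg_cong[where f = "\<lambda>s. sub s B"], rule ext, simp add: eval_nat_numeral up_def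
         lift_Var split: nat.split)
  ultimately show ?thesis
    using is_type_repl[OF C, of "[B, A]" _ 2] by simp
qed

text \<open>Each successful test \<open>cv\<close> becomes an application of \<open>ty_conv\<close>
  through \<open>typed_cv\<close>, once the expected type is known to be a type; for components of
  inferred types this comes from \<open>is_type_formers\<close>. Failure carries no information, so
  formers such as \<open>Plus\<close>, which do not occur in the proof terms below, simply
  fail.\<close>

theorem infer_sound: "infer \<Gamma> t = Some A \<Longrightarrow> wf_ctx \<Gamma> \<Longrightarrow> typed \<Gamma> t A"
proof (induction t arbitrary: \<Gamma> A)
  case (Var n)
  then show ?case by (auto simp: infer_eqs intro!: typedI ty_var is_type_var)
next
  case (Univ i)
  then show ?case by (auto simp: infer_eqs typed_Univ intro: ty_Univ)
next
  case (Pi X Y)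
  then obtain i j where "infer \<Gamma> X = Some (Univ i)" "infer (X # \<Gamma>) Y = Some (Univ j)" "A = Univ
    (max i j)"
    by (auto simp: infer_eqs)
  note r = this
  have X: "typed \<Gamma> X (Univ i)" using Pi.IH(1)[OF r(1) Pi.prems(2)] .
  then have "wf_ctx (X # \<Gamma>)" using typed_Univ_is_type is_type_wf by blast
  from X Pi.IH(2)[OF r(2) this] r(3) show ?case by (simp add: typed_Univ ty_Pi)
next
  case (Sg X Y)
  then obtain i j where "infer \<Gamma> X = Some (Univ i)" "infer (X # \<Gamma>) Y = Some (Univ j)" "A = Univ
    (max i j)"
    by (auto simp: infer_eqs)
  note r = this
  have X: "typed \<Gamma> X (Univ i)" using Sg.IH(1)[OF r(1) Sg.prems(2)] .
  then have "wf_ctx (X # \<Gamma>)" using typed_Univ_is_type is_type_wf by blast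
  from X Sg.IH(2)[OF r(2) this] r(3) show ?case by (simp add: typed_Univ ty_Sg)
next
  case (Lam X b)
  then obtain i B where b: "infer \<Gamma> X = Some (Univ i)" "infer (X # \<Gamma>) b = Some B" "small B" "A =
    Pi X B"
    by (auto simp: infer_eqs)
  have X: "\<Gamma> \<turnstile> X \<Ztypecolon> Univ i" "is_type \<Gamma> X"
    using Lam.IH(1)[OF b(1) Lam.prems(2)] by (auto dest: typed_UnivD)
  have "X # \<Gamma> \<turnstile> b \<Ztypecolon> B \<and> is_type (X # \<Gamma>) B"
    using Lam.IH(2)[OF b(2)] X is_type_wf typed_small b(3) by blast
  with b(4) X show ?case by (auto intro!: typedI ty_Lam is_type_intro)
next
  case (App f a)
  then obtain X B X' where b: "infer \<Gamma> f = Some (Pi X B)" "infer \<Gamma> a = Some X'" "cv X' X" "A =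
    repl 0 a B"
    by (auto simp: infer_eqs)
  have f: "\<Gamma> \<turnstile> f \<Ztypecolon> Pi X B" "is_type \<Gamma> (Pi X B)"
    and t: "is_type \<Gamma> X" "is_type (X # \<Gamma>) B"
    using App.IH(1)[OF b(1) App.prems(2), THEN typed_formerD(1)] by blast+
  have "\<Gamma> \<turnstile> a \<Ztypecolon> X" using App.IH(2)[OF b(2) App.prems(2)] b(3) t(1) typed_cv by blast
  with f t b(4) show ?case by (auto intro!: typedI ty_App is_type_repl0)
next
  case (Pair X B a b)
  then obtain i j X' B' where q: "infer \<Gamma> X = Some (Univ i)" "infer (X # \<Gamma>) B = Some (Univ j)"
    "infer \<Gamma> a = Some X'" "cv X' X" "infer \<Gamma> b = Some B'" "cv B' (repl 0 a B)" "A = Sg X B"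
    by (auto simp: infer_eqs)
  have X: "\<Gamma> \<turnstile> X \<Ztypecolon> Univ i" "is_type \<Gamma> X"
    using Pair.IH(1)[OF q(1) Pair.prems(2)] by (auto dest: typed_UnivD)
  then have w: "wf_ctx (X # \<Gamma>)" using is_type_wf by blast
  have B: "X # \<Gamma> \<turnstile> B \<Ztypecolon> Univ j" "is_type (X # \<Gamma>) B"
    using Pair.IH(2)[OF q(2) w] by (auto dest: typed_UnivD)
  have a: "\<Gamma> \<turnstile> a \<Ztypecolon> X" using Pair.IH(3)[OF q(3) Pair.prems(2)] q(4) X(2) typed_cv by blast
  have b: "\<Gamma> \<turnstile> b \<Ztypecolon> repl 0 a B"
    using Pair.IH(4)[OF q(5) Pair.prems(2)] q(6) is_type_repl0[OF B(2) a] typed_cv by blast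
  show ?case using X B a b q(7) by (auto intro!: typedI ty_Pair is_type_intro)
next
  case (Fst p)
  then obtain X B where q: "infer \<Gamma> p = Some (Sg X B)" "A = X" by (auto simp: infer_eqs)
  show ?case using Fst.IH[OF q(1) Fst.prems(2), THEN typed_formerD(2)] q(2)
    by (blast intro: typedI ty_Fst)
next
  case (Snd p)
  then obtain X B where q: "infer \<Gamma> p = Some (Sg X B)" "A = repl 0 (Fst p) B"
    by (auto simp: infer_eqs)
  have "\<Gamma> \<turnstile> p \<Ztypecolon> Sg X B" "is_type \<Gamma> (Sg X B)" "is_type (X # \<Gamma>) B"
    using Snd.IH[OF q(1) Snd.prems(2), THEN typed_formerD(2)] by blast+
  then show ?case unfolding q(2) by (blast intro: typedI is_type_repl0 ty_Snd ty_Fst)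
next
  case (SgInd C d p)
  then obtain X B i D where q: "infer \<Gamma> p = Some (Sg X B)" "infer (Sg X B # \<Gamma>) C = Some (Univ i)"
    "infer (B # X # \<Gamma>) d = Some D"
    "cv D (repl 2 (Pair (lift 2 X) (repl 3 (Var 0) B) (Var 1) (Var 0)) C)" "A = repl 0 p C"
    by (auto simp: infer_eqs)
  have p: "\<Gamma> \<turnstile> p \<Ztypecolon> Sg X B" "is_type \<Gamma> (Sg X B)"
    using SgInd.IH(3)[OF q(1) SgInd.prems(2), THEN typed_formerD(2)] by blast+
  have t: "is_type \<Gamma> X" "is_type (X # \<Gamma>) B" using is_type_formers(2)[OF p(2)] by blast+
  have w: "wf_ctx (Sg X B # \<Gamma>)" "wf_ctx (B # X # \<Gamma>)" using p(2) t(2) is_type_wf by blast+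
  have C: "Sg X B # \<Gamma> \<turnstile> C \<Ztypecolon> Univ i" "is_type (Sg X B # \<Gamma>) C"
    using SgInd.IH(1)[OF q(2) w(1)] by (auto dest: typed_UnivD)
  have d: "B # X # \<Gamma> \<turnstile> d \<Ztypecolon> repl 2 (Pair (lift 2 X) (repl 3 (Var 0) B) (Var 1) (Var 0)) C"
    using SgInd.IH(2)[OF q(3) w(2)] q(4) repl_pair_type[OF p(2) C(2)] typed_cv by blast
  show ?case using ty_SgInd[OF C(1) d p(1)] is_type_repl0[OF C(2) p(1)] q(5) by (simp add: typedI)
next
  case (EmptyInd C e)
  then obtain i E where q: "infer (EmptyT # \<Gamma>) C = Some (Univ i)" "infer \<Gamma> e = Some E" "cv E EmptyT"
    "A = repl 0 e C" by (auto simp: infer_eqs)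
  have E: "is_type \<Gamma> EmptyT" using EmptyInd.prems(2) by (rule is_type_intro)
  have C: "EmptyT # \<Gamma> \<turnstile> C \<Ztypecolon> Univ i" "is_type (EmptyT # \<Gamma>) C"
    using EmptyInd.IH(1)[OF q(1)] is_type_wf[OF E] by (auto dest: typed_UnivD)
  have e: "\<Gamma> \<turnstile> e \<Ztypecolon> EmptyT" using EmptyInd.IH(2)[OF q(2) EmptyInd.prems(2)] q(3) E typed_cv by blast
  show ?case using ty_EmptyInd[OF C(1) e] is_type_repl0[OF C(2) e] q(4) by (simp add: typedI)
next
  case (UnitInd C d u)
  then obtain i D U where q: "infer (UnitT # \<Gamma>) C = Some (Univ i)" "infer \<Gamma> d = Some D" "cv D
    (repl 0 Star C)"
    "infer \<Gamma> u = Some U" "cv U UnitT" "A = repl 0 u C" by (auto simp: infer_eqs)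
  have E: "is_type \<Gamma> UnitT" using UnitInd.prems(2) by (rule is_type_intro)
  have C: "UnitT # \<Gamma> \<turnstile> C \<Ztypecolon> Univ i" "is_type (UnitT # \<Gamma>) C"
    using UnitInd.IH(1)[OF q(1)] is_type_wf[OF E] by (auto dest: typed_UnivD)
  have d: "\<Gamma> \<turnstile> d \<Ztypecolon> repl 0 Star C"
    using UnitInd.IH(2)[OF q(2) UnitInd.prems(2)] q(3) is_type_repl0[OF C(2)
      ty_Star[OF UnitInd.prems(2)]] typed_cv by blast
  have u: "\<Gamma> \<turnstile> u \<Ztypecolon> UnitT" using UnitInd.IH(3)[OF q(4) UnitInd.prems(2)] q(5) E typed_cv by blast
  show ?case using ty_UnitInd[OF C(1) d u] is_type_repl0[OF C(2) u] q(6) by (simp add: typedI)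
next
  case (Succ m)
  then show ?case
    by (auto simp: infer_eqs intro!: typedI is_type_intro ty_Succ
      intro: typed_cv[OF _ _ is_type_intro(7)])
next
  case (NatInd C d s m)
  then obtain i D S M where q: "infer (NatT # \<Gamma>) C = Some (Univ i)" "infer \<Gamma> d = Some D" "cv D
    (repl 0 Zero C)"
    "infer (C # NatT # \<Gamma>) s = Some S" "cv S (repl 2 (Succ (Var 1)) C)"
    "infer \<Gamma> m = Some M" "cv M NatT" "A = repl 0 m C" by (auto simp: infer_eqs)
  have E: "is_type \<Gamma> NatT" using NatInd.prems(2) by (rule is_type_intro)
  have C: "NatT # \<Gamma> \<turnstile> C \<Ztypecolon> Univ i" "is_type (NatT # \<Gamma>) C"
    using NatInd.IH(1)[OF q(1)] is_type_wf[OF E] by (auto dest: typed_UnivD)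
  have d: "\<Gamma> \<turnstile> d \<Ztypecolon> repl 0 Zero C"
    using NatInd.IH(2)[OF q(2) NatInd.prems(2)] q(3) is_type_repl0[OF C(2)
      ty_Zero[OF NatInd.prems(2)]] typed_cv by blast
  have w: "wf_ctx (C # NatT # \<Gamma>)" using is_type_wf[OF C(2)] by blast
  have "C # NatT # \<Gamma> \<turnstile> Succ (Var 1) \<Ztypecolon> lift 2 NatT"
    using ty_var[OF w, of 1] by (auto simp: lift_def intro: ty_Succ)
  then have s: "C # NatT # \<Gamma> \<turnstile> s \<Ztypecolon> repl 2 (Succ (Var 1)) C"
    using NatInd.IH(3)[OF q(4) w] q(5) is_type_repl[OF C(2), of "[C, NatT]" "Succ (Var 1)" 2]
      typed_cv by auto
  have m: "\<Gamma> \<turnstile> m \<Ztypecolon> NatT" using NatInd.IH(4)[OF q(6) NatInd.prems(2)] q(7) E typed_cv by blast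
  show ?case using ty_NatInd[OF C(1) d s m] is_type_repl0[OF C(2) m] q(8) by (simp add: typedI)
next
  case (Eq X a b)
  then obtain i X' X'' where q: "infer \<Gamma> X = Some (Univ i)" "infer \<Gamma> a = Some X'" "cv X' X"
    "infer \<Gamma> b = Some X''" "cv X'' X" "A = Univ i" by (auto simp: infer_eqs)
  have X: "typed \<Gamma> X (Univ i)" "is_type \<Gamma> X"
    using Eq.IH(1)[OF q(1) Eq.prems(2)] typed_Univ_is_type by auto
  have "\<Gamma> \<turnstile> a \<Ztypecolon> X" "\<Gamma> \<turnstile> b \<Ztypecolon> X"
    using Eq.IH(2)[OF q(2) Eq.prems(2)] Eq.IH(3)[OF q(4) Eq.prems(2)] q(3,5) X(2) typed_cv by blast+
  with X(1) q(6) show ?case by (auto simp: typed_Univ intro: ty_Eq)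
next
  case (Refl a)
  then obtain X where "infer \<Gamma> a = Some X" "small X" "A = Eq X a a" by (auto simp: infer_eqs)
  with Refl typed_small[of \<Gamma> a X] show ?case by (auto intro!: typedI is_type_intro ty_Refl)
next
  case (J C d q)
  then obtain X a b i D where r: "infer \<Gamma> q = Some (Eq X a b)"
    "infer (Eq (lift 1 X) (lift 1 a) (Var 0) # X # \<Gamma>) C = Some (Univ i)"
    "infer \<Gamma> d = Some D" "cv D (inst2 a (Refl a) C)" "A = inst2 b q C" by (auto simp: infer_eqs)
  have p: "\<Gamma> \<turnstile> q \<Ztypecolon> Eq X a b" "is_type \<Gamma> (Eq X a b)"
    and t: "is_type \<Gamma> X" "\<Gamma> \<turnstile> a \<Ztypecolon> X" "\<Gamma> \<turnstile> b \<Ztypecolon> X"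
    using J.IH(3)[OF r(1) J.prems(2), THEN typed_formerD(3)] by blast+
  have w: "wf_ctx (X # \<Gamma>)" using t is_type_wf by blast
  have E: "is_type (X # \<Gamma>) (Eq (lift 1 X) (lift 1 a) (Var 0))"
    using is_type_weaken[OF t(1) w] weakening[OF t(2) w] ty_var[OF w, of 0]
      by (auto intro!: is_type_intro)
  have C: "Eq (lift 1 X) (lift 1 a) (Var 0) # X # \<Gamma> \<turnstile> C \<Ztypecolon> Univ i"
    "is_type (Eq (lift 1 X) (lift 1 a) (Var 0) # X # \<Gamma>) C"
    using J.IH(1)[OF r(2)] is_type_wf[OF E] by (auto dest: typed_UnivD)
  have e: "repl 0 c (Eq (lift 1 X) (lift 1 a) (Var 0)) = Eq X a c" for c
    using repl0_lift[of c X] repl0_lift[of c a] by (simp add: repl_def)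
  have "is_type \<Gamma> (inst2 a (Refl a) C)"
    using is_type_inst2[OF C(2) t(2), of "Refl a"] ty_Refl[OF t(2)] e by simp
  then have d: "\<Gamma> \<turnstile> d \<Ztypecolon> inst2 a (Refl a) C" using J.IH(2)[OF r(3) J.prems(2)] r(4) typed_cv by blast
  show ?case using ty_J[OF C(1) d p(1)] is_type_inst2[OF C(2) t(3), of q] p(1) e r(5)
    by (simp add: typedI)
next
  case (Trunc X)
  then obtain i where "infer \<Gamma> X = Some (Univ i)" "A = Univ i" by (auto simp: infer_eqs)
  with Trunc.IH[of \<Gamma> "Univ i"] Trunc.prems(2) show ?case by (simp add: typed_Univ ty_Trunc)
next
  case (TrIn a)
  then obtain X where "infer \<Gamma> a = Some X" "small X" "A = Trunc X" by (auto simp: infer_eqs)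
  with TrIn typed_small[of \<Gamma> a X] show ?case by (auto intro!: typedI is_type_intro ty_TrIn)
next
  case (TrEq s t)
  then obtain X T where r: "infer \<Gamma> s = Some (Trunc X)" "infer \<Gamma> t = Some T" "cv T (Trunc X)"
    "A = Eq (Trunc X) s t" by (auto simp: infer_eqs)
  have "\<Gamma> \<turnstile> s \<Ztypecolon> Trunc X" "is_type \<Gamma> (Trunc X)"
    using TrEq.IH(1)[OF r(1) TrEq.prems(2), THEN typed_formerD(4)] by blast+
  moreover from this have "\<Gamma> \<turnstile> t \<Ztypecolon> Trunc X" using TrEq.IH(2)[OF r(2) TrEq.prems(2)] r(3) typed_cv
    by blast
  ultimately show ?case using r(4) by (auto intro!: typedI is_type_intro ty_TrEq)
next
  case (TrRec P h f t)
  then obtain j H X F where r: "infer \<Gamma> P = Some (Univ j)" "infer \<Gamma> h = Some H" "cv H (is_prop P)"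
    "infer \<Gamma> t = Some (Trunc X)" "infer \<Gamma> f = Some F" "cv F (arrow X P)" "A = P"
    by (auto simp: infer_eqs)
  have P: "\<Gamma> \<turnstile> P \<Ztypecolon> Univ j" "is_type \<Gamma> P" using TrRec.IH(1)[OF r(1) TrRec.prems(2)]
    by (auto dest: typed_UnivD)
  have t: "\<Gamma> \<turnstile> t \<Ztypecolon> Trunc X" "is_type \<Gamma> X"
    using TrRec.IH(4)[OF r(4) TrRec.prems(2), THEN typed_formerD(4)] by blast+
  have "\<Gamma> \<turnstile> h \<Ztypecolon> is_prop P" using TrRec.IH(2)[OF r(2) TrRec.prems(2)] r(3) is_type_is_prop[OF P(2)]
    typed_cv by blast
  moreover have "\<Gamma> \<turnstile> f \<Ztypecolon> arrow X P"
    using TrRec.IH(3)[OF r(5) TrRec.prems(2)] r(6) is_type_arrow[OF t(2) P(2)] typed_cv by blast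
  ultimately show ?case using P t r(7) by (auto intro!: typedI intro: ty_TrRec)
next
  case (Funext f g h)
  then obtain X B G H where r: "infer \<Gamma> f = Some (Pi X B)" "infer \<Gamma> g = Some G" "cv G (Pi X B)"
    "infer \<Gamma> h = Some H" "cv H (Pi X (Eq B (App (lift 1 f) (Var 0)) (App (lift 1 g) (Var 0))))"
    "A = Eq (Pi X B) f g" by (auto simp: infer_eqs)
  have f: "\<Gamma> \<turnstile> f \<Ztypecolon> Pi X B" "is_type \<Gamma> (Pi X B)"
    using Funext.IH(1)[OF r(1) Funext.prems(2), THEN typed_formerD(1)] by blast+
  have g: "\<Gamma> \<turnstile> g \<Ztypecolon> Pi X B" using Funext.IH(2)[OF r(2) Funext.prems(2)] r(3) f(2) typed_cv by blast
  have t: "is_type \<Gamma> X" "is_type (X # \<Gamma>) B" using is_type_formers(1)[OF f(2)] by blast+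
  then have w: "wf_ctx (X # \<Gamma>)" using is_type_wf by blast
  \<comment> \<open>Weakening \<open>B\<close> under its binder and instantiating the bound variable
    by \<open>Var 0\<close> gives back \<open>B\<close>, so \<open>App (lift 1 k) (Var 0)\<close>
    has type \<open>B\<close> itself.\<close>
  have e: "repl 0 (Var 0) (sub (up (\<lambda>k. Var (k + 1))) B) = B"
  proof -
    have "sub (\<lambda>k. case k of 0 \<Rightarrow> Var 0 | Suc k \<Rightarrow> Var k) \<circ> up (\<lambda>k. Var (k + 1)) = Var"
      by (rule ext) (simp add: up_def lift_Var split: nat.split)
    then show ?thesis by (simp add: repl_def sub_sub sub_Var)
  qed
  have "X # \<Gamma> \<turnstile> App (lift 1 k) (Var 0) \<Ztypecolon> B" if "\<Gamma> \<turnstile> k \<Ztypecolon> Pi X B" for k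
    using ty_App[of "X # \<Gamma>" "lift 1 k" "lift 1 X" "sub (up (\<lambda>k. Var (k + 1))) B" "Var 0"]
      weakening[OF that w] ty_var[OF w, of 0] e by (simp add: lift_eq_sub)
  then have "is_type \<Gamma> (Pi X (Eq B (App (lift 1 f) (Var 0)) (App (lift 1 g) (Var 0))))"
    using f g t by (auto intro!: is_type_intro)
  then have "\<Gamma> \<turnstile> h \<Ztypecolon> Pi X (Eq B (App (lift 1 f) (Var 0)) (App (lift 1 g) (Var 0)))"
    using Funext.IH(3)[OF r(4) Funext.prems(2)] r(5) typed_cv by blast
  with f g r(6) show ?case by (auto intro!: typedI is_type_intro(3) ty_Funext)
next
  case (Propext P Q p q f g)
  then obtain i P' Q' F G where r: "infer \<Gamma> P = Some (Univ i)" "i < 2" "infer \<Gamma> Q = Some (Univ i)"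
    "infer \<Gamma> p = Some P'" "cv P' (is_prop P)" "infer \<Gamma> q = Some Q'" "cv Q' (is_prop Q)"
    "infer \<Gamma> f = Some F" "cv F (arrow P Q)" "infer \<Gamma> g = Some G" "cv G (arrow Q P)" "A = Eq
      (Univ i) P Q"
    by (auto simp: infer_eqs)
  note w = Propext.prems(2)
  have PQ: "\<Gamma> \<turnstile> P \<Ztypecolon> Univ i" "is_type \<Gamma> P" "\<Gamma> \<turnstile> Q \<Ztypecolon> Univ i" "is_type \<Gamma> Q"
    using Propext.IH(1)[OF r(1) w] Propext.IH(2)[OF r(3) w] by (auto dest: typed_UnivD)
  have "\<Gamma> \<turnstile> p \<Ztypecolon> is_prop P" "\<Gamma> \<turnstile> q \<Ztypecolon> is_prop Q" "\<Gamma> \<turnstile> f \<Ztypecolon> arrow P Q" "\<Gamma> \<turnstile> g \<Ztypecolon> arrow Q P"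
    using Propext.IH(3)[OF r(4) w] Propext.IH(4)[OF r(6) w] Propext.IH(5)[OF r(8) w]
      Propext.IH(6)[OF r(10) w]
      r(5,7,9,11) PQ is_type_is_prop is_type_arrow typed_cv by blast+
  moreover have "is_type \<Gamma> (Univ i)" unfolding is_type_def using ty_Univ[OF w r(2)] by blast
  ultimately show ?case using PQ r by (auto intro!: typedI is_type_intro ty_Propext)
next
  case (Arr s t)
  then obtain S T where r: "infer \<Gamma> s = Some S" "cv S PcfT" "infer \<Gamma> t = Some T" "cv T PcfT" "A =
    PcfT"
    by (auto simp: infer_eqs)
  have E: "is_type \<Gamma> PcfT" using Arr.prems(2) by (rule is_type_intro)
  have "\<Gamma> \<turnstile> s \<Ztypecolon> PcfT" "\<Gamma> \<turnstile> t \<Ztypecolon> PcfT"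
    using Arr.IH(1)[OF r(1) Arr.prems(2)] Arr.IH(2)[OF r(3) Arr.prems(2)] r(2,4) E typed_cv
      by blast+
  with E r(5) show ?case by (auto intro!: typedI ty_Arr)
next
  case (PcfInd C d e t)
  then obtain i D E T where q: "infer (PcfT # \<Gamma>) C = Some (Univ i)" "infer \<Gamma> d = Some D" "cv D
    (repl 0 Iota C)"
    "infer (repl 3 (Var 1) C # repl 2 (Var 1) C # PcfT # PcfT # \<Gamma>) e = Some E"
    "cv E (repl 4 (Arr (Var 3) (Var 2)) C)"
    "infer \<Gamma> t = Some T" "cv T PcfT" "A = repl 0 t C" by (auto simp: infer_eqs)
  note w0 = PcfInd.prems(2)
  have P: "is_type \<Gamma> PcfT" if "wf_ctx \<Gamma>" for \<Gamma> using that by (rule is_type_intro)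
  have w1: "wf_ctx (PcfT # \<Gamma>)" using is_type_wf[OF P[OF w0]] by blast
  have C: "PcfT # \<Gamma> \<turnstile> C \<Ztypecolon> Univ i" "is_type (PcfT # \<Gamma>) C"
    using PcfInd.IH(1)[OF q(1) w1] by (auto dest: typed_UnivD)
  have d: "\<Gamma> \<turnstile> d \<Ztypecolon> repl 0 Iota C"
    using PcfInd.IH(2)[OF q(2) w0] q(3) is_type_repl0[OF C(2) ty_Iota[OF w0]] typed_cv by blast
  \<comment> \<open>\<open>ty_PcfInd\<close> uses the motive under two, three and four extra
    variables; each instance makes the context for the next one well-formed.\<close>
  have rC: "is_type (\<Xi> @ \<Gamma>) (repl n a C)" if "\<Xi> @ \<Gamma> \<turnstile> a \<Ztypecolon> PcfT" "length \<Xi> = n" for \<Xi> n a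
    using is_type_repl[OF C(2), of \<Xi> a n] that by (simp add: lift_def)
  have v: "\<Gamma> \<turnstile> Var k \<Ztypecolon> PcfT" if "wf_ctx \<Gamma>" "k < length \<Gamma>" "\<Gamma> ! k = PcfT" for \<Gamma> k
    using ty_var[OF that(1,2)] that(3) by (simp add: lift_def)
  have w2: "wf_ctx (PcfT # PcfT # \<Gamma>)" using is_type_wf[OF P[OF w1]] by blast
  have w3: "wf_ctx (repl 2 (Var 1) C # PcfT # PcfT # \<Gamma>)"
    using rC[of "[PcfT, PcfT]" "Var 1" 2] v[OF w2, of 1] is_type_wf by simp
  have w4: "wf_ctx (repl 3 (Var 1) C # repl 2 (Var 1) C # PcfT # PcfT # \<Gamma>)"
    using rC[of "[repl 2 (Var 1) C, PcfT, PcfT]" "Var 1" 3] v[OF w3, of 1] is_type_wf by simp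
  have "is_type (repl 3 (Var 1) C # repl 2 (Var 1) C # PcfT # PcfT # \<Gamma>)
    (repl 4 (Arr (Var 3) (Var 2)) C)"
    using rC[of "[repl 3 (Var 1) C, repl 2 (Var 1) C, PcfT, PcfT]" "Arr (Var 3) (Var 2)" 4]
      ty_Arr[OF v[OF w4, of 3] v[OF w4, of 2]] by (simp add: eval_nat_numeral)
  then have e: "repl 3 (Var 1) C # repl 2 (Var 1) C # PcfT # PcfT # \<Gamma> \<turnstile> e \<Ztypecolon> repl 4
    (Arr (Var 3) (Var 2)) C"
    using PcfInd.IH(3)[OF q(4) w4] q(5) typed_cv by blast
  have t: "\<Gamma> \<turnstile> t \<Ztypecolon> PcfT" using PcfInd.IH(4)[OF q(6) w0] q(7) P[OF w0] typed_cv by blast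
  show ?case using ty_PcfInd[OF C(1) d e t] is_type_repl0[OF C(2) t] q(8) by (simp add: typedI)
qed (auto simp: typed_Univ intro!: typedI is_type_intro ty_Empty ty_Unit ty_Star ty_Nat ty_Zero
  ty_Pcf ty_Iota)

section \<open>Closed terms, and beta reduction with an environment\<close>

definition fixes_below :: "nat \<Rightarrow> (nat \<Rightarrow> tm) \<Rightarrow> bool" where
  "fixes_below n \<sigma> \<longleftrightarrow> (\<forall>k<n. \<sigma> k = Var k)"

lemma fixes_below_up: "fixes_below n \<sigma> \<Longrightarrow> fixes_below (Suc n) (up \<sigma>)"
  by (auto simp: fixes_below_def up_def lift_Var split: nat.split)

text \<open>At the empty context this makes the proof terms of theorems invariant under every
  substitution, so that they behave as constants. The induction passes binders because the length of
  the context and the number of fixed variables grow together.\<close>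

lemma typing_sub_id: "\<Gamma> \<turnstile> t \<Ztypecolon> A \<Longrightarrow> \<forall>\<sigma>. fixes_below (length \<Gamma>) \<sigma> \<longrightarrow> sub \<sigma> t = t"
  by (induction rule: wf_ctx_typing.inducts(2)[where ?P1.0 = "\<lambda>_. True"])
     (simp_all add: fixes_below_up, simp_all add: fixes_below_def)

lemma closed_sub: "[] \<turnstile> t \<Ztypecolon> A \<Longrightarrow> sub \<sigma> t = t"
  using typing_sub_id[of "[]" t A] by (simp add: fixes_below_def)

lemma closed_ren: "[] \<turnstile> t \<Ztypecolon> A \<Longrightarrow> ren r t = t"
  by (simp add: ren_eq_sub closed_sub)

text \<open>Beta reduction with a delayed substitution: \<open>\<sigma>\<close> is the environment
  collected so far. Iterated from \<open>Var\<close>, it contracts nested abstractions applied to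
  several arguments into one simultaneous substitution.\<close>

lemma beta_sub: "f \<cong> sub \<sigma> (Lam A t) \<Longrightarrow> App f a \<cong> sub (case_nat a \<sigma>) t"
proof -
  assume "f \<cong> sub \<sigma> (Lam A t)"
  then have "App f a \<cong> repl 0 a (sub (up \<sigma>) t)"
    using conv_trans[OF cong_App[OF _ conv_refl] beta] by auto
  moreover have "repl 0 a (sub (up \<sigma>) t) = sub (case_nat a \<sigma>) t"
    unfolding repl_def sub_sub
  proof (rule arg_cong[where f = "\<lambda>s. sub s t"], rule ext)
    fix k show "(sub (case_nat a (\<lambda>k. Var (k + 0))) \<circ> up \<sigma>) k = case_nat a \<sigma> k"
      by (cases k) (simp_all add: up_simps sub_case_lift[of _ _ 0, simplified] sub_lift0 sub_Var)
  qed
  ultimately show ?thesis by simp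
qed

section \<open>Named variables and theorems\<close>

text \<open>
  Terms are written with named variables: a term is represented as a function of the number \<open>n\<close> of
  variables in scope, and a bound variable is an Isabelle variable that stands for \<open>hvar m\<close>, where
  \<open>m\<close> is the number of variables outside its binder.
\<close>

type_synonym htm = "nat \<Rightarrow> tm"

definition hvar :: "nat \<Rightarrow> htm" where "hvar m n = Var (n - Suc m)"
definition hU :: "nat \<Rightarrow> htm" where "hU i n = Univ i"
definition hPi :: "htm \<Rightarrow> (htm \<Rightarrow> htm) \<Rightarrow> htm" where
  "hPi A B n = Pi (A n) (B (hvar n) (Suc n))"
definition hLam :: "htm \<Rightarrow> (htm \<Rightarrow> htm) \<Rightarrow> htm" where
  "hLam A b n = Lam (A n) (b (hvar n) (Suc n))"
definition hApp :: "htm \<Rightarrow> htm \<Rightarrow> htm" (infixl "\<cdot>" 90) where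
  "(f \<cdot> a) n = App (f n) (a n)"
definition hSg :: "htm \<Rightarrow> (htm \<Rightarrow> htm) \<Rightarrow> htm" where
  "hSg A B n = Sg (A n) (B (hvar n) (Suc n))"
definition hPair :: "htm \<Rightarrow> (htm \<Rightarrow> htm) \<Rightarrow> htm \<Rightarrow> htm \<Rightarrow> htm" where
  "hPair A B a b n = Pair (A n) (B (hvar n) (Suc n)) (a n) (b n)"
definition hFst :: "htm \<Rightarrow> htm" where "hFst p n = Fst (p n)"
definition hSnd :: "htm \<Rightarrow> htm" where "hSnd p n = Snd (p n)"
definition hSgInd :: "(htm \<Rightarrow> htm) \<Rightarrow> (htm \<Rightarrow> htm \<Rightarrow> htm) \<Rightarrow> htm \<Rightarrow> htm" where
  "hSgInd C d p n = SgInd (C (hvar n) (Suc n)) (d (hvar n) (hvar (Suc n)) (Suc (Suc n))) (p n)"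
definition hEmpty :: htm where "hEmpty n = EmptyT"
definition hEmptyInd :: "(htm \<Rightarrow> htm) \<Rightarrow> htm \<Rightarrow> htm" where
  "hEmptyInd C e n = EmptyInd (C (hvar n) (Suc n)) (e n)"
definition hUnit :: htm where "hUnit n = UnitT"
definition hStar :: htm where "hStar n = Star"
definition hUnitInd :: "(htm \<Rightarrow> htm) \<Rightarrow> htm \<Rightarrow> htm \<Rightarrow> htm" where
  "hUnitInd C d u n = UnitInd (C (hvar n) (Suc n)) (d n) (u n)"
definition hNat :: htm where "hNat n = NatT"
definition hZero :: htm where "hZero n = Zero"
definition hSucc :: "htm \<Rightarrow> htm" where "hSucc m n = Succ (m n)"
definition hNatInd :: "(htm \<Rightarrow> htm) \<Rightarrow> htm \<Rightarrow> (htm \<Rightarrow> htm \<Rightarrow> htm) \<Rightarrow> htm \<Rightarrow> htm" where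
  "hNatInd C d s m n =
     NatInd (C (hvar n) (Suc n)) (d n) (s (hvar n) (hvar (Suc n)) (Suc (Suc n))) (m n)"
definition hEq :: "htm \<Rightarrow> htm \<Rightarrow> htm \<Rightarrow> htm" where "hEq A a b n = Eq (A n) (a n) (b n)"
definition hRefl :: "htm \<Rightarrow> htm" where "hRefl a n = Refl (a n)"
definition hJ :: "(htm \<Rightarrow> htm \<Rightarrow> htm) \<Rightarrow> htm \<Rightarrow> htm \<Rightarrow> htm" where
  "hJ C d q n = J (C (hvar n) (hvar (Suc n)) (Suc (Suc n))) (d n) (q n)"
definition hTr :: "htm \<Rightarrow> htm" where "hTr A n = Trunc (A n)"
definition hTrIn :: "htm \<Rightarrow> htm" where "hTrIn a n = TrIn (a n)"
definition hTrEq :: "htm \<Rightarrow> htm \<Rightarrow> htm" where "hTrEq s t n = TrEq (s n) (t n)"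
definition hTrRec :: "htm \<Rightarrow> htm \<Rightarrow> htm \<Rightarrow> htm \<Rightarrow> htm" where
  "hTrRec P h f t n = TrRec (P n) (h n) (f n) (t n)"
definition hFunext :: "htm \<Rightarrow> htm \<Rightarrow> htm \<Rightarrow> htm" where
  "hFunext f g h n = Funext (f n) (g n) (h n)"
definition hPropext :: "htm \<Rightarrow> htm \<Rightarrow> htm \<Rightarrow> htm \<Rightarrow> htm \<Rightarrow> htm \<Rightarrow> htm" where
  "hPropext P Q p q f g n = Propext (P n) (Q n) (p n) (q n) (f n) (g n)"
text \<open>Evaluating \<open>B\<close> with one more variable in scope is weakening in this
  representation, since a bound variable is stored by its distance from the outside.\<close>

definition hArr :: "htm \<Rightarrow> htm \<Rightarrow> htm" (infixr "\<rightharpoonup>" 60) where "hArr A B n = Pi (A n) (B (Suc n))"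
definition hProd :: "htm \<Rightarrow> htm \<Rightarrow> htm" (infixr "\<otimes>" 65) where "hProd A B n = Sg (A n) (B (Suc n))"

definition hPcf :: htm where "hPcf n = PcfT"
definition hPcfInd :: "(htm \<Rightarrow> htm) \<Rightarrow> htm \<Rightarrow> (htm \<Rightarrow> htm \<Rightarrow> htm \<Rightarrow> htm \<Rightarrow> htm) \<Rightarrow> htm \<Rightarrow> htm" where
  "hPcfInd C d e t n = PcfInd (C (hvar n) (Suc n)) (d n)
     (e (hvar n) (hvar (Suc n)) (hvar (Suc (Suc n))) (hvar (Suc (Suc (Suc n))))
       (Suc (Suc (Suc (Suc n))))) (t n)"
definition hAsc :: "htm \<Rightarrow> htm \<Rightarrow> htm" where "hAsc T t n = App (Lam (T n) (Var 0)) (t n)"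
definition hPr :: "htm \<Rightarrow> htm \<Rightarrow> htm \<Rightarrow> htm \<Rightarrow> htm" where
  "hPr A B a b n = Pair (A n) (B (Suc n)) (a n) (b n)"

lemmas hoas = hvar_def hU_def hPi_def hLam_def hApp_def hSg_def hPair_def hFst_def hSnd_def
  hSgInd_def hEmpty_def hEmptyInd_def hUnit_def hStar_def hUnitInd_def hNat_def hZero_def
  hSucc_def hNatInd_def hEq_def hRefl_def hJ_def hTr_def hTrIn_def hTrEq_def hTrRec_def
  hFunext_def hPropext_def hArr_def hProd_def hPcf_def hPcfInd_def hAsc_def hPr_def

text \<open>
  A theorem of the type theory is a pair of a type and a term, so that both can be built under the
  same quantifiers. Proofs refer to earlier theorems through the constant \<open>evid\<close>, which is not
  unfolded when they are checked. As the normalization gets stuck on it, theorems whose statements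
  depend on the proof of another one take that proof as a hypothesis.
\<close>

type_synonym hth = "nat \<Rightarrow> tm \<times> tm"

definition hbind :: "tm \<Rightarrow> tm \<times> tm \<Rightarrow> tm \<times> tm" where
  "hbind A p = (case p of (T, t) \<Rightarrow> (Pi A T, Lam A t))"
definition hall :: "htm \<Rightarrow> (htm \<Rightarrow> hth) \<Rightarrow> hth" where
  "hall A f n = hbind (A n) (f (hvar n) (Suc n))"
definition hby :: "htm \<Rightarrow> htm \<Rightarrow> hth" (infix "\<Ztypecolon>by" 10) where
  "(T \<Ztypecolon>by t) n = (T n, App (Lam (T n) (Var 0)) (t n))"
definition evid :: "hth \<Rightarrow> tm" where "evid H = snd (H 0)"
definition use :: "hth \<Rightarrow> htm" where "use H n = evid H"

lemma hbind_simp: "hbind A (T, t) = (Pi A T, Lam A t)" by (simp add: hbind_def)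

syntax
  "_hPi" :: "pttrn \<Rightarrow> htm \<Rightarrow> htm \<Rightarrow> htm" ("(3\<^bold>\<Pi>_ : _./ _)" [0, 0, 55] 55)
  "_hSg" :: "pttrn \<Rightarrow> htm \<Rightarrow> htm \<Rightarrow> htm" ("(3\<^bold>\<Sigma>_ : _./ _)" [0, 0, 55] 55)
  "_hLam" :: "pttrn \<Rightarrow> htm \<Rightarrow> htm \<Rightarrow> htm" ("(3\<^bold>\<lambda>_ : _./ _)" [0, 0, 55] 55)
  "_hall" :: "pttrn \<Rightarrow> htm \<Rightarrow> hth \<Rightarrow> hth" ("(3\<^bold>\<forall>_ : _./ _)" [0, 0, 10] 10)
translations
  "\<^bold>\<Pi>x : A. B" \<rightleftharpoons> "CONST hPi A (\<lambda>x. B)"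
  "\<^bold>\<Sigma>x : A. B" \<rightleftharpoons> "CONST hSg A (\<lambda>x. B)"
  "\<^bold>\<lambda>x : A. B" \<rightleftharpoons> "CONST hLam A (\<lambda>x. B)"
  "\<^bold>\<forall>x : A. B" \<rightleftharpoons> "CONST hall A (\<lambda>x. B)"

definition hIsProp :: "htm \<Rightarrow> htm" where "hIsProp A = (\<^bold>\<Pi>x : A. \<^bold>\<Pi>y : A. hEq A x y)"
definition hIsSet :: "htm \<Rightarrow> htm" where "hIsSet A = (\<^bold>\<Pi>x : A. \<^bold>\<Pi>y : A. hIsProp (hEq A x y))"
definition eq_sym :: "htm \<Rightarrow> htm \<Rightarrow> htm \<Rightarrow> htm" where
  "eq_sym A a p = hJ (\<lambda>x _. hEq A x a) (hRefl a) p"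
definition eq_trans :: "htm \<Rightarrow> htm \<Rightarrow> htm \<Rightarrow> htm \<Rightarrow> htm" where
  "eq_trans A a p q = hJ (\<lambda>x _. hEq A a x) p q"

lemmas hmacros = hIsProp_def hIsSet_def eq_sym_def eq_trans_def

text \<open>
  The congruence rules keep the simplifier, which runs the type checker, from evaluating the
  branches of a case distinction before the case is decided.
\<close>

lemma guard_simp: "guard True x = x" by (simp add: guard_def)
lemma bind_wcong: "x = y \<Longrightarrow> Option.bind x f = Option.bind y f" by simp
lemma case_prod_wcong: "x = y \<Longrightarrow> case_prod f x = case_prod f y" by simp
lemma case_lam_wcong: "x = y \<Longrightarrow> case_lam x f d = case_lam y f d" by simp
lemma case_pair_wcong: "x = y \<Longrightarrow> case_pair x f d = case_pair y f d" by simp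
lemma case_num_wcong: "x = y \<Longrightarrow> case_num x z f d = case_num y z f d" by simp
lemma case_star_wcong: "x = y \<Longrightarrow> case_star x f d = case_star y f d" by simp
lemma case_refl_wcong: "x = y \<Longrightarrow> case_refl x f d = case_refl y f d" by simp
lemma small_simps: "small (Var k)" "small (Univ 0)" "small (Univ (Suc 0))" "small (Pi A B)"
  "small (Sg A B)" "small (App f a)" "small (Fst f)" "small (Snd f)" "small (Eq A a b)"
  "small (Trunc A)" "small EmptyT" "small UnitT" "small NatT" "small PcfT" "small (NatInd C d s m)"
  by (simp_all add: small_def)
lemma of_simps: "univ_of (Univ i) = Some i" "pi_of (Pi A B) = Some (A, B)"
  "sg_of (Sg A B) = Some (A, B)" "eq_of (Eq A a b) = Some (A, a, b)" "tr_of (Trunc A) = Some A"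
  by (simp_all add: univ_of_def pi_of_def sg_of_def eq_of_def tr_of_def)
lemma look_simps: "look (A # \<Gamma>) 0 = Some A" "look (A # \<Gamma>) (Suc n) = look \<Gamma> n" by simp_all
lemma cv_refl: "cv t t = True" by (simp add: cv_def)
text \<open>The fuel is written in unary, so that the equations of \<open>nf\<close> apply to
  it.\<close>

lemmas cv_nf = cv_def[unfolded eval_nat_numeral BitM.simps]
lemma numeral_4: "(4::nat) = Suc (Suc (Suc (Suc 0)))" by simp

lemmas elab_simps = hoas hall_def hby_def hbind_simp hmacros
  fst_conv snd_conv case_prod_conv
  diff_Suc_Suc diff_0_eq_0 minus_nat.diff_0 One_nat_def numeral_2_eq_2 numeral_3_eq_3 numeral_4
  add_0_right add_Suc_right add_0 add_Suc
lemmas eval_simps = elab_simps ren.simps sub.simps up_ren_simps up_simps lift_def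
  repl_def inst2_def nat.case guard_simp small_simps of_simps look_simps zero_less_Suc Suc_less_eq
  cv_nf cv_refl
  bind.simps infer.simps nf.simps case_lam_simps case_pair_simps case_num_simps
  case_refl_simps case_star_simps max_0L max_0R max_Suc_Suc HOL.simp_thms nat.inject use_def
  arrow_def is_prop_def
lemmas eval_congs = bind_wcong case_prod_wcong case_lam_wcong case_pair_wcong case_num_wcong
  case_star_wcong case_refl_wcong

text \<open>Quantified over \<open>\<Gamma>\<close> because theorems are used under binders. The
  check runs with \<open>\<Gamma>\<close> symbolic: a closed term looks up only variables that it
  has bound itself.\<close>

definition proves :: "hth \<Rightarrow> tm \<Rightarrow> bool" where
  "proves H A \<longleftrightarrow> (\<forall>\<Gamma>. infer \<Gamma> (evid H) = Some A)"

lemma provesI: "(\<And>\<Gamma>. infer \<Gamma> (snd (H 0)) = Some A) \<Longrightarrow> proves H A"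
  by (simp add: proves_def evid_def)

lemma infer_typing: "infer \<Gamma> t = Some A \<Longrightarrow> wf_ctx \<Gamma> \<Longrightarrow> \<Gamma> \<turnstile> t \<Ztypecolon> A"
  using infer_sound typed_def by blast

lemma proves_typing: "proves H A \<Longrightarrow> wf_ctx \<Gamma> \<Longrightarrow> \<Gamma> \<turnstile> evid H \<Ztypecolon> A"
  using infer_typing by (simp add: proves_def)

text \<open>As rewrite rules these turn a checked theorem into an opaque constant: its type is
  returned without a second check, and renamings and substitutions do not enter it. Unfolding
  \<open>One_nat_def\<close> in their instances matches the unary numerals of the
  evaluation.\<close>

lemma proves_rules:
  assumes "proves H A"
  shows "infer \<Gamma> (evid H) = Some A" "ren r (evid H) = evid H" "sub \<sigma> (evid H) = evid H"
  using assms closed_ren[OF proves_typing[OF assms wf_nil]]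
    closed_sub[OF proves_typing[OF assms wf_nil]]
  by (simp_all add: proves_def)

named_theorems known
named_theorems macros

section \<open>Propositions and sets\<close>

text \<open>
  \<open>f x x (\<rho> x)\<^sup>-\<^sup>1 \<bullet> f x y r\<close> does not depend on \<open>r\<close>, and by path induction it is equal to every
  \<open>p : x = y\<close>. The statements \<open>proves H ?A\<close> are schematic so that the simplifier computes the raw
  type from \<open>H\<close>.
\<close>

definition set_of_rel :: "nat \<Rightarrow> nat \<Rightarrow> hth" where "set_of_rel i j =
  (\<^bold>\<forall>X : hU i. \<^bold>\<forall>R : X \<rightharpoonup> X \<rightharpoonup> hU j. \<^bold>\<forall>\<rho> : (\<^bold>\<Pi>x : X. R \<cdot> x \<cdot> x).
   \<^bold>\<forall>h : (\<^bold>\<Pi>x : X. \<^bold>\<Pi>y : X. hIsProp (R \<cdot> x \<cdot> y)). \<^bold>\<forall>f : (\<^bold>\<Pi>x : X. \<^bold>\<Pi>y : X. R \<cdot> x \<cdot> y \<rightharpoonup> hEq X x y).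
   hIsSet X \<Ztypecolon>by
    (\<^bold>\<lambda>x : X. \<^bold>\<lambda>y : X. \<^bold>\<lambda>p : hEq X x y. \<^bold>\<lambda>q : hEq X x y.
      (let c = (\<lambda>z r. eq_trans X x (eq_sym X x (f \<cdot> x \<cdot> x \<cdot> (\<rho> \<cdot> x))) (f \<cdot> x \<cdot> z \<cdot> r));
           base = hJ (\<lambda>z e. hEq (hEq X z z) (eq_trans X z (eq_sym X x e) e) (hRefl z))
             (hRefl (hRefl x)) (f \<cdot> x \<cdot> x \<cdot> (\<rho> \<cdot> x));
           atx = (\<^bold>\<lambda>r : R \<cdot> x \<cdot> x. hJ (\<lambda>r' _. hEq (hEq X x x) (c x r') (hRefl x)) base
             (h \<cdot> x \<cdot> x \<cdot> (\<rho> \<cdot> x) \<cdot> r));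
           K = (\<lambda>p. hJ (\<lambda>z p. \<^bold>\<Pi>r : R \<cdot> x \<cdot> z. hEq (hEq X x z) (c z r) p) atx p);
           r = hJ (\<lambda>z _. R \<cdot> x \<cdot> z) (\<rho> \<cdot> x) p
       in eq_trans (hEq X x y) p (eq_sym (hEq X x y) (c y r) (K p \<cdot> r)) (K q \<cdot> r))))"

schematic_goal set_of_rel00: "proves (set_of_rel 0 0) ?A"
  by (rule provesI, simp only: set_of_rel_def Let_def macros known eval_simps cong: eval_congs)
lemmas [known] = proves_rules[OF set_of_rel00, unfolded One_nat_def]

schematic_goal set_of_rel10: "proves (set_of_rel 1 0) ?A"
  by (rule provesI, simp only: set_of_rel_def Let_def macros known eval_simps cong: eval_congs)
lemmas [known] = proves_rules[OF set_of_rel10, unfolded One_nat_def]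

schematic_goal set_of_rel11: "proves (set_of_rel 1 1) ?A"
  by (rule provesI, simp only: set_of_rel_def Let_def macros known eval_simps cong: eval_congs)
lemmas [known] = proves_rules[OF set_of_rel11, unfolded One_nat_def]

text \<open>The relation is the constant one with value \<open>X\<close>: it is inhabited at
  \<open>x\<close> by \<open>x\<close> itself, it is a proposition by \<open>h\<close>, and
  \<open>h\<close> also provides the equality.\<close>

definition set_of_prop :: "nat \<Rightarrow> hth" where "set_of_prop i =
  (\<^bold>\<forall>X : hU i. \<^bold>\<forall>h : hIsProp X. hIsSet X \<Ztypecolon>by
    use (set_of_rel i i) \<cdot> X \<cdot> (\<^bold>\<lambda>x : X. \<^bold>\<lambda>y : X. X) \<cdot> (\<^bold>\<lambda>x : X. x) \<cdot> (\<^bold>\<lambda>x : X. \<^bold>\<lambda>y : X. h)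
      \<cdot> (\<^bold>\<lambda>x : X. \<^bold>\<lambda>y : X. \<^bold>\<lambda>z : X. h \<cdot> x \<cdot> y))"

schematic_goal set_of_prop0: "proves (set_of_prop 0) ?A"
  by (rule provesI, simp only: set_of_prop_def Let_def macros known eval_simps cong: eval_congs)
lemmas [known] = proves_rules[OF set_of_prop0, unfolded One_nat_def]
definition prop_pi :: "nat \<Rightarrow> nat \<Rightarrow> hth" where "prop_pi i j =
  (\<^bold>\<forall>A : hU i. \<^bold>\<forall>B : A \<rightharpoonup> hU j. \<^bold>\<forall>h : (\<^bold>\<Pi>x : A. hIsProp (B \<cdot> x)). hIsProp (\<^bold>\<Pi>x : A. B \<cdot> x) \<Ztypecolon>by
    (\<^bold>\<lambda>f : (\<^bold>\<Pi>x : A. B \<cdot> x). \<^bold>\<lambda>g : (\<^bold>\<Pi>x : A. B \<cdot> x). hFunext f g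
      (\<^bold>\<lambda>x : A. h \<cdot> x \<cdot> (f \<cdot> x) \<cdot> (g \<cdot> x))))"

schematic_goal prop_pi00: "proves (prop_pi 0 0) ?A"
  by (rule provesI, simp only: prop_pi_def Let_def macros known eval_simps cong: eval_congs)
lemmas [known] = proves_rules[OF prop_pi00, unfolded One_nat_def]

schematic_goal prop_pi01: "proves (prop_pi 0 1) ?A"
  by (rule provesI, simp only: prop_pi_def Let_def macros known eval_simps cong: eval_congs)
lemmas [known] = proves_rules[OF prop_pi01, unfolded One_nat_def]

schematic_goal prop_pi11: "proves (prop_pi 1 1) ?A"
  by (rule provesI, simp only: prop_pi_def Let_def macros known eval_simps cong: eval_congs)
lemmas [known] = proves_rules[OF prop_pi11, unfolded One_nat_def]

definition propPi :: "nat \<Rightarrow> nat \<Rightarrow> htm \<Rightarrow> (htm \<Rightarrow> htm) \<Rightarrow> (htm \<Rightarrow> htm) \<Rightarrow> htm" where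
  [macros]: "propPi i j A B h = use (prop_pi i j) \<cdot> A \<cdot> hLam A B \<cdot> hLam A h"

text \<open>Both elements are first replaced by explicit pairs. Path induction on the equality of
  the first components needs the second component \<open>b'\<close> generalized, because its type
  varies with the endpoint.\<close>

definition sg_ext :: "nat \<Rightarrow> nat \<Rightarrow> hth" where "sg_ext i j =
  (\<^bold>\<forall>A : hU i. \<^bold>\<forall>B : A \<rightharpoonup> hU j. \<^bold>\<forall>h : (\<^bold>\<Pi>x : A. hIsProp (B \<cdot> x)).
   let S = (\<^bold>\<Sigma>x : A. B \<cdot> x); pr = hPair A (\<lambda>x. B \<cdot> x) in
   (\<^bold>\<Pi>p : S. \<^bold>\<Pi>q : S. hEq A (hFst p) (hFst q) \<rightharpoonup> hEq S p q) \<Ztypecolon>by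
   (\<^bold>\<lambda>p : S. hSgInd (\<lambda>p. \<^bold>\<Pi>q : S. hEq A (hFst p) (hFst q) \<rightharpoonup> hEq S p q)
     (\<lambda>a b. \<^bold>\<lambda>q : S. hSgInd (\<lambda>q. hEq A (hFst (pr a b)) (hFst q) \<rightharpoonup> hEq S (pr a b) q)
       (\<lambda>a' b'. \<^bold>\<lambda>e : hEq A a a'.
         hJ (\<lambda>x _. \<^bold>\<Pi>b' : B \<cdot> x. hEq S (pr a b) (pr x b'))
           (\<^bold>\<lambda>b' : B \<cdot> a. hJ (\<lambda>z _. hEq S (pr a b) (pr a z)) (hRefl (pr a b)) (h \<cdot> a \<cdot> b \<cdot> b')) e
             \<cdot> b') q) p))"

schematic_goal sg_ext00: "proves (sg_ext 0 0) ?A"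
  by (rule provesI, simp only: sg_ext_def Let_def macros known eval_simps cong: eval_congs)
lemmas [known] = proves_rules[OF sg_ext00, unfolded One_nat_def]

schematic_goal sg_ext11: "proves (sg_ext 1 1) ?A"
  by (rule provesI, simp only: sg_ext_def Let_def macros known eval_simps cong: eval_congs)
lemmas [known] = proves_rules[OF sg_ext11, unfolded One_nat_def]

definition prop_prod :: "nat \<Rightarrow> nat \<Rightarrow> hth" where "prop_prod i j =
  (\<^bold>\<forall>A : hU i. \<^bold>\<forall>B : hU j. \<^bold>\<forall>hA : hIsProp A. \<^bold>\<forall>hB : hIsProp B. hIsProp (A \<otimes> B) \<Ztypecolon>by
    (\<^bold>\<lambda>p : A \<otimes> B. \<^bold>\<lambda>q : A \<otimes> B. use (sg_ext i j) \<cdot> A \<cdot> (\<^bold>\<lambda>x : A. B) \<cdot> (\<^bold>\<lambda>x : A. hB) \<cdot> p \<cdot> q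
      \<cdot> (hA \<cdot> hFst p \<cdot> hFst q)))"

schematic_goal prop_prod00: "proves (prop_prod 0 0) ?A"
  by (rule provesI, simp only: prop_prod_def Let_def macros known eval_simps cong: eval_congs)
lemmas [known] = proves_rules[OF prop_prod00, unfolded One_nat_def]

schematic_goal prop_prod11: "proves (prop_prod 1 1) ?A"
  by (rule provesI, simp only: prop_prod_def Let_def macros known eval_simps cong: eval_congs)
lemmas [known] = proves_rules[OF prop_prod11, unfolded One_nat_def]

text \<open>An element \<open>h\<close> already makes \<open>A\<close> a set, so
  \<open>hIsProp A\<close> is a product of propositions; the proof of this is then applied to
  \<open>h\<close> itself.\<close>

definition prop_is_prop :: "nat \<Rightarrow> hth" where "prop_is_prop i =
  (\<^bold>\<forall>A : hU i. hIsProp (hIsProp A) \<Ztypecolon>by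
    (\<^bold>\<lambda>h : hIsProp A. propPi i i A (\<lambda>x. \<^bold>\<Pi>y : A. hEq A x y) (\<lambda>x. propPi i i A (\<lambda>y. hEq A x y)
      (\<lambda>y. use (set_of_prop i) \<cdot> A \<cdot> h \<cdot> x \<cdot> y)) \<cdot> h))"

schematic_goal prop_is_prop0: "proves (prop_is_prop 0) ?A"
  by (rule provesI, simp only: prop_is_prop_def Let_def macros known eval_simps cong: eval_congs)
lemmas [known] = proves_rules[OF prop_is_prop0, unfolded One_nat_def]

text \<open>Observational equality on N, the relation to which \<open>set_of_rel\<close> is applied:
  it computes to the unit type on equal numerals and to the empty type on different ones.\<close>

definition ncode :: htm where [macros]: "ncode =
  (\<^bold>\<lambda>m : hNat. hNatInd (\<lambda>_. hNat \<rightharpoonup> hU 0)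
    (\<^bold>\<lambda>n : hNat. hNatInd (\<lambda>_. hU 0) hUnit (\<lambda>_ _. hEmpty) n)
    (\<lambda>_ R. \<^bold>\<lambda>n : hNat. hNatInd (\<lambda>_. hU 0) hEmpty (\<lambda>n _. R \<cdot> n) n) m)"

definition prop_unit :: hth where "prop_unit = (hIsProp hUnit \<Ztypecolon>by
  (\<^bold>\<lambda>x : hUnit. \<^bold>\<lambda>y : hUnit. hUnitInd (\<lambda>x. hEq hUnit x y) (hUnitInd (\<lambda>y. hEq hUnit hStar y)
    (hRefl hStar) y) x))"

schematic_goal prop_unit: "proves prop_unit ?A"
  by (rule provesI, simp only: prop_unit_def Let_def macros known eval_simps cong: eval_congs)
lemmas [known] = proves_rules[OF prop_unit, unfolded One_nat_def]

definition prop_empty :: hth where "prop_empty = (hIsProp hEmpty \<Ztypecolon>by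
  (\<^bold>\<lambda>x : hEmpty. \<^bold>\<lambda>y : hEmpty. hEmptyInd (\<lambda>_. hEq hEmpty x y) x))"

schematic_goal prop_empty: "proves prop_empty ?A"
  by (rule provesI, simp only: prop_empty_def Let_def macros known eval_simps cong: eval_congs)
lemmas [known] = proves_rules[OF prop_empty, unfolded One_nat_def]

definition nat_set :: hth where "nat_set = (hIsSet hNat \<Ztypecolon>by
  use (set_of_rel 0 0) \<cdot> hNat \<cdot> ncode
  \<cdot> (\<^bold>\<lambda>n : hNat. hNatInd (\<lambda>n. ncode \<cdot> n \<cdot> n) hStar (\<lambda>_ r. r) n)
  \<cdot> (\<^bold>\<lambda>m : hNat. hNatInd (\<lambda>m. \<^bold>\<Pi>n : hNat. hIsProp (ncode \<cdot> m \<cdot> n))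
      (\<^bold>\<lambda>n : hNat. hNatInd (\<lambda>n. hIsProp (ncode \<cdot> hZero \<cdot> n)) (use prop_unit)
        (\<lambda>_ _. use prop_empty) n)
      (\<lambda>m h. \<^bold>\<lambda>n : hNat. hNatInd (\<lambda>n. hIsProp (ncode \<cdot> hSucc m \<cdot> n)) (use prop_empty)
        (\<lambda>n _. h \<cdot> n) n) m)
  \<cdot> (\<^bold>\<lambda>m : hNat. hNatInd (\<lambda>m. \<^bold>\<Pi>n : hNat. ncode \<cdot> m \<cdot> n \<rightharpoonup> hEq hNat m n)
      (\<^bold>\<lambda>n : hNat. hNatInd (\<lambda>n. ncode \<cdot> hZero \<cdot> n \<rightharpoonup> hEq hNat hZero n)
        (\<^bold>\<lambda>_ : hUnit. hRefl hZero) (\<lambda>n _. \<^bold>\<lambda>e : hEmpty. hEmptyInd (\<lambda>_. hEq hNat hZero (hSucc n))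
          e) n)
      (\<lambda>m h. \<^bold>\<lambda>n : hNat. hNatInd (\<lambda>n. ncode \<cdot> hSucc m \<cdot> n \<rightharpoonup> hEq hNat (hSucc m) n)
        (\<^bold>\<lambda>e : hEmpty. hEmptyInd (\<lambda>_. hEq hNat (hSucc m) hZero) e)
        (\<lambda>n _. \<^bold>\<lambda>r : ncode \<cdot> m \<cdot> n. hJ (\<lambda>x _. hEq hNat (hSucc m) (hSucc x)) (hRefl (hSucc m))
          (h \<cdot> n \<cdot> r)) n) m))"

schematic_goal nat_set: "proves nat_set ?A"
  by (rule provesI, simp only: nat_set_def Let_def macros known eval_simps cong: eval_congs)
lemmas [known] = proves_rules[OF nat_set, unfolded One_nat_def]

section \<open>The lifting of the natural numbers\<close>

definition hOmega :: htm where [macros]: "hOmega = (\<^bold>\<Sigma>P : hU 0. hIsProp P)"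
definition hL :: htm where [macros]: "hL = (\<^bold>\<Sigma>w : hOmega. hFst w \<rightharpoonup> hNat)"
definition ldom :: "htm \<Rightarrow> htm" where [macros]: "ldom l = hFst (hFst l)"
definition lval :: "htm \<Rightarrow> htm \<Rightarrow> htm" where [macros]: "lval l p = hSnd l \<cdot> p"
definition mk :: "htm \<Rightarrow> htm \<Rightarrow> htm \<Rightarrow> htm" where
  [macros]: "mk P h \<phi> = hPair hOmega (\<lambda>w. hFst w \<rightharpoonup> hNat) (hPair (hU 0) hIsProp P h) \<phi>"
definition lord :: "htm \<Rightarrow> htm \<Rightarrow> htm" where [macros]: "lord l m = ldom l \<rightharpoonup> hEq hL l m"
definition hLO :: htm where [macros]: "hLO = (\<^bold>\<lambda>l : hL. \<^bold>\<lambda>m : hL. lord l m)"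

text \<open>Propositional extensionality and path induction reduce this to the case that
  \<open>Q\<close> is \<open>P\<close>; then the two proofs of \<open>hIsProp P\<close> agree, and
  the values agree by function extensionality. As \<open>H\<close> compares values at independent
  witnesses, \<open>\<psi>\<close> does not have to be transported in the statement.\<close>

definition mk_ext :: hth where "mk_ext =
  (\<^bold>\<forall>P : hU 0. \<^bold>\<forall>hP : hIsProp P. \<^bold>\<forall>\<phi> : P \<rightharpoonup> hNat. \<^bold>\<forall>Q : hU 0. \<^bold>\<forall>hQ : hIsProp Q. \<^bold>\<forall>\<psi> : Q \<rightharpoonup> hNat.
   \<^bold>\<forall>f : P \<rightharpoonup> Q. \<^bold>\<forall>g : Q \<rightharpoonup> P. \<^bold>\<forall>H : (\<^bold>\<Pi>p : P. \<^bold>\<Pi>q : Q. hEq hNat (\<phi> \<cdot> p) (\<psi> \<cdot> q)).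
   hEq hL (mk P hP \<phi>) (mk Q hQ \<psi>) \<Ztypecolon>by
   hJ (\<lambda>Q _. \<^bold>\<Pi>h : hIsProp Q. \<^bold>\<Pi>\<psi> : Q \<rightharpoonup> hNat. (\<^bold>\<Pi>p : P. \<^bold>\<Pi>q : Q. hEq hNat (\<phi> \<cdot> p) (\<psi> \<cdot> q)) \<rightharpoonup>
         hEq hL (mk P hP \<phi>) (mk Q h \<psi>))
     (\<^bold>\<lambda>h : hIsProp P. \<^bold>\<lambda>\<psi> : P \<rightharpoonup> hNat. \<^bold>\<lambda>H : (\<^bold>\<Pi>p : P. \<^bold>\<Pi>q : P. hEq hNat (\<phi> \<cdot> p) (\<psi> \<cdot> q)).
       hJ (\<lambda>h' _. hEq hL (mk P hP \<phi>) (mk P h' \<psi>))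
         (hJ (\<lambda>\<chi> _. hEq hL (mk P hP \<phi>) (mk P hP \<chi>)) (hRefl (mk P hP \<phi>))
           (hFunext \<phi> \<psi> (\<^bold>\<lambda>p : P. H \<cdot> p \<cdot> p)))
         (use (prop_is_prop 0) \<cdot> P \<cdot> hP \<cdot> h))
     (hPropext P Q hP hQ f g) \<cdot> hQ \<cdot> \<psi> \<cdot> H)"

schematic_goal mk_ext: "proves mk_ext ?A"
  by (rule provesI, simp only: mk_ext_def Let_def macros known eval_simps cong: eval_congs)
lemmas [known] = proves_rules[OF mk_ext, unfolded One_nat_def]

text \<open>The inner elimination generalizes \<open>\<phi>\<close>, whose type depends on the pair
  that is taken apart.\<close>

definition L_ind :: hth where "L_ind =
  (\<^bold>\<forall>C : hL \<rightharpoonup> hU 1. \<^bold>\<forall>c : (\<^bold>\<Pi>P : hU 0. \<^bold>\<Pi>h : hIsProp P. \<^bold>\<Pi>\<phi> : P \<rightharpoonup> hNat. C \<cdot> mk P h \<phi>).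
   (\<^bold>\<Pi>l : hL. C \<cdot> l) \<Ztypecolon>by
   (\<^bold>\<lambda>l : hL. hSgInd (\<lambda>l. C \<cdot> l)
     (\<lambda>w \<phi>. hSgInd (\<lambda>w. \<^bold>\<Pi>\<phi> : hFst w \<rightharpoonup> hNat. C \<cdot> hPair hOmega (\<lambda>w. hFst w \<rightharpoonup> hNat) w \<phi>)
       (\<lambda>P h. \<^bold>\<lambda>\<phi> : P \<rightharpoonup> hNat. c \<cdot> P \<cdot> h \<cdot> \<phi>) w \<cdot> \<phi>) l))"

schematic_goal L_ind: "proves L_ind ?A"
  by (rule provesI, simp only: L_ind_def Let_def macros known eval_simps cong: eval_congs)
lemmas [known] = proves_rules[OF L_ind, unfolded One_nat_def]

definition val_agree :: "htm \<Rightarrow> htm \<Rightarrow> htm" where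
  [macros]: "val_agree l m = (\<^bold>\<Pi>p : ldom l. \<^bold>\<Pi>q : ldom m. hEq hNat (lval l p) (lval m q))"

text \<open>Two uses of \<open>L_ind\<close> lead to \<open>mk_ext\<close>. The ascription is there
  because the result of the outer use has a redex as its type, and the checker does not reduce types
  in search of a product.\<close>

definition lift_ext :: hth where "lift_ext =
  (let G = (\<lambda>l m. (ldom l \<rightharpoonup> ldom m) \<rightharpoonup> (ldom m \<rightharpoonup> ldom l) \<rightharpoonup> val_agree l m \<rightharpoonup> hEq hL l m) in
   \<^bold>\<forall>l : hL. \<^bold>\<forall>m : hL. G l m \<Ztypecolon>by
   (hAsc (\<^bold>\<Pi>m : hL. G l m) (use L_ind \<cdot> (\<^bold>\<lambda>l : hL. \<^bold>\<Pi>m : hL. G l m) \<cdot>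
     (\<^bold>\<lambda>P : hU 0. \<^bold>\<lambda>hP : hIsProp P. \<^bold>\<lambda>\<phi> : P \<rightharpoonup> hNat.
       use L_ind \<cdot> (\<^bold>\<lambda>m : hL. G (mk P hP \<phi>) m) \<cdot>
       (\<^bold>\<lambda>Q : hU 0. \<^bold>\<lambda>hQ : hIsProp Q. \<^bold>\<lambda>\<psi> : Q \<rightharpoonup> hNat.
         use mk_ext \<cdot> P \<cdot> hP \<cdot> \<phi> \<cdot> Q \<cdot> hQ \<cdot> \<psi>)) \<cdot> l) \<cdot> m))"

schematic_goal lift_ext: "proves lift_ext ?A"
  by (rule provesI, simp only: lift_ext_def Let_def macros known eval_simps cong: eval_congs)
lemmas [known] = proves_rules[OF lift_ext, unfolded One_nat_def]

text \<open>By path induction only \<open>l\<close> itself is left, where the extent is a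
  proposition and so any two witnesses are equal. Instances at \<open>hRefl l\<close> serve below as
  independence of the value from the witness.\<close>

definition val_eq :: hth where "val_eq =
  (\<^bold>\<forall>l : hL. \<^bold>\<forall>m : hL. \<^bold>\<forall>e : hEq hL l m. val_agree l m \<Ztypecolon>by
    hJ (\<lambda>m _. val_agree l m)
      (\<^bold>\<lambda>p : ldom l. \<^bold>\<lambda>q : ldom l. hJ (\<lambda>x _. hEq hNat (lval l p) (lval l x)) (hRefl (lval l p))
        (hSnd (hFst l) \<cdot> p \<cdot> q)) e)"

schematic_goal val_eq: "proves val_eq ?A"
  by (rule provesI, simp only: val_eq_def Let_def macros known eval_simps cong: eval_congs)
lemmas [known] = proves_rules[OF val_eq, unfolded One_nat_def]

text \<open>Extents and values are compared in \<open>Univ 0\<close> although \<open>hL\<close> is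
  in \<open>Univ 1\<close>, hence the instance \<open>set_of_rel 1 0\<close>. The part about values
  is a proposition since N is a set.\<close>

definition lift_set :: hth where "lift_set = (hIsSet hL \<Ztypecolon>by
  (let R2 = (\<lambda>l m. (ldom m \<rightharpoonup> ldom l) \<otimes> val_agree l m);
       R = (\<lambda>l m. (ldom l \<rightharpoonup> ldom m) \<otimes> R2 l m);
       pd = (\<lambda>l m. propPi 0 0 (ldom l) (\<lambda>_. ldom m) (\<lambda>_. hSnd (hFst m)))
   in use (set_of_rel 1 0) \<cdot> hL \<cdot> (\<^bold>\<lambda>l : hL. \<^bold>\<lambda>m : hL. R l m)
   \<cdot> (\<^bold>\<lambda>l : hL. hPr (ldom l \<rightharpoonup> ldom l) (R2 l l) (\<^bold>\<lambda>p : ldom l. p)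
        (hPr (ldom l \<rightharpoonup> ldom l) (val_agree l l) (\<^bold>\<lambda>p : ldom l. p) (use val_eq \<cdot> l \<cdot> l \<cdot> hRefl l)))
   \<cdot> (\<^bold>\<lambda>l : hL. \<^bold>\<lambda>m : hL. use (prop_prod 0 0) \<cdot> (ldom l \<rightharpoonup> ldom m) \<cdot> R2 l m \<cdot> pd l m
        \<cdot> (use (prop_prod 0 0) \<cdot> (ldom m \<rightharpoonup> ldom l) \<cdot> val_agree l m \<cdot> pd m l
          \<cdot> propPi 0 0 (ldom l) (\<lambda>p. \<^bold>\<Pi>q : ldom m. hEq hNat (lval l p) (lval m q))
             (\<lambda>p. propPi 0 0 (ldom m) (\<lambda>q. hEq hNat (lval l p) (lval m q))
               (\<lambda>q. use nat_set \<cdot> lval l p \<cdot> lval m q))))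
   \<cdot> (\<^bold>\<lambda>l : hL. \<^bold>\<lambda>m : hL. \<^bold>\<lambda>r : R l m. use lift_ext \<cdot> l \<cdot> m \<cdot> hFst r \<cdot> hFst (hSnd r) \<cdot> hSnd
     (hSnd r))))"

schematic_goal lift_set: "proves lift_set ?A"
  by (rule provesI, simp only: lift_set_def Let_def macros known eval_simps cong: eval_congs)
lemmas [known] = proves_rules[OF lift_set, unfolded One_nat_def]

text \<open>With a witness on each side, both implications between the extents are constant, and
  values at other witnesses agree with those at \<open>p\<close> and \<open>q\<close>.\<close>

definition lift_eq_of :: hth where "lift_eq_of =
  (\<^bold>\<forall>l : hL. \<^bold>\<forall>m : hL. \<^bold>\<forall>p : ldom l. \<^bold>\<forall>q : ldom m. \<^bold>\<forall>e : hEq hNat (lval l p) (lval m q). hEq hL l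
    m \<Ztypecolon>by
   use lift_ext \<cdot> l \<cdot> m \<cdot> (\<^bold>\<lambda>_ : ldom l. q) \<cdot> (\<^bold>\<lambda>_ : ldom m. p)
   \<cdot> (\<^bold>\<lambda>p' : ldom l. \<^bold>\<lambda>q' : ldom m. eq_trans hNat (lval l p')
     (use val_eq \<cdot> l \<cdot> l \<cdot> hRefl l \<cdot> p' \<cdot> p)
       (eq_trans hNat (lval l p) e (use val_eq \<cdot> m \<cdot> m \<cdot> hRefl m \<cdot> q \<cdot> q'))))"

schematic_goal lift_eq_of: "proves lift_eq_of ?A"
  by (rule provesI, simp only: lift_eq_of_def Let_def macros known eval_simps cong: eval_congs)
lemmas [known] = proves_rules[OF lift_eq_of, unfolded One_nat_def]

text \<open>
  The notions of the domain theory in \<open>Defs\<close>, in named notation; they elaborate to the same terms.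
\<close>

definition po_prop :: "htm \<Rightarrow> htm \<Rightarrow> htm" where
  [macros]: "po_prop X r = (\<^bold>\<Pi>x : X. \<^bold>\<Pi>y : X. hIsProp (r \<cdot> x \<cdot> y))"
definition po_refl :: "htm \<Rightarrow> htm \<Rightarrow> htm" where [macros]: "po_refl X r = (\<^bold>\<Pi>x : X. r \<cdot> x \<cdot> x)"
definition po_anti :: "htm \<Rightarrow> htm \<Rightarrow> htm" where
  [macros]: "po_anti X r = (\<^bold>\<Pi>x : X. \<^bold>\<Pi>y : X. r \<cdot> x \<cdot> y \<rightharpoonup> r \<cdot> y \<cdot> x \<rightharpoonup> hEq X x y)"
definition po_trans :: "htm \<Rightarrow> htm \<Rightarrow> htm" where
  [macros]: "po_trans X r = (\<^bold>\<Pi>x : X. \<^bold>\<Pi>y : X. \<^bold>\<Pi>z : X. r \<cdot> x \<cdot> y \<rightharpoonup> r \<cdot> y \<cdot> z \<rightharpoonup> r \<cdot> x \<cdot> z)"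
definition hPoset :: "htm \<Rightarrow> htm \<Rightarrow> htm" where
  [macros]: "hPoset X r = hIsSet X \<otimes> po_prop X r \<otimes> po_refl X r \<otimes> po_anti X r \<otimes> po_trans X r"
definition hLeast :: "htm \<Rightarrow> htm \<Rightarrow> htm" where [macros]: "hLeast X r = (\<^bold>\<Sigma>x : X. \<^bold>\<Pi>y : X. r \<cdot> x \<cdot> y)"
definition hDirected :: "htm \<Rightarrow> htm \<Rightarrow> htm \<Rightarrow> htm" where [macros]: "hDirected r I u = hTr I \<otimes>
     (\<^bold>\<Pi>i : I. \<^bold>\<Pi>j : I. hTr (\<^bold>\<Sigma>k : I. r \<cdot> (u \<cdot> i) \<cdot> (u \<cdot> k) \<otimes> r \<cdot> (u \<cdot> j) \<cdot> (u \<cdot> k)))"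
definition hUB :: "htm \<Rightarrow> htm \<Rightarrow> htm \<Rightarrow> htm \<Rightarrow> htm" where
  [macros]: "hUB r I u x = (\<^bold>\<Pi>i : I. r \<cdot> (u \<cdot> i) \<cdot> x)"
definition hLeastUB :: "htm \<Rightarrow> htm \<Rightarrow> htm \<Rightarrow> htm \<Rightarrow> htm \<Rightarrow> htm" where
  [macros]: "hLeastUB X r I u x = (\<^bold>\<Pi>y : X. hUB r I u y \<rightharpoonup> r \<cdot> x \<cdot> y)"
definition hLub :: "htm \<Rightarrow> htm \<Rightarrow> htm \<Rightarrow> htm \<Rightarrow> htm \<Rightarrow> htm" where
  [macros]: "hLub X r I u x = hUB r I u x \<otimes> hLeastUB X r I u x"
definition hDC :: "htm \<Rightarrow> htm \<Rightarrow> htm" where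
  [macros]: "hDC X r = (\<^bold>\<Pi>I : hU 0. \<^bold>\<Pi>u : I \<rightharpoonup> X. hDirected r I u \<rightharpoonup> (\<^bold>\<Sigma>x : X. hLub X r I u x))"

text \<open>The relation for \<open>set_of_rel\<close> is the order in both directions. The set
  condition of a poset thus comes from its order, also for spaces of continuous maps.\<close>

definition set_of_order :: hth where "set_of_order =
  (\<^bold>\<forall>X : hU 1. \<^bold>\<forall>r : X \<rightharpoonup> X \<rightharpoonup> hU 1. \<^bold>\<forall>b : po_prop X r. \<^bold>\<forall>c : po_refl X r. \<^bold>\<forall>d : po_anti X r. hIsSet
    X \<Ztypecolon>by
   use (set_of_rel 1 1) \<cdot> X \<cdot> (\<^bold>\<lambda>x : X. \<^bold>\<lambda>y : X. r \<cdot> x \<cdot> y \<otimes> r \<cdot> y \<cdot> x)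
   \<cdot> (\<^bold>\<lambda>x : X. hPr (r \<cdot> x \<cdot> x) (r \<cdot> x \<cdot> x) (c \<cdot> x) (c \<cdot> x))
   \<cdot> (\<^bold>\<lambda>x : X. \<^bold>\<lambda>y : X. use (prop_prod 1 1) \<cdot> (r \<cdot> x \<cdot> y) \<cdot> (r \<cdot> y \<cdot> x) \<cdot> (b \<cdot> x \<cdot> y) \<cdot> (b \<cdot> y \<cdot> x))
   \<cdot> (\<^bold>\<lambda>x : X. \<^bold>\<lambda>y : X. \<^bold>\<lambda>p : r \<cdot> x \<cdot> y \<otimes> r \<cdot> y \<cdot> x. d \<cdot> x \<cdot> y \<cdot> hFst p \<cdot> hSnd p))"

schematic_goal set_of_order: "proves set_of_order ?A"
  by (rule provesI, simp only: set_of_order_def Let_def macros known eval_simps cong: eval_congs)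
lemmas [known] = proves_rules[OF set_of_order, unfolded One_nat_def]

definition posetI :: hth where "posetI =
  (\<^bold>\<forall>X : hU 1. \<^bold>\<forall>r : X \<rightharpoonup> X \<rightharpoonup> hU 1. \<^bold>\<forall>b : po_prop X r. \<^bold>\<forall>c : po_refl X r. \<^bold>\<forall>d : po_anti X r.
   \<^bold>\<forall>e : po_trans X r. hPoset X r \<Ztypecolon>by
   hPr (hIsSet X) (po_prop X r \<otimes> po_refl X r \<otimes> po_anti X r \<otimes> po_trans X r)
     (use set_of_order \<cdot> X \<cdot> r \<cdot> b \<cdot> c \<cdot> d)
   (hPr (po_prop X r) (po_refl X r \<otimes> po_anti X r \<otimes> po_trans X r) b
   (hPr (po_refl X r) (po_anti X r \<otimes> po_trans X r) c
   (hPr (po_anti X r) (po_trans X r) d e))))"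

schematic_goal posetI: "proves posetI ?A"
  by (rule provesI, simp only: posetI_def Let_def macros known eval_simps cong: eval_congs)
lemmas [known] = proves_rules[OF posetI, unfolded One_nat_def]

text \<open>The order takes values in identity types of \<open>hL\<close>, so it is
  \<open>lift_set\<close> that makes it proposition-valued. In antisymmetry and transitivity a
  witness of the extent is transported along the equality that it yields.\<close>

definition nat_poset :: hth where "nat_poset = (hPoset hL hLO \<Ztypecolon>by
  use posetI \<cdot> hL \<cdot> hLO
  \<cdot> (\<^bold>\<lambda>l : hL. \<^bold>\<lambda>m : hL. propPi 0 1 (ldom l) (\<lambda>_. hEq hL l m) (\<lambda>_. use lift_set \<cdot> l \<cdot> m))
  \<cdot> (\<^bold>\<lambda>l : hL. \<^bold>\<lambda>p : ldom l. hRefl l)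
  \<cdot> (\<^bold>\<lambda>l : hL. \<^bold>\<lambda>m : hL. \<^bold>\<lambda>a : lord l m. \<^bold>\<lambda>b : lord m l. use lift_ext \<cdot> l \<cdot> m
      \<cdot> (\<^bold>\<lambda>p : ldom l. hJ (\<lambda>x _. ldom x) p (a \<cdot> p)) \<cdot> (\<^bold>\<lambda>q : ldom m. hJ (\<lambda>x _. ldom x) q (b \<cdot> q))
      \<cdot> (\<^bold>\<lambda>p : ldom l. use val_eq \<cdot> l \<cdot> m \<cdot> (a \<cdot> p) \<cdot> p))
  \<cdot> (\<^bold>\<lambda>l : hL. \<^bold>\<lambda>m : hL. \<^bold>\<lambda>n : hL. \<^bold>\<lambda>a : lord l m. \<^bold>\<lambda>b : lord m n. \<^bold>\<lambda>p : ldom l.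
      eq_trans hL l (a \<cdot> p) (b \<cdot> hJ (\<lambda>x _. ldom x) p (a \<cdot> p))))"

schematic_goal nat_poset: "proves nat_poset ?A"
  by (rule provesI, simp only: nat_poset_def Let_def macros known eval_simps cong: eval_congs)
lemmas [known] = proves_rules[OF nat_poset, unfolded One_nat_def]

definition nat_least :: hth where "nat_least = (\<^bold>\<forall>h : hIsProp hEmpty. hLeast hL hLO \<Ztypecolon>by
  (let b = mk hEmpty h (\<^bold>\<lambda>e : hEmpty. hEmptyInd (\<lambda>_. hNat) e) in
   hPair hL (\<lambda>x. \<^bold>\<Pi>y : hL. hLO \<cdot> x \<cdot> y) b (\<^bold>\<lambda>m : hL. \<^bold>\<lambda>e : hEmpty. hEmptyInd (\<lambda>_. hEq hL b m) e)))"

schematic_goal nat_least: "proves nat_least ?A"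
  by (rule provesI, simp only: nat_least_def Let_def macros known eval_simps cong: eval_congs)
lemmas [known] = proves_rules[OF nat_least, unfolded One_nat_def]

text \<open>Once \<open>p\<close> inhabits the extent of \<open>u i\<close>, being below an upper
  bound \<open>u k\<close> means being equal to it, and likewise for \<open>u j\<close> and
  \<open>q\<close>; so \<open>u i\<close> and \<open>u j\<close> are equal. The truncation around
  \<open>k\<close> may be opened because the goal is an equality in N, a proposition by
  \<open>nat_set\<close>.\<close>

definition nat_compat :: hth where "nat_compat =
  (\<^bold>\<forall>I : hU 0. \<^bold>\<forall>u : I \<rightharpoonup> hL. \<^bold>\<forall>\<delta> : hDirected hLO I u. \<^bold>\<forall>i : I. \<^bold>\<forall>j : I. \<^bold>\<forall>p : ldom (u \<cdot> i).
   \<^bold>\<forall>q : ldom (u \<cdot> j).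
   hEq hNat (lval (u \<cdot> i) p) (lval (u \<cdot> j) q) \<Ztypecolon>by
   hTrRec (hEq hNat (lval (u \<cdot> i) p) (lval (u \<cdot> j) q)) (use nat_set \<cdot> lval (u \<cdot> i) p \<cdot> lval
     (u \<cdot> j) q)
     (\<^bold>\<lambda>s : (\<^bold>\<Sigma>k : I. lord (u \<cdot> i) (u \<cdot> k) \<otimes> lord (u \<cdot> j) (u \<cdot> k)).
       use val_eq \<cdot> (u \<cdot> i) \<cdot> (u \<cdot> j) \<cdot> eq_trans hL (u \<cdot> i) (hFst (hSnd s) \<cdot> p)
         (eq_sym hL (u \<cdot> j) (hSnd (hSnd s) \<cdot> q)) \<cdot> p \<cdot> q)
     (hSnd \<delta> \<cdot> i \<cdot> j))"

schematic_goal nat_compat: "proves nat_compat ?A"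
  by (rule provesI, simp only: nat_compat_def Let_def macros known eval_simps cong: eval_congs)
lemmas [known] = proves_rules[OF nat_compat, unfolded One_nat_def]

text \<open>
  The values of the supremum are part of its extent, so that its value function is the first
  projection; no map from a truncation to \<open>N\<close> has to be constructed.
\<close>

definition attained :: "htm \<Rightarrow> htm \<Rightarrow> htm \<Rightarrow> htm" where
  [macros]: "attained I u n = (\<^bold>\<Sigma>i : I. \<^bold>\<Sigma>p : ldom (u \<cdot> i). hEq hNat (lval (u \<cdot> i) p) n)"
definition sup_dom :: "htm \<Rightarrow> htm \<Rightarrow> htm" where
  [macros]: "sup_dom I u = (\<^bold>\<Sigma>n : hNat. hTr (attained I u n))"
definition sup_nat :: "htm \<Rightarrow> htm \<Rightarrow> htm \<Rightarrow> htm" where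
  [macros]: "sup_nat I u h = mk (sup_dom I u) h (\<^bold>\<lambda>z : sup_dom I u. hFst z)"

text \<open>Truncations are propositions, so only the two numbers must agree. Both truncated
  witnesses are opened into an equality in N, and \<open>nat_compat\<close> compares the members of
  the family found there.\<close>

definition sup_dom_prop :: hth where "sup_dom_prop =
  (\<^bold>\<forall>I : hU 0. \<^bold>\<forall>u : I \<rightharpoonup> hL. \<^bold>\<forall>\<delta> : hDirected hLO I u. hIsProp (sup_dom I u) \<Ztypecolon>by
   (\<^bold>\<lambda>x : sup_dom I u. \<^bold>\<lambda>y : sup_dom I u.
     use (sg_ext 0 0) \<cdot> hNat \<cdot> (\<^bold>\<lambda>n : hNat. hTr (attained I u n))
     \<cdot> (\<^bold>\<lambda>n : hNat. \<^bold>\<lambda>s : hTr (attained I u n). \<^bold>\<lambda>t : hTr (attained I u n). hTrEq s t) \<cdot> x \<cdot> y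
     \<cdot> (let G = hEq hNat (hFst x) (hFst y); hG = use nat_set \<cdot> hFst x \<cdot> hFst y in
        hTrRec G hG (\<^bold>\<lambda>s : attained I u (hFst x). hTrRec G hG (\<^bold>\<lambda>t : attained I u (hFst y).
          eq_trans hNat (hFst x) (eq_sym hNat (lval (u \<cdot> hFst s) (hFst (hSnd s))) (hSnd (hSnd s)))
          (eq_trans hNat (lval (u \<cdot> hFst s) (hFst (hSnd s)))
            (use nat_compat \<cdot> I \<cdot> u \<cdot> \<delta> \<cdot> hFst s \<cdot> hFst t \<cdot> hFst (hSnd s) \<cdot> hFst (hSnd t))
            (hSnd (hSnd t)))) (hSnd y)) (hSnd x))))"

schematic_goal sup_dom_prop: "proves sup_dom_prop ?A"
  by (rule provesI, simp only: sup_dom_prop_def Let_def macros known eval_simps cong: eval_congs)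
lemmas [known] = proves_rules[OF sup_dom_prop, unfolded One_nat_def]

text \<open>The value of \<open>u i\<close> at \<open>p\<close>, attained at \<open>i\<close> and
  \<open>p\<close>, is an element of the extent of the supremum, and the value function of the
  supremum returns that same number; so the values agree by \<open>hRefl\<close>.\<close>

definition nat_ub :: hth where "nat_ub =
  (\<^bold>\<forall>I : hU 0. \<^bold>\<forall>u : I \<rightharpoonup> hL. \<^bold>\<forall>h : hIsProp (sup_dom I u). (\<^bold>\<Pi>i : I. lord (u \<cdot> i) (sup_nat I u h))
    \<Ztypecolon>by
   (\<^bold>\<lambda>i : I. \<^bold>\<lambda>p : ldom (u \<cdot> i). use lift_eq_of \<cdot> (u \<cdot> i) \<cdot> sup_nat I u h \<cdot> p
     \<cdot> hPair hNat (\<lambda>n. hTr (attained I u n)) (lval (u \<cdot> i) p)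
        (hTrIn (hPair I (\<lambda>i'. \<^bold>\<Sigma>p' : ldom (u \<cdot> i'). hEq hNat (lval (u \<cdot> i') p') (lval (u \<cdot> i) p)) i
          (hPair (ldom (u \<cdot> i)) (\<lambda>p'. hEq hNat (lval (u \<cdot> i) p') (lval (u \<cdot> i) p)) p
            (hRefl (lval (u \<cdot> i) p)))))
     \<cdot> hRefl (lval (u \<cdot> i) p)))"

schematic_goal nat_ub: "proves nat_ub ?A"
  by (rule provesI, simp only: nat_ub_def Let_def macros known eval_simps cong: eval_congs)
lemmas [known] = proves_rules[OF nat_ub, unfolded One_nat_def]

text \<open>Where the supremum is defined, some member of \<open>u\<close> is defined, and this
  member equals both the supremum, by \<open>nat_ub\<close>, and the given upper bound. The
  truncated witness may be opened since \<open>hL\<close> is a set.\<close>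

definition nat_lub :: hth where "nat_lub =
  (\<^bold>\<forall>I : hU 0. \<^bold>\<forall>u : I \<rightharpoonup> hL. \<^bold>\<forall>h : hIsProp (sup_dom I u). hLub hL hLO I u (sup_nat I u h) \<Ztypecolon>by
   hPr (hUB hLO I u (sup_nat I u h)) (hLeastUB hL hLO I u (sup_nat I u h)) (use nat_ub \<cdot> I \<cdot> u \<cdot> h)
   (\<^bold>\<lambda>x : hL. \<^bold>\<lambda>b : (\<^bold>\<Pi>i : I. lord (u \<cdot> i) x). \<^bold>\<lambda>z : sup_dom I u.
     hTrRec (hEq hL (sup_nat I u h) x) (use lift_set \<cdot> sup_nat I u h \<cdot> x)
       (\<^bold>\<lambda>s : attained I u (hFst z). eq_trans hL (sup_nat I u h)
         (eq_sym hL (u \<cdot> hFst s) (use nat_ub \<cdot> I \<cdot> u \<cdot> h \<cdot> hFst s \<cdot> hFst (hSnd s)))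
           (b \<cdot> hFst s \<cdot> hFst (hSnd s)))
       (hSnd z)))"

schematic_goal nat_lub: "proves nat_lub ?A"
  by (rule provesI, simp only: nat_lub_def Let_def macros known eval_simps cong: eval_congs)
lemmas [known] = proves_rules[OF nat_lub, unfolded One_nat_def]

definition nat_dc :: hth where "nat_dc = (hDC hL hLO \<Ztypecolon>by
  (\<^bold>\<lambda>I : hU 0. \<^bold>\<lambda>u : I \<rightharpoonup> hL. \<^bold>\<lambda>\<delta> : hDirected hLO I u.
    hPair hL (\<lambda>x. hLub hL hLO I u x) (sup_nat I u (use sup_dom_prop \<cdot> I \<cdot> u \<cdot> \<delta>))
      (use nat_lub \<cdot> I \<cdot> u \<cdot> (use sup_dom_prop \<cdot> I \<cdot> u \<cdot> \<delta>))))"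

schematic_goal nat_dc: "proves nat_dc ?A"
  by (rule provesI, simp only: nat_dc_def Let_def macros known eval_simps cong: eval_congs)
lemmas [known] = proves_rules[OF nat_dc, unfolded One_nat_def]

section \<open>Continuous maps\<close>

definition hCont :: "htm \<Rightarrow> htm \<Rightarrow> htm \<Rightarrow> htm \<Rightarrow> htm \<Rightarrow> htm" where
  [macros]: "hCont X r Y s f = (\<^bold>\<Pi>I : hU 0. \<^bold>\<Pi>u : I \<rightharpoonup> X. hDirected r I u \<rightharpoonup>
    (\<^bold>\<Pi>x : X. hLub X r I u x \<rightharpoonup> hLub Y s I (\<^bold>\<lambda>i : I. f \<cdot> (u \<cdot> i)) (f \<cdot> x)))"
definition hCM :: "htm \<Rightarrow> htm \<Rightarrow> htm \<Rightarrow> htm \<Rightarrow> htm" where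
  [macros]: "hCM X r Y s = (\<^bold>\<Sigma>f : X \<rightharpoonup> Y. hCont X r Y s f)"
definition hle :: "htm \<Rightarrow> htm \<Rightarrow> htm \<Rightarrow> htm \<Rightarrow> htm" where
  [macros]: "hle X s f g = (\<^bold>\<Pi>x : X. s \<cdot> (hFst f \<cdot> x) \<cdot> (hFst g \<cdot> x))"
definition hPW :: "htm \<Rightarrow> htm \<Rightarrow> htm \<Rightarrow> htm \<Rightarrow> htm" where
  [macros]: "hPW X r Y s = (\<^bold>\<lambda>f : hCM X r Y s. \<^bold>\<lambda>g : hCM X r Y s. hle X s f g)"
definition for_orders :: "(htm \<Rightarrow> htm \<Rightarrow> htm \<Rightarrow> htm \<Rightarrow> hth) \<Rightarrow> hth" where
  [macros]: "for_orders H = (\<^bold>\<forall>X : hU 1. \<^bold>\<forall>r : X \<rightharpoonup> X \<rightharpoonup> hU 1. \<^bold>\<forall>Y : hU 1. \<^bold>\<forall>s : Y \<rightharpoonup> Y \<rightharpoonup> hU 1.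
    H X r Y s)"

definition lub_prop :: hth where "lub_prop =
  (\<^bold>\<forall>Y : hU 1. \<^bold>\<forall>s : Y \<rightharpoonup> Y \<rightharpoonup> hU 1. \<^bold>\<forall>h : po_prop Y s. \<^bold>\<forall>I : hU 0. \<^bold>\<forall>u : I \<rightharpoonup> Y. \<^bold>\<forall>x : Y.
   hIsProp (hLub Y s I u x) \<Ztypecolon>by
   use (prop_prod 1 1) \<cdot> hUB s I u x \<cdot> hLeastUB Y s I u x
   \<cdot> propPi 0 1 I (\<lambda>i. s \<cdot> (u \<cdot> i) \<cdot> x) (\<lambda>i. h \<cdot> (u \<cdot> i) \<cdot> x)
   \<cdot> propPi 1 1 Y (\<lambda>y. hUB s I u y \<rightharpoonup> s \<cdot> x \<cdot> y) (\<lambda>y. propPi 1 1 (hUB s I u y) (\<lambda>_. s \<cdot> x \<cdot> y)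
     (\<lambda>_. h \<cdot> x \<cdot> y)))"

schematic_goal lub_prop: "proves lub_prop ?A"
  by (rule provesI, simp only: lub_prop_def Let_def macros known eval_simps cong: eval_congs)
lemmas [known] = proves_rules[OF lub_prop, unfolded One_nat_def]

text \<open>The outermost product ranges over \<open>hU 0\<close>, which is itself in
  \<open>Univ 1\<close>, so all instances of \<open>prop_pi\<close> have both levels equal to
  1.\<close>

definition cont_prop :: hth where "cont_prop = for_orders (\<lambda>X r Y s.
   \<^bold>\<forall>h : po_prop Y s. \<^bold>\<forall>f : X \<rightharpoonup> Y. hIsProp (hCont X r Y s f) \<Ztypecolon>by
   (let L = (\<lambda>I u x. hLub Y s I (\<^bold>\<lambda>i : I. f \<cdot> (u \<cdot> i)) (f \<cdot> x)) in
   propPi 1 1 (hU 0) (\<lambda>I. \<^bold>\<Pi>u : I \<rightharpoonup> X. hDirected r I u \<rightharpoonup> (\<^bold>\<Pi>x : X. hLub X r I u x \<rightharpoonup> L I u x)) (\<lambda>I.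
   propPi 1 1 (I \<rightharpoonup> X) (\<lambda>u. hDirected r I u \<rightharpoonup> (\<^bold>\<Pi>x : X. hLub X r I u x \<rightharpoonup> L I u x)) (\<lambda>u.
   propPi 1 1 (hDirected r I u) (\<lambda>_. \<^bold>\<Pi>x : X. hLub X r I u x \<rightharpoonup> L I u x) (\<lambda>_.
   propPi 1 1 X (\<lambda>x. hLub X r I u x \<rightharpoonup> L I u x) (\<lambda>x.
   propPi 1 1 (hLub X r I u x) (\<lambda>_. L I u x) (\<lambda>_.
   use lub_prop \<cdot> Y \<cdot> s \<cdot> h \<cdot> I \<cdot> (\<^bold>\<lambda>i : I. f \<cdot> (u \<cdot> i)) \<cdot> (f \<cdot> x))))))))"

schematic_goal cont_prop: "proves cont_prop ?A"
  by (rule provesI, simp only: cont_prop_def Let_def macros known eval_simps cong: eval_congs)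
lemmas [known] = proves_rules[OF cont_prop, unfolded One_nat_def]

definition cm_ext :: hth where "cm_ext = for_orders (\<lambda>X r Y s.
   \<^bold>\<forall>h : po_prop Y s. \<^bold>\<forall>f : hCM X r Y s. \<^bold>\<forall>g : hCM X r Y s.
   \<^bold>\<forall>e : (\<^bold>\<Pi>x : X. hEq Y (hFst f \<cdot> x) (hFst g \<cdot> x)). hEq (hCM X r Y s) f g \<Ztypecolon>by
   use (sg_ext 1 1) \<cdot> (X \<rightharpoonup> Y) \<cdot> (\<^bold>\<lambda>f : X \<rightharpoonup> Y. hCont X r Y s f) \<cdot> (use cont_prop \<cdot> X \<cdot> r \<cdot> Y \<cdot> s \<cdot> h)
     \<cdot> f \<cdot> g \<cdot> hFunext (hFst f) (hFst g) e)"

schematic_goal cm_ext: "proves cm_ext ?A"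
  by (rule provesI, simp only: cm_ext_def Let_def macros known eval_simps cong: eval_congs)
lemmas [known] = proves_rules[OF cm_ext, unfolded One_nat_def]

definition cm_prop :: hth where "cm_prop = for_orders (\<lambda>X r Y s. \<^bold>\<forall>h : po_prop Y s.
  po_prop (hCM X r Y s) (hPW X r Y s) \<Ztypecolon>by
  (\<^bold>\<lambda>f : hCM X r Y s. \<^bold>\<lambda>g : hCM X r Y s. propPi 1 1 X (\<lambda>x. s \<cdot> (hFst f \<cdot> x) \<cdot> (hFst g \<cdot> x))
    (\<lambda>x. h \<cdot> (hFst f \<cdot> x) \<cdot> (hFst g \<cdot> x))))"

schematic_goal cm_prop: "proves cm_prop ?A"
  by (rule provesI, simp only: cm_prop_def Let_def macros known eval_simps cong: eval_congs)
lemmas [known] = proves_rules[OF cm_prop, unfolded One_nat_def]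

definition cm_refl :: hth where "cm_refl = for_orders (\<lambda>X r Y s. \<^bold>\<forall>h : po_refl Y s.
  po_refl (hCM X r Y s) (hPW X r Y s) \<Ztypecolon>by
  (\<^bold>\<lambda>f : hCM X r Y s. \<^bold>\<lambda>x : X. h \<cdot> (hFst f \<cdot> x)))"

schematic_goal cm_refl: "proves cm_refl ?A"
  by (rule provesI, simp only: cm_refl_def Let_def macros known eval_simps cong: eval_congs)
lemmas [known] = proves_rules[OF cm_refl, unfolded One_nat_def]

definition cm_anti :: hth where
  "cm_anti = for_orders (\<lambda>X r Y s. \<^bold>\<forall>h : po_prop Y s. \<^bold>\<forall>h' : po_anti Y s.
  po_anti (hCM X r Y s) (hPW X r Y s) \<Ztypecolon>by
  (\<^bold>\<lambda>f : hCM X r Y s. \<^bold>\<lambda>g : hCM X r Y s. \<^bold>\<lambda>a : hle X s f g. \<^bold>\<lambda>b : hle X s g f.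
    use cm_ext \<cdot> X \<cdot> r \<cdot> Y \<cdot> s \<cdot> h \<cdot> f \<cdot> g \<cdot> (\<^bold>\<lambda>x : X. h' \<cdot> (hFst f \<cdot> x) \<cdot> (hFst g \<cdot> x) \<cdot> (a \<cdot> x)
      \<cdot> (b \<cdot> x))))"

schematic_goal cm_anti: "proves cm_anti ?A"
  by (rule provesI, simp only: cm_anti_def Let_def macros known eval_simps cong: eval_congs)
lemmas [known] = proves_rules[OF cm_anti, unfolded One_nat_def]

definition cm_trans :: hth where "cm_trans = for_orders (\<lambda>X r Y s. \<^bold>\<forall>h : po_trans Y s.
  po_trans (hCM X r Y s) (hPW X r Y s) \<Ztypecolon>by
  (\<^bold>\<lambda>f : hCM X r Y s. \<^bold>\<lambda>g : hCM X r Y s. \<^bold>\<lambda>k : hCM X r Y s. \<^bold>\<lambda>a : hle X s f g. \<^bold>\<lambda>b : hle X s g k.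
    \<^bold>\<lambda>x : X. h \<cdot> (hFst f \<cdot> x) \<cdot> (hFst g \<cdot> x) \<cdot> (hFst k \<cdot> x) \<cdot> (a \<cdot> x) \<cdot> (b \<cdot> x)))"

schematic_goal cm_trans: "proves cm_trans ?A"
  by (rule provesI, simp only: cm_trans_def Let_def macros known eval_simps cong: eval_congs)
lemmas [known] = proves_rules[OF cm_trans, unfolded One_nat_def]

definition cm_poset :: hth where "cm_poset = for_orders (\<lambda>X r Y s. \<^bold>\<forall>h : hPoset Y s.
  hPoset (hCM X r Y s) (hPW X r Y s) \<Ztypecolon>by
  use posetI \<cdot> hCM X r Y s \<cdot> hPW X r Y s
    \<cdot> (use cm_prop \<cdot> X \<cdot> r \<cdot> Y \<cdot> s \<cdot> hFst (hSnd h))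
    \<cdot> (use cm_refl \<cdot> X \<cdot> r \<cdot> Y \<cdot> s \<cdot> hFst (hSnd (hSnd h)))
    \<cdot> (use cm_anti \<cdot> X \<cdot> r \<cdot> Y \<cdot> s \<cdot> hFst (hSnd h) \<cdot> hFst (hSnd (hSnd (hSnd h))))
    \<cdot> (use cm_trans \<cdot> X \<cdot> r \<cdot> Y \<cdot> s \<cdot> hSnd (hSnd (hSnd (hSnd h)))))"

schematic_goal cm_poset: "proves cm_poset ?A"
  by (rule provesI, simp only: cm_poset_def Let_def macros known eval_simps cong: eval_congs)
lemmas [known] = proves_rules[OF cm_poset, unfolded One_nat_def]

text \<open>The constant map at the bottom element. Its continuity has two halves: bottom bounds the
  constant family, and bottom is below every bound. Both are instances of leastness.\<close>

definition cm_least :: hth where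
  "cm_least = for_orders (\<lambda>X r Y s. \<^bold>\<forall>b : hLeast Y s. hLeast (hCM X r Y s) (hPW X r Y s) \<Ztypecolon>by
  hPair (hCM X r Y s) (\<lambda>x. \<^bold>\<Pi>y : hCM X r Y s. hPW X r Y s \<cdot> x \<cdot> y)
    (hPair (X \<rightharpoonup> Y) (\<lambda>f. hCont X r Y s f) (\<^bold>\<lambda>_ : X. hFst b)
      (\<^bold>\<lambda>I : hU 0. \<^bold>\<lambda>u : I \<rightharpoonup> X. \<^bold>\<lambda>\<delta> : hDirected r I u. \<^bold>\<lambda>x : X. \<^bold>\<lambda>l : hLub X r I u x.
        (let c = (\<^bold>\<lambda>_ : I. hFst b) in
        hPr (hUB s I c (hFst b)) (hLeastUB Y s I c (hFst b)) (\<^bold>\<lambda>i : I. hSnd b \<cdot> hFst b)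
          (\<^bold>\<lambda>y : Y. \<^bold>\<lambda>_ : hUB s I c y. hSnd b \<cdot> y))))
    (\<^bold>\<lambda>g : hCM X r Y s. \<^bold>\<lambda>x : X. hSnd b \<cdot> (hFst g \<cdot> x)))"

schematic_goal cm_least: "proves cm_least ?A"
  by (rule provesI, simp only: cm_least_def Let_def macros known eval_simps cong: eval_congs)
lemmas [known] = proves_rules[OF cm_least, unfolded One_nat_def]

section \<open>Pointwise suprema of continuous maps\<close>

definition hfam :: "htm \<Rightarrow> htm \<Rightarrow> htm \<Rightarrow> htm" where
  [macros]: "hfam I F x = (\<^bold>\<lambda>i : I. hFst (F \<cdot> i) \<cdot> x)"

text \<open>An index \<open>k\<close> whose map bounds \<open>F i\<close> and \<open>F j\<close>
  also bounds their values at \<open>x\<close>. It is available only under a truncation, but the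
  goal is truncated, too.\<close>

definition dir_pt :: hth where "dir_pt = for_orders (\<lambda>X r Y s. \<^bold>\<forall>I : hU 0. \<^bold>\<forall>F : I \<rightharpoonup> hCM X r Y s.
  \<^bold>\<forall>\<delta> : hDirected (hPW X r Y s) I F. \<^bold>\<forall>x : X. hDirected s I (hfam I F x) \<Ztypecolon>by
  (let B = (\<lambda>i j k. s \<cdot> (hFst (F \<cdot> i) \<cdot> x) \<cdot> (hFst (F \<cdot> k) \<cdot> x) \<otimes> s \<cdot> (hFst (F \<cdot> j) \<cdot> x) \<cdot>
    (hFst (F \<cdot> k) \<cdot> x));
       T = (\<lambda>i j. hTr (\<^bold>\<Sigma>k : I. B i j k)) in
   hPr (hTr I) (\<^bold>\<Pi>i : I. \<^bold>\<Pi>j : I. T i j) (hFst \<delta>)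
    (\<^bold>\<lambda>i : I. \<^bold>\<lambda>j : I. hTrRec (T i j) (\<^bold>\<lambda>a : T i j. \<^bold>\<lambda>b : T i j. hTrEq a b)
      (\<^bold>\<lambda>t : (\<^bold>\<Sigma>k : I. hle X s (F \<cdot> i) (F \<cdot> k) \<otimes> hle X s (F \<cdot> j) (F \<cdot> k)).
        hTrIn (hPair I (B i j) (hFst t)
          (hPr (s \<cdot> (hFst (F \<cdot> i) \<cdot> x) \<cdot> (hFst (F \<cdot> hFst t) \<cdot> x))
            (s \<cdot> (hFst (F \<cdot> j) \<cdot> x) \<cdot> (hFst (F \<cdot> hFst t) \<cdot> x))
            (hFst (hSnd t) \<cdot> x) (hSnd (hSnd t) \<cdot> x))))
      (hSnd \<delta> \<cdot> i \<cdot> j))))"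

schematic_goal dir_pt: "proves dir_pt ?A"
  by (rule provesI, simp only: dir_pt_def Let_def macros known eval_simps cong: eval_congs)
lemmas [known] = proves_rules[OF dir_pt, unfolded One_nat_def]

text \<open>Interchange of suprema. Each \<open>F i\<close> at \<open>v j\<close> is below
  \<open>F i\<close> at \<open>x\<close> by continuity, hence below \<open>g\<close> at
  \<open>x\<close>; so \<open>g\<close> at \<open>v j\<close> is below \<open>g\<close> at
  \<open>x\<close>. If \<open>y\<close> bounds \<open>g\<close> at all \<open>v j\<close>, it bounds
  \<open>F i\<close> at all \<open>v j\<close>, hence \<open>F i\<close> at \<open>x\<close> by
  continuity, and hence \<open>g\<close> at \<open>x\<close>.\<close>

definition sup_cont :: hth where
  "sup_cont = for_orders (\<lambda>X r Y s. \<^bold>\<forall>tr : po_trans Y s. \<^bold>\<forall>I : hU 0. \<^bold>\<forall>F : I \<rightharpoonup> hCM X r Y s.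
  \<^bold>\<forall>g : X \<rightharpoonup> Y. \<^bold>\<forall>l : (\<^bold>\<Pi>x : X. hLub Y s I (hfam I F x) (g \<cdot> x)). hCont X r Y s g \<Ztypecolon>by
  (\<^bold>\<lambda>J : hU 0. \<^bold>\<lambda>v : J \<rightharpoonup> X. \<^bold>\<lambda>d : hDirected r J v. \<^bold>\<lambda>x : X. \<^bold>\<lambda>lx : hLub X r J v x.
   (let gv = (\<^bold>\<lambda>j : J. g \<cdot> (v \<cdot> j)); Fc = (\<lambda>i. hSnd (F \<cdot> i) \<cdot> J \<cdot> v \<cdot> d \<cdot> x \<cdot> lx); ap =
     (\<lambda>i x. hFst (F \<cdot> i) \<cdot> x) in
   hPr (hUB s J gv (g \<cdot> x)) (hLeastUB Y s J gv (g \<cdot> x))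
    (\<^bold>\<lambda>j : J. hSnd (l \<cdot> (v \<cdot> j)) \<cdot> (g \<cdot> x) \<cdot>
      (\<^bold>\<lambda>i : I. tr \<cdot> ap i (v \<cdot> j) \<cdot> ap i x \<cdot> (g \<cdot> x) \<cdot> (hFst (Fc i) \<cdot> j) \<cdot> (hFst (l \<cdot> x) \<cdot> i)))
    (\<^bold>\<lambda>y : Y. \<^bold>\<lambda>b : hUB s J gv y. hSnd (l \<cdot> x) \<cdot> y \<cdot>
      (\<^bold>\<lambda>i : I. hSnd (Fc i) \<cdot> y \<cdot>
        (\<^bold>\<lambda>j : J. tr \<cdot> ap i (v \<cdot> j) \<cdot> (g \<cdot> (v \<cdot> j)) \<cdot> y \<cdot> (hFst (l \<cdot> (v \<cdot> j)) \<cdot> i) \<cdot> (b \<cdot> j)))))))"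

schematic_goal sup_cont: "proves sup_cont ?A"
  by (rule provesI, simp only: sup_cont_def Let_def macros known eval_simps cong: eval_congs)
lemmas [known] = proves_rules[OF sup_cont, unfolded One_nat_def]

definition sup_lub :: hth where "sup_lub = for_orders (\<lambda>X r Y s. \<^bold>\<forall>I : hU 0. \<^bold>\<forall>F : I \<rightharpoonup> hCM X r Y s.
  \<^bold>\<forall>g : X \<rightharpoonup> Y. \<^bold>\<forall>c : hCont X r Y s g. \<^bold>\<forall>l : (\<^bold>\<Pi>x : X. hLub Y s I (hfam I F x) (g \<cdot> x)).
  let G = hPair (X \<rightharpoonup> Y) (\<lambda>f. hCont X r Y s f) g c; C = hCM X r Y s; P = hPW X r Y s in
  hLub C P I F G \<Ztypecolon>by
  hPr (hUB P I F G) (hLeastUB C P I F G) (\<^bold>\<lambda>i : I. \<^bold>\<lambda>x : X. hFst (l \<cdot> x) \<cdot> i)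
   (\<^bold>\<lambda>k : C. \<^bold>\<lambda>b : (\<^bold>\<Pi>i : I. hle X s (F \<cdot> i) k). \<^bold>\<lambda>x : X. hSnd (l \<cdot> x) \<cdot> (hFst k \<cdot> x) \<cdot>
     (\<^bold>\<lambda>i : I. b \<cdot> i \<cdot> x)))"

schematic_goal sup_lub: "proves sup_lub ?A"
  by (rule provesI, simp only: sup_lub_def Let_def macros known eval_simps cong: eval_congs)
lemmas [known] = proves_rules[OF sup_lub, unfolded One_nat_def]

text \<open>\<open>G\<close> gives an actual supremum at every point, since directed completeness is
  untruncated data; the limit map is read off by projection and no choice is made.\<close>

definition cm_sup :: hth where
  "cm_sup = for_orders (\<lambda>X r Y s. \<^bold>\<forall>tr : po_trans Y s. \<^bold>\<forall>I : hU 0. \<^bold>\<forall>F : I \<rightharpoonup> hCM X r Y s.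
  \<^bold>\<forall>G : (\<^bold>\<Pi>x : X. \<^bold>\<Sigma>y : Y. hLub Y s I (hfam I F x) y).
  let C = hCM X r Y s; P = hPW X r Y s; g = (\<^bold>\<lambda>x : X. hFst (G \<cdot> x)); l = (\<^bold>\<lambda>x : X. hSnd (G \<cdot> x));
      c = use sup_cont \<cdot> X \<cdot> r \<cdot> Y \<cdot> s \<cdot> tr \<cdot> I \<cdot> F \<cdot> g \<cdot> l in
  (\<^bold>\<Sigma>f : C. hLub C P I F f) \<Ztypecolon>by
  hPair C (\<lambda>f. hLub C P I F f) (hPair (X \<rightharpoonup> Y) (\<lambda>f. hCont X r Y s f) g c)
    (use sup_lub \<cdot> X \<cdot> r \<cdot> Y \<cdot> s \<cdot> I \<cdot> F \<cdot> g \<cdot> c \<cdot> l))"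

schematic_goal cm_sup: "proves cm_sup ?A"
  by (rule provesI, simp only: cm_sup_def Let_def macros known eval_simps cong: eval_congs)
lemmas [known] = proves_rules[OF cm_sup, unfolded One_nat_def]

definition cm_dc :: hth where
  "cm_dc = for_orders (\<lambda>X r Y s. \<^bold>\<forall>tr : po_trans Y s. \<^bold>\<forall>dc : hDC Y s. hDC (hCM X r Y s)
    (hPW X r Y s) \<Ztypecolon>by
  (\<^bold>\<lambda>I : hU 0. \<^bold>\<lambda>F : I \<rightharpoonup> hCM X r Y s. \<^bold>\<lambda>\<delta> : hDirected (hPW X r Y s) I F.
    use cm_sup \<cdot> X \<cdot> r \<cdot> Y \<cdot> s \<cdot> tr \<cdot> I \<cdot> F \<cdot>
      (\<^bold>\<lambda>x : X. dc \<cdot> I \<cdot> hfam I F x \<cdot> (use dir_pt \<cdot> X \<cdot> r \<cdot> Y \<cdot> s \<cdot> I \<cdot> F \<cdot> \<delta> \<cdot> x))))"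

schematic_goal cm_dc: "proves cm_dc ?A"
  by (rule provesI, simp only: cm_dc_def Let_def macros known eval_simps cong: eval_congs)
lemmas [known] = proves_rules[OF cm_dc, unfolded One_nat_def]

section \<open>The interpretation\<close>

definition hD3 :: "htm \<Rightarrow> htm \<Rightarrow> htm" where [macros]: "hD3 X r = hPoset X r \<otimes> hLeast X r \<otimes> hDC X r"
definition hD2 :: "htm \<Rightarrow> htm" where [macros]: "hD2 X = (\<^bold>\<Sigma>r : X \<rightharpoonup> X \<rightharpoonup> hU 1. hD3 X r)"
definition hD :: htm where [macros]: "hD = (\<^bold>\<Sigma>X : hU 1. hD2 X)"

text \<open>Carrier and order are arguments, so both can be read off a dcpo by unfolding this term,
  with the three proofs left arbitrary.\<close>

definition mk_dcpo :: hth where "mk_dcpo =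
  (\<^bold>\<forall>X : hU 1. \<^bold>\<forall>r : X \<rightharpoonup> X \<rightharpoonup> hU 1. \<^bold>\<forall>a : hPoset X r. \<^bold>\<forall>b : hLeast X r. \<^bold>\<forall>c : hDC X r. hD \<Ztypecolon>by
   hPair (hU 1) hD2 X (hPair (X \<rightharpoonup> X \<rightharpoonup> hU 1) (hD3 X) r
     (hPr (hPoset X r) (hLeast X r \<otimes> hDC X r) a (hPr (hLeast X r) (hDC X r) b c))))"

schematic_goal mk_dcpo: "proves mk_dcpo ?A"
  by (rule provesI, simp only: mk_dcpo_def Let_def macros known eval_simps cong: eval_congs)
lemmas [known] = proves_rules[OF mk_dcpo, unfolded One_nat_def]

definition nat_dcpo :: hth where "nat_dcpo = (hD \<Ztypecolon>by
  use mk_dcpo \<cdot> hL \<cdot> hLO \<cdot> use nat_poset \<cdot> (use nat_least \<cdot> use prop_empty) \<cdot> use nat_dc)"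

schematic_goal nat_dcpo: "proves nat_dcpo ?A"
  by (rule provesI, simp only: nat_dcpo_def Let_def macros known eval_simps cong: eval_congs)
lemmas [known] = proves_rules[OF nat_dcpo, unfolded One_nat_def]

definition arr_dcpo :: hth where "arr_dcpo = (\<^bold>\<forall>D : hD. \<^bold>\<forall>E : hD.
  let X = hFst D; r = hFst (hSnd D); Y = hFst E; s = hFst (hSnd E); q = hSnd (hSnd E);
      f = (\<lambda>H. use H \<cdot> X \<cdot> r \<cdot> Y \<cdot> s)
  in hD \<Ztypecolon>by use mk_dcpo \<cdot> hCM X r Y s \<cdot> hPW X r Y s \<cdot> (f cm_poset \<cdot> hFst q)
    \<cdot> (f cm_least \<cdot> hFst (hSnd q)) \<cdot> (f cm_dc \<cdot> hSnd (hSnd (hSnd (hSnd (hFst q)))) \<cdot> hSnd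
      (hSnd q)))"

schematic_goal arr_dcpo: "proves arr_dcpo ?A"
  by (rule provesI, simp only: arr_dcpo_def Let_def macros known eval_simps cong: eval_congs)
lemmas [known] = proves_rules[OF arr_dcpo, unfolded One_nat_def]

text \<open>Recursion with a constant motive. As \<open>hD\<close> contains \<open>hU 1\<close>, it
  lives at level \<open>Univ 2\<close>, which the elimination rule for PCF types admits.\<close>

definition scott :: hth where "scott = (\<^bold>\<forall>t : hPcf. hD \<Ztypecolon>by
  hPcfInd (\<lambda>_. hD) (use nat_dcpo) (\<lambda>s t D E. use arr_dcpo \<cdot> D \<cdot> E) t)"

schematic_goal scott: "proves scott ?A"
  by (rule provesI, simp only: scott_def Let_def macros known eval_simps cong: eval_congs)
lemmas [known] = proves_rules[OF scott, unfolded One_nat_def]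

section \<open>The clauses of the interpretation as definitional equalities\<close>

lemmas domain_defs = DCPO_bot_def is_poset_def is_set_def has_least_def directed_complete_def
  is_directed_def is_lub_def is_upper_bound_def prod_def rel_def lift_nat_def lift_nat_order_def
  Omega_def cont_maps_def is_continuous_def pointwise_order_def carrier_def order_def

lemma DCPO_bot_sub: "sub \<sigma> (DCPO_bot 0 1 1) = DCPO_bot 0 1 1"
  by (simp only: domain_defs eval_simps)

lemma scott_typing:
  assumes "wf_ctx \<Gamma>" shows "\<Gamma> \<turnstile> evid scott \<Ztypecolon> arrow PcfT (DCPO_bot 0 1 1)"
  using proves_typing[OF scott assms] by (simp only: domain_defs eval_simps)

lemma carrier_typing: "\<Gamma> \<turnstile> D \<Ztypecolon> DCPO_bot 0 1 1 \<Longrightarrow> \<Gamma> \<turnstile> carrier D \<Ztypecolon> Univ 1"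
  unfolding carrier_def DCPO_bot_def by (rule ty_Fst)

lemma order_typing:
  assumes "\<Gamma> \<turnstile> D \<Ztypecolon> DCPO_bot 0 1 1"
  shows "\<Gamma> \<turnstile> order D \<Ztypecolon> arrow (carrier D) (arrow (carrier D) (Univ 1))"
  using ty_Fst[of \<Gamma> "Snd D"] ty_Snd[OF assms[unfolded DCPO_bot_def]]
  by (fastforce simp: order_def carrier_def repl_def sub_arrow)

lemma scott_App_typing: "wf_ctx \<Gamma> \<Longrightarrow> \<Gamma> \<turnstile> x \<Ztypecolon> PcfT \<Longrightarrow> \<Gamma> \<turnstile> App (evid scott) x \<Ztypecolon> DCPO_bot 0 1 1"
  using ty_App[OF scott_typing[unfolded arrow_def], of \<Gamma> x] by (simp add: repl0_lift)

lemma conv_arrow: "A \<cong> A' \<Longrightarrow> B \<cong> B' \<Longrightarrow> arrow A B \<cong> arrow A' B'"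
  unfolding arrow_def lift_eq_sub by (intro cong_Pi conv_sub)

lemma conv_ascribe: "App (Lam T (Var 0)) t \<cong> t"
  using beta[of T "Var 0" t] by (simp add: repl_def)

abbreviation mkD :: "tm \<Rightarrow> tm \<Rightarrow> tm \<Rightarrow> tm \<Rightarrow> tm \<Rightarrow> tm" where
  "mkD X r a b c \<equiv> App (App (App (App (App (evid mk_dcpo) X) r) a) b) c"

lemma mk_dcpo_conv: "carrier (mkD X r a b c) \<cong> X" "order (mkD X r a b c) \<cong> r"
proof -
  \<comment> \<open>Only the shape of the term matters: the annotations and the proof part
    \<open>q\<close> stay existential. Under the five binders, \<open>X\<close> is
    \<open>Var 4\<close> and \<open>r\<close> is \<open>Var 3\<close>.\<close>
  have "\<exists>A1 A2 A3 A4 A5 T U V U' V' q. evid mk_dcpo = Lam A1 (Lam A2 (Lam A3 (Lam A4 (Lam A5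
          (App (Lam T (Var 0)) (Pair U V (Var 4) (Pair U' V' (Var 3) q)))))))"
    unfolding evid_def[of mk_dcpo] by (intro exI) (simp only: mk_dcpo_def macros elab_simps)
  then obtain A1 A2 A3 A4 A5 T U V U' V' q where
    e: "evid mk_dcpo = Lam A1 (Lam A2 (Lam A3 (Lam A4 (Lam A5
          (App (Lam T (Var 0)) (Pair U V (Var 4) (Pair U' V' (Var 3) q)))))))" by blast
  define \<sigma> where "\<sigma> = case_nat c (case_nat b (case_nat a (case_nat r (case_nat X Var))))"
  have "mkD X r a b c \<cong> sub \<sigma> (App (Lam T (Var 0)) (Pair U V (Var 4) (Pair U' V' (Var 3) q)))"
    unfolding \<sigma>_def by (rule beta_sub)+ (simp only: e sub_Var, rule conv_refl)
  also have "\<dots> = App (Lam (sub \<sigma> T) (Var 0))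
      (Pair (sub \<sigma> U) (sub (up \<sigma>) V) X (Pair (sub \<sigma> U') (sub (up \<sigma>) V') r (sub \<sigma> q)))"
    by (simp add: up_simps \<sigma>_def eval_nat_numeral)
  finally have p: "mkD X r a b c \<cong>
      Pair (sub \<sigma> U) (sub (up \<sigma>) V) X (Pair (sub \<sigma> U') (sub (up \<sigma>) V') r (sub \<sigma> q))"
    by (rule conv_trans[OF _ conv_ascribe])
  show "carrier (mkD X r a b c) \<cong> X"
    unfolding carrier_def by (rule conv_trans[OF cong_Fst[OF p] fst_pair])
  have "Snd (mkD X r a b c) \<cong> Pair (sub \<sigma> U') (sub (up \<sigma>) V') r (sub \<sigma> q)"
    by (rule conv_trans[OF cong_Snd[OF p] snd_pair])
  then show "order (mkD X r a b c) \<cong> r"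
    unfolding order_def by (rule conv_trans[OF cong_Fst fst_pair])
qed

lemma conv_dcpo:
  assumes "D \<cong> mkD X r a b c" shows "carrier D \<cong> X" "order D \<cong> r"
  using cong_Fst[OF assms] cong_Fst[OF cong_Snd[OF assms]] mk_dcpo_conv conv_trans
  unfolding carrier_def order_def by blast+

lemma nat_dcpo_conv: "\<exists>a b c. evid nat_dcpo \<cong> mkD lift_nat lift_nat_order a b c"
proof -
  have "\<exists>T a b c. evid nat_dcpo = App (Lam T (Var 0)) (mkD lift_nat lift_nat_order a b c)"
    unfolding evid_def[of nat_dcpo]
    by (intro exI) (simp only: nat_dcpo_def macros elab_simps domain_defs eval_simps)
  then show ?thesis using conv_ascribe by metis
qed

lemma arr_dcpo_conv:
  fixes D E defines "\<sigma> \<equiv> case_nat E (case_nat D Var)"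
  shows "\<exists>a b c. App (App (evid arr_dcpo) D) E \<cong>
    mkD (sub \<sigma> (cont_maps (Var 1) (Var 0))) (sub \<sigma> (pointwise_order (Var 1) (Var 0))) a b c"
proof -
  have "\<exists>A1 A2 T a b c. evid arr_dcpo = Lam A1 (Lam A2 (App (Lam T (Var 0))
      (mkD (cont_maps (Var 1) (Var 0)) (pointwise_order (Var 1) (Var 0)) a b c)))"
    unfolding evid_def[of arr_dcpo]
    by (intro exI) (simp only: arr_dcpo_def Let_def macros elab_simps domain_defs eval_simps)
  then obtain A1 A2 T a b c where e: "evid arr_dcpo = Lam A1 (Lam A2 (App (Lam T (Var 0))
      (mkD (cont_maps (Var 1) (Var 0)) (pointwise_order (Var 1) (Var 0)) a b c)))" by blast
  have "App (App (evid arr_dcpo) D) E \<cong> sub \<sigma> (App (Lam T (Var 0))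
      (mkD (cont_maps (Var 1) (Var 0)) (pointwise_order (Var 1) (Var 0)) a b c))"
    unfolding \<sigma>_def by (rule beta_sub)+ (simp only: e sub_Var, rule conv_refl)
  \<comment> \<open>\<open>evid mk_dcpo\<close> is closed, so the substitution passes to the
    arguments of \<open>mkD\<close>; the substituted proofs are the existential witnesses.\<close>
  from conv_trans[OF this conv_sub[OF conv_ascribe]] show ?thesis
    by (auto simp: proves_rules(3)[OF mk_dcpo])
qed

abbreviation scottInd :: "tm \<Rightarrow> tm" where
  "scottInd \<equiv> PcfInd (DCPO_bot 0 1 1) (evid nat_dcpo) (App (App (evid arr_dcpo) (Var 1)) (Var 0))"

lemma scott_conv: "App (evid scott) x \<cong> scottInd x"
proof -
  have "\<exists>T. evid scott = Lam PcfT (App (Lam T (Var 0)) (scottInd (Var 0)))"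
    unfolding evid_def[of scott] by (intro exI) (simp only: scott_def macros elab_simps
      domain_defs eval_simps)
  then obtain T where e: "evid scott = Lam PcfT (App (Lam T (Var 0)) (scottInd (Var 0)))" by blast
  have "App (evid scott) x \<cong> sub (case_nat x Var) (App (Lam T (Var 0)) (scottInd (Var 0)))"
    by (rule beta_sub) (simp only: e sub_Var, rule conv_refl)
  from conv_trans[OF this conv_sub[OF conv_ascribe]] show ?thesis
    by (simp add: DCPO_bot_sub[simplified] proves_rules(3)[OF nat_dcpo]
      proves_rules(3)[OF arr_dcpo] up_simps lift_Var)
qed

lemma scott_Iota: "App (evid scott) Iota \<cong> evid nat_dcpo"
  by (rule conv_trans[OF scott_conv iota_comp])

lemma scott_Arr:
  "App (evid scott) (Arr s t) \<cong> App (App (evid arr_dcpo) (App (evid scott) s)) (App (evid scott) t)"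
proof -
  have "App (evid scott) (Arr s t) \<cong>
      inst4 s t (scottInd s) (scottInd t) (App (App (evid arr_dcpo) (Var 1)) (Var 0))"
    by (rule conv_trans[OF scott_conv arr_comp])
  also have "\<dots> = App (App (evid arr_dcpo) (scottInd s)) (scottInd t)"
    by (simp add: inst4_def proves_rules(3)[OF arr_dcpo])
  \<comment> \<open>The recursive results appear as \<open>scottInd\<close> and are folded back into
    applications of the interpretation.\<close>
  finally show ?thesis
    by (rule conv_trans) (intro cong_App conv_refl conv_sym[OF scott_conv])
qed

theorem theorem9p1:
  shows "\<exists>S. [] \<turnstile> S \<Ztypecolon> arrow PcfT (DCPO_bot 0 1 1) \<and> scott_iota S \<and> scott_arr S"
proof (intro exI conjI)
  show "[] \<turnstile> evid scott \<Ztypecolon> arrow PcfT (DCPO_bot 0 1 1)" by (rule scott_typing[OF wf_nil])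
next
  obtain a b c where "App (evid scott) Iota \<cong> mkD lift_nat lift_nat_order a b c"
    using nat_dcpo_conv scott_Iota conv_trans by blast
  note c = conv_dcpo[OF this]
  have t: "[] \<turnstile> App (evid scott) Iota \<Ztypecolon> DCPO_bot 0 1 1"
    by (rule scott_App_typing[OF wf_nil ty_Iota[OF wf_nil]])
  have L: "[] \<turnstile> lift_nat \<Ztypecolon> Univ 1"
    by (rule infer_typing[OF _ wf_nil]) (simp only: domain_defs known eval_simps cong: eval_congs)
  have O: "[] \<turnstile> lift_nat_order \<Ztypecolon> arrow lift_nat (arrow lift_nat (Univ 1))"
    by (rule infer_typing[OF _ wf_nil]) (simp only: domain_defs known eval_simps cong: eval_congs)
  \<comment> \<open>The type of the order mentions the carrier that the interpretation computes.
    Converting it to the one with \<open>lift_nat\<close> requires the target to be a type.\<close>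
  have "is_type [] (arrow lift_nat (arrow lift_nat (Univ 1)))"
    using L ty_Univ[OF wf_nil, of 1] by (intro is_type_arrow) (auto simp: is_type_def)
  then have "[] \<turnstile> order (App (evid scott) Iota) \<Ztypecolon> arrow lift_nat (arrow lift_nat (Univ 1))"
    by (rule is_type_conv[OF order_typing[OF t] conv_arrow[OF c(1) conv_arrow[OF c(1) conv_refl]]])
  then show "scott_iota (evid scott)"
    unfolding scott_iota_def def_eq_def using carrier_typing[OF t] L O c by blast
next
  let ?\<Gamma> = "[PcfT, PcfT]" and ?D = "App (evid scott) (Var 1)" and ?E = "App (evid scott) (Var 0)"
  let ?F = "App (evid scott) (Arr (Var 1) (Var 0))"
  let ?\<sigma> = "case_nat ?E (case_nat ?D Var)"
  have w: "wf_ctx ?\<Gamma>" by (blast intro: wf_cons wf_nil ty_Pcf)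
  obtain a b c where "?F \<cong> mkD (sub ?\<sigma> (cont_maps (Var 1) (Var 0)))
      (sub ?\<sigma> (pointwise_order (Var 1) (Var 0))) a b c"
    using arr_dcpo_conv scott_Arr conv_trans by blast
  note c = conv_dcpo[OF this]
  \<comment> \<open>The environment is pushed through both formers, which weaken \<open>?D\<close>
    and \<open>?E\<close> under their binders just as the substitution does.\<close>
  have s: "sub ?\<sigma> (cont_maps (Var 1) (Var 0)) = cont_maps ?D ?E"
      "sub ?\<sigma> (pointwise_order (Var 1) (Var 0)) = pointwise_order ?D ?E"
    by (simp_all only: domain_defs known eval_simps)
  note c = c[unfolded s]
  have v: "?\<Gamma> \<turnstile> Var 1 \<Ztypecolon> PcfT" "?\<Gamma> \<turnstile> Var 0 \<Ztypecolon> PcfT"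
    using ty_var[OF w, of 1] ty_var[OF w, of 0] by (simp_all add: lift_def)
  have t: "?\<Gamma> \<turnstile> ?F \<Ztypecolon> DCPO_bot 0 1 1"
    by (rule scott_App_typing[OF w ty_Arr[OF v]])
  \<comment> \<open>The checker runs once more, in a context of two PCF types and with
    \<open>evid scott\<close> opaque; here the function space is seen to stay in
    \<open>Univ 1\<close>.\<close>
  have L: "?\<Gamma> \<turnstile> cont_maps ?D ?E \<Ztypecolon> Univ 1"
    by (rule infer_typing[OF _ w]) (simp only: domain_defs known eval_simps cong: eval_congs)
  have O: "?\<Gamma> \<turnstile> pointwise_order ?D ?E \<Ztypecolon> arrow (cont_maps ?D ?E) (arrow (cont_maps ?D ?E) (Univ 1))"
    by (rule infer_typing[OF _ w]) (simp only: domain_defs known eval_simps cong: eval_congs)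
  have "is_type ?\<Gamma> (arrow (cont_maps ?D ?E) (arrow (cont_maps ?D ?E) (Univ 1)))"
    using L ty_Univ[OF w, of 1] by (intro is_type_arrow) (auto simp: is_type_def)
  then have "?\<Gamma> \<turnstile> order ?F \<Ztypecolon> arrow (cont_maps ?D ?E) (arrow (cont_maps ?D ?E) (Univ 1))"
    by (rule is_type_conv[OF order_typing[OF t] conv_arrow[OF c(1) conv_arrow[OF c(1) conv_refl]]])
  moreover have "lift 2 (evid scott) = evid scott"
    unfolding lift_def by (rule proves_rules(2)[OF scott])
  ultimately show "scott_arr (evid scott)"
    unfolding scott_arr_def def_eq_def Let_def using carrier_typing[OF t] L O c by simp
qed

end
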